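(* For $n \geq 2$ and $i>j$, we have the following two-point correlations: $$c_{i,j}(n)=\begin{cases} \frac{n}{\binom{n+j}{2}}-\frac{n}{\binom{n+i}{2}}, & \text{ if }j < i < n, \\ \frac{n(j+1)}{\binom{n+j}{2}}-\frac{n(j-1)}{\binom{n+j-1}{2}}-\frac{n}{\binom{2n}{2}}, & \text{ if } j < i = n. \end{cases}$$
   Context: Consider the continuous multispecies TASEP on a ring with type $(1,\ldots,1)$ (an $n$-tuple of ones): there are $n$ particles, each carrying a distinct label from $[n]=\{1,\ldots,n\}$. This is the distribution of labelled particles on the continuous ring $[0,1)$ obtained as the limit, as the number of sites $L\to\infty$ (with the numbers of labelled particles fixed, unoccupied sites treated as label $n+1$, ring rescaled to $[0,1)$), of the stationary distribution of the multispecies TASEP on a ring with $L$ sites in which each particle with label $i$ jumps left at rate 1, swapping with the left neighbour when that neighbour has a larger label. Let $c_{i,j}(n)$ denote the probability, in this limiting distribution, that the particles labelled $i$ and $j$ are next to each other with the particle labelled $i$ immediately to the left of the particle labelled $j$. *)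

theory Defs
  imports "HOL-Probability.Probability"
begin

text \<open>
  Multispecies TASEP of type \<open>(1,\<dots>,1)\<close> on a ring with \<open>L\<close> sites. A state is the word of labels
  read from left to right along the sites \<open>0,\<dots>,L-1\<close>; empty sites carry the label \<open>n + 1\<close>.
\<close>

definition tasep_states :: "nat \<Rightarrow> nat \<Rightarrow> nat list set" where
  "tasep_states n L =
     {w. length w = L \<and> set w \<subseteq> {1..n + 1} \<and> (\<forall>k\<in>{1..n}. count_list w k = 1)}"

definition left_site :: "nat \<Rightarrow> nat \<Rightarrow> nat" where
  "left_site L s = (s + L - 1) mod L"

definition swap_left :: "nat list \<Rightarrow> nat \<Rightarrow> nat list" where
  "swap_left w s = w[left_site (length w) s := w ! s, s := w ! left_site (length w) s]"

text \<open>
  Only left neighbours with a strictly larger label are overtaken, so the largest label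
  \<open>n + 1\<close> never jumps.
\<close>

definition tasep_rate :: "nat list \<Rightarrow> nat list \<Rightarrow> real" where
  "tasep_rate w w' =
     real (card {s. s < length w \<and> w ! left_site (length w) s > w ! s \<and> swap_left w s = w'})"

definition tasep_stationary :: "nat \<Rightarrow> nat \<Rightarrow> nat list pmf \<Rightarrow> bool" where
  "tasep_stationary n L p \<longleftrightarrow>
     set_pmf p \<subseteq> tasep_states n L \<and>
     (\<forall>w\<in>tasep_states n L.
        (\<Sum>w'\<in>tasep_states n L. pmf p w' * tasep_rate w' w) =
        pmf p w * (\<Sum>w'\<in>tasep_states n L. tasep_rate w w'))"

definition tasep_pmf :: "nat \<Rightarrow> nat \<Rightarrow> nat list pmf" where
  "tasep_pmf n L = (THE p. tasep_stationary n L p)"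

definition site_of :: "nat list \<Rightarrow> nat \<Rightarrow> nat" where
  "site_of w k = (THE s. s < length w \<and> w ! s = k)"

definition rescaled_positions :: "nat \<Rightarrow> nat list \<Rightarrow> nat \<Rightarrow> real" where
  "rescaled_positions n w = (\<lambda>k\<in>{1..n}. real (site_of w k) / real (length w))"

text \<open>
  A configuration on the continuous ring \<open>[0,1)\<close> maps each label \<open>k \<in> {1..n}\<close> to the position
  of the particle carrying it.
\<close>

definition ring_space :: "nat \<Rightarrow> (nat \<Rightarrow> real) measure" where
  "ring_space n = PiM {1..n} (\<lambda>_. restrict_space borel {0..<1})"

text \<open>
  Continuous functions on the \<open>n\<close>-fold product of the circle \<open>\<real>/\<int>\<close>, given as continuous
  functions with period 1 in each of the coordinates \<open>1,\<dots>,n\<close>. They are only ever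
  evaluated at extensional functions on \<open>{1..n}\<close>, so the other coordinates play no role.
\<close>

definition ring_continuous :: "nat \<Rightarrow> ((nat \<Rightarrow> real) \<Rightarrow> real) \<Rightarrow> bool" where
  "ring_continuous n f \<longleftrightarrow>
     continuous_on UNIV f \<and> (\<forall>x. \<forall>k\<in>{1..n}. f (x(k := x k + 1)) = f x)"

text \<open>Weak convergence of the rescaled stationary distributions on the ring.\<close>

definition is_continuous_tasep :: "nat \<Rightarrow> (nat \<Rightarrow> real) measure \<Rightarrow> bool" where
  "is_continuous_tasep n M \<longleftrightarrow>
     prob_space M \<and> sets M = sets (ring_space n) \<and>
     (\<forall>f. ring_continuous n f \<longrightarrow>
        (\<lambda>L. measure_pmf.expectation (tasep_pmf n L) (\<lambda>w. f (rescaled_positions n w)))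
          \<longlonglongrightarrow> integral\<^sup>L M f)"

definition continuous_tasep :: "nat \<Rightarrow> (nat \<Rightarrow> real) measure" where
  "continuous_tasep n = (THE M. is_continuous_tasep n M)"

text \<open>
  For positions \<open>a, b \<in> [0,1)\<close>, \<open>frac (b - a)\<close> is the length of the arc from \<open>a\<close> rightwards
  to \<open>b\<close>. So the event says that \<open>j\<close> is the first particle met when moving right from \<open>i\<close>.
\<close>

definition immediately_left :: "nat \<Rightarrow> nat \<Rightarrow> nat \<Rightarrow> (nat \<Rightarrow> real) \<Rightarrow> bool" where
  "immediately_left n i j x \<longleftrightarrow>
     (\<forall>k\<in>{1..n} - {i, j}. frac (x j - x i) < frac (x k - x i))"

definition two_point_correlation :: "nat \<Rightarrow> nat \<Rightarrow> nat \<Rightarrow> real" where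
  "two_point_correlation i j n =
     measure (continuous_tasep n) {x \<in> space (continuous_tasep n). immediately_left n i j x}"

end

theory Submission
  imports Defs
begin

text \<open>
  By Ferrari and Martin, the stationary law on \<open>L\<close> sites is the law of the last row of a multiline
  queue whose rows are independent uniform sets of \<open>1, 2, \<dots>, n\<close> sites: a jump at a site of the last row
  can be passed up through the rows by a bijection. As \<open>L\<close> grows, the rows become independent
  uniform points of \<open>[0,1)\<close>. The last row depends on them only through their order, which almost
  surely agrees with that of the discretised points for large \<open>L\<close>; so the continuous law is explicit
  and the probability in question is the limit of its discrete counterparts.

  Let \<open>N k l\<close> be the expected number of adjacent pairs with a label above \<open>k\<close> on the left and a label at
  most \<open>l \<le> k\<close> on the right; \<open>c i j\<close> is a mixed second difference of \<open>N\<close>. Only three classes of labels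
  matter for \<open>N k l\<close>, so by uniqueness of the stationary law it can be computed from rows \<open>X, Y, Z\<close> of
  \<open>l, k, n\<close> points. Such a pair consists of an unused service and the next service, with an arrival
  of the first class in between. Read from the unused service on, the complementary
  configurations are words in which every suffix contains at least as many \<open>Z\<close> as \<open>Y\<close> and at least
  as many \<open>Y\<close> as \<open>X\<close>, with a condition on the letters before the first \<open>Z\<close>. They are counted by
  sums of numbers of standard Young tableaux with three rows.
\<close>

section \<open>Queues on a ring\<close>

text \<open>On a ring a queue has no first moment, and the recursion for its length may have many
  solutions: with as many arrivals as services a constant can be added. Hence departures are defined
  through intervals, and when services are in excess any solution that is empty somewhere determines
  them. The complementary configurations are counted because "nobody is served" is an inequality for
  every interval, that is, a ballot condition, whereas "somebody is served" is existential; an empty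
  row \<open>X\<close> gives the total from which they are subtracted. A word has one letter per
  site, so only pairwise disjoint rows are counted exactly. Overlapping rows form a vanishing
  fraction as \<open>L\<close> grows, and the limit is thereby simpler than any count on finitely
  many sites. Adjacency is not a continuous function on the torus. Weak convergence therefore only
  identifies the limit law; the probability is reached by discretising one and the same family of
  uniform points, for which adjacency is eventually constant in \<open>L\<close>.\<close>

definition cyc_int :: "'a::linorder \<Rightarrow> 'a \<Rightarrow> 'a set" where
  "cyc_int t s = {u. if t \<le> s then t \<le> u \<and> u \<le> s else t \<le> u \<or> u \<le> s}"

text \<open>
  Sites are read as times, \<open>A\<close> as arrivals and \<open>S\<close> as services of a queue. The service at \<open>s\<close> is used
  iff some cyclic interval ending at \<open>s\<close> contains at least as many arrivals as services.
\<close>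

definition departures :: "'a::linorder set \<Rightarrow> 'a set \<Rightarrow> 'a set" where
  "departures A S = {s \<in> S. \<exists>t\<in>A. card (S \<inter> cyc_int t s) \<le> card (A \<inter> cyc_int t s)}"

text \<open>This is a jump as seen by the set of sites with label at most \<open>k\<close>: a larger
  label on the left counts as an empty site.\<close>

definition hop :: "nat \<Rightarrow> nat \<Rightarrow> nat set \<Rightarrow> nat set" where
  "hop L x A =
     (if x \<in> A \<and> left_site L x \<notin> A then insert (left_site L x) (A - {x}) else A)"

text \<open>
  \<open>q s\<close> is the queue length after time \<open>s\<close>; the truncated subtraction accounts for unused services.
\<close>

definition is_queue :: "nat \<Rightarrow> nat set \<Rightarrow> nat set \<Rightarrow> (nat \<Rightarrow> nat) \<Rightarrow> bool" where
  "is_queue L A S q \<longleftrightarrow>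
     (\<forall>s<L. q s = q (left_site L s) + of_bool (s \<in> A) - of_bool (s \<in> S))"

lemma left_site_eq: "s < L \<Longrightarrow> left_site L s = (if s = 0 then L - 1 else s - 1)"
  by (auto simp: left_site_def mod_if)

lemma left_site_less: "s < L \<Longrightarrow> left_site L s < L"
  by (simp add: left_site_def)

lemma left_site_inj: "s < L \<Longrightarrow> t < L \<Longrightarrow> left_site L s = left_site L t \<Longrightarrow> s = t"
  by (auto simp: left_site_eq split: if_splits)

lemma left_site_neq: "s < L \<Longrightarrow> 2 \<le> L \<Longrightarrow> left_site L s \<noteq> s"
  by (auto simp: left_site_eq)

lemma bij_left_site: "bij_betw (left_site L) {..<L} {..<L}"
proof -
  have inj: "inj_on (left_site L) {..<L}"
    using left_site_inj by (auto intro: inj_onI)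
  then show ?thesis
    using endo_inj_surj[OF _ _ inj] left_site_less by (auto simp: bij_betw_def)
qed

lemma departures_subset: "departures A S \<subseteq> S"
  by (auto simp: departures_def)

lemma departures_mono:
  assumes "A \<subseteq> B" "finite B" shows "departures A S \<subseteq> departures B S"
proof
  fix s assume "s \<in> departures A S"
  then obtain t where t: "s \<in> S" "t \<in> A" "card (S \<inter> cyc_int t s) \<le> card (A \<inter> cyc_int t s)"
    by (auto simp: departures_def)
  have "card (A \<inter> cyc_int t s) \<le> card (B \<inter> cyc_int t s)"
    using assms by (intro card_mono) auto
  then show "s \<in> departures B S" using t assms by (force simp: departures_def)
qed

lemma cyc_int_step:
  assumes "t < L" "s < L" "t \<noteq> s" "B \<subseteq> {..<L}"
  shows "card (B \<inter> cyc_int t s) = card (B \<inter> cyc_int t (left_site L s)) + of_bool (s \<in> B)"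
proof -
  have eq: "B \<inter> cyc_int t s = B \<inter> cyc_int t (left_site L s) \<union> (B \<inter> {s})"
    using assms by (auto simp: cyc_int_def left_site_eq split: if_splits)
  have ni: "s \<notin> cyc_int t (left_site L s)"
    using assms by (auto simp: cyc_int_def left_site_eq split: if_splits)
  have "finite B" using assms finite_subset by blast
  then show ?thesis unfolding eq using ni by (subst card_Un_disjoint) auto
qed

lemma cyc_int_self: "cyc_int s s = {s::nat}"
  by (auto simp: cyc_int_def)

lemma cyc_int_full: "2 \<le> L \<Longrightarrow> s < L \<Longrightarrow> B \<subseteq> {..<L} \<Longrightarrow> B \<inter> cyc_int s (left_site L s) = B"
  by (auto simp: cyc_int_def left_site_eq split: if_splits)

text \<open>Lindley's formula: the queue length is the largest excess of arrivals over services in a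
  cyclic interval that starts with an arrival and ends at \<open>s\<close>, or 0 if no excess is
  positive.\<close>

lemma queue_exists:
  assumes L: "2 \<le> L" and A: "A \<subseteq> {..<L}" and S: "S \<subseteq> {..<L}" and c: "card A \<le> card S"
  shows "\<exists>q. is_queue L A S q \<and>
    departures A S = {s \<in> S. 0 < q (left_site L s) + of_bool (s \<in> A)}"
proof -
  have fin: "finite A" "finite S" using A S finite_subset by blast+
  define f where "f t s = int (card (A \<inter> cyc_int t s)) - int (card (S \<inter> cyc_int t s))" for t s
  define q where "q s = nat (Max (insert 0 ((\<lambda>t. f t s) ` A)))" for s
  let ?d = "\<lambda>s. int (of_bool (s \<in> A)) - int (of_bool (s \<in> S))"
  have step: "f t s = f t (left_site L s) + ?d s" if "t \<in> A" "s < L" "t \<noteq> s" for t s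
    using that cyc_int_step[of t L s A] cyc_int_step[of t L s S] A S by (auto simp: f_def)
  have self: "f s s = ?d s" for s
    by (auto simp: f_def cyc_int_self)
  \<comment> \<open>Here the interval is the whole ring, so \<open>card A \<le> card S\<close>
    excludes a positive excess. An interval that attains a positive maximum can thus always be
    extended by one more site without closing up.\<close>
  have full: "f s (left_site L s) \<le> 0" if "s < L" for s
    using cyc_int_full[OF L that] A S c by (simp add: f_def)
  have q_ge: "f t s \<le> int (q s)" if "t \<in> A" for t s
    using fin that Max_ge[of "insert 0 ((\<lambda>t. f t s) ` A)" "f t s"] by (auto simp: q_def)
  have q_att: "q s = 0 \<or> (\<exists>t\<in>A. f t s = int (q s))" for s
    using fin Max_in[of "insert 0 ((\<lambda>t. f t s) ` A)"] by (fastforce simp: q_def)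
  have rec: "q s = q (left_site L s) + of_bool (s \<in> A) - of_bool (s \<in> S)" if s: "s < L" for s
  proof (rule antisym)
    show "q s \<le> q (left_site L s) + of_bool (s \<in> A) - of_bool (s \<in> S)"
    proof (cases "q s = 0")
      case False
      then obtain t where t: "t \<in> A" "f t s = int (q s)" using q_att[of s] by metis
      show ?thesis
      proof (cases "t = s")
        case True
        then show ?thesis using t self[of s] by (auto split: if_splits)
      next
        case False
        then show ?thesis using t step[OF t(1) s False] q_ge[OF t(1), of "left_site L s"] by linarith
      qed
    qed auto
    show "q (left_site L s) + of_bool (s \<in> A) - of_bool (s \<in> S) \<le> q s"
    proof (cases "q (left_site L s) = 0")
      case True
      then show ?thesis using q_ge[of s s] self[of s] by (auto split: if_splits)
    next
      case False
      then obtain t where t: "t \<in> A" "f t (left_site L s) = int (q (left_site L s))"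
        using q_att[of "left_site L s"] by metis
      have "t \<noteq> s" using full[OF s] t False by auto
      then show ?thesis using step[OF t(1) s] t q_ge[OF t(1), of s] by linarith
    qed
  qed
  have dep: "s \<in> departures A S \<longleftrightarrow> 0 < q (left_site L s) + of_bool (s \<in> A)" if s: "s \<in> S" for s
  proof -
    have sL: "s < L" using s S by auto
    have "s \<in> departures A S \<longleftrightarrow> (\<exists>t\<in>A. 0 \<le> f t s)"
      using s by (auto simp: departures_def f_def)
    also have "\<dots> \<longleftrightarrow> 0 < q (left_site L s) + of_bool (s \<in> A)"
    proof
      assume "\<exists>t\<in>A. 0 \<le> f t s"
      then obtain t where t: "t \<in> A" "0 \<le> f t s" by blast
      show "0 < q (left_site L s) + of_bool (s \<in> A)"
      proof (cases "t = s")
        case False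
        then show ?thesis using t step[OF t(1) sL False] q_ge[OF t(1), of "left_site L s"] s
          by (auto split: if_splits)
      qed (use t in auto)
    next
      assume pos: "0 < q (left_site L s) + of_bool (s \<in> A)"
      show "\<exists>t\<in>A. 0 \<le> f t s"
      proof (cases "s \<in> A")
        case True
        then show ?thesis using self[of s] by (auto intro!: bexI[of _ s])
      next
        case False
        then have "q (left_site L s) \<noteq> 0" using pos by auto
        then obtain t where t: "t \<in> A" "f t (left_site L s) = int (q (left_site L s))"
          using q_att[of "left_site L s"] by metis
        have "t \<noteq> s" using t False by auto
        then show ?thesis using step[OF t(1) sL] t \<open>q (left_site L s) \<noteq> 0\<close> s
          by (intro bexI[of _ t]) auto
      qed
    qed
    finally show ?thesis .
  qed
  show ?thesis
    using rec dep departures_subset[of A S] by (intro exI[of _ q]) (auto simp: is_queue_def)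
qed

lemma card_eq_sum_of_bool: "B \<subseteq> {..<L} \<Longrightarrow> card B = (\<Sum>s<L. of_bool (s \<in> B) :: nat)" for L :: nat
  by (simp add: of_bool_def sum.If_cases Int_absorb1)

text \<open>Conservation of customers: summed around the ring, the queue lengths before and after
  each site cancel, and arrivals and departures remain.\<close>

lemma card_departures:
  fixes L :: nat
  assumes L: "2 \<le> L" and A: "A \<subseteq> {..<L}" and S: "S \<subseteq> {..<L}" and c: "card A \<le> card S"
  shows "card (departures A S) = card A"
proof -
  obtain q where q: "is_queue L A S q"
    and d: "departures A S = {s \<in> S. 0 < q (left_site L s) + of_bool (s \<in> A)}"
    using queue_exists[OF assms] by blast
  have "q s + of_bool (s \<in> departures A S) = q (left_site L s) + of_bool (s \<in> A)" if "s < L" for s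
    using q that unfolding d is_queue_def by auto
  then have "(\<Sum>s<L. q s + of_bool (s \<in> departures A S)) = (\<Sum>s<L. q (left_site L s) + of_bool (s \<in> A))"
    by (intro sum.cong) auto
  moreover have "(\<Sum>s<L. q (left_site L s)) = (\<Sum>s<L. q s)"
    using sum.reindex_bij_betw[OF bij_left_site] by blast
  moreover have "departures A S \<subseteq> {..<L}" using departures_subset S by blast
  ultimately show ?thesis using A by (simp add: sum.distrib card_eq_sum_of_bool)
qed

text \<open>The recursion is monotone in the queue length, so the comparison, trivial at a zero of
  \<open>q\<close>, propagates once around the ring.\<close>

lemma is_queue_le:
  assumes q: "is_queue L A S q" and q': "is_queue L A S q'" and z: "z < L" "q z = 0" and s: "s < L"
  shows "q s \<le> q' s"
proof -
  have "q ((z + d) mod L) \<le> q' ((z + d) mod L)" for d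
  proof (induction d)
    case (Suc d)
    have "left_site L ((z + Suc d) mod L) = (z + d) mod L"
      using z mod_less_divisor[of L "z + d"] by (auto simp: left_site_eq mod_Suc Suc_lessI)
    then show ?case using Suc q q' z
      by (auto simp: is_queue_def)
  qed (use z in auto)
  from this[of "s + L - z"] show ?thesis using z s by (simp add: add.commute)
qed

text \<open>Strictly more services than arrivals leave some service idle, and the queue of
  \<open>queue_exists\<close> is empty there. By \<open>is_queue_le\<close> in both directions it
  coincides with \<open>q\<close>. This lets a queue that was modified by hand be used for computing
  departures.\<close>

lemma departures_eq_queue:
  assumes L: "2 \<le> L" and A: "A \<subseteq> {..<L}" and S: "S \<subseteq> {..<L}" and c: "card A < card S"
    and q: "is_queue L A S q" and z: "z < L" "q z = 0"
  shows "departures A S = {s \<in> S. 0 < q (left_site L s) + of_bool (s \<in> A)}"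
proof -
  obtain p where p: "is_queue L A S p"
    and d: "departures A S = {s \<in> S. 0 < p (left_site L s) + of_bool (s \<in> A)}"
    using queue_exists[OF L A S] c by auto
  have "card (departures A S) < card S" using card_departures[OF L A S] c by simp
  then obtain y where y: "y \<in> S" "y \<notin> departures A S"
    using departures_subset[of A S] by (metis less_irrefl subset_antisym subset_iff)
  then have "p y = 0" "y < L" using p S unfolding d is_queue_def by auto
  then have "p s = q s" if "s < L" for s
    using is_queue_le[OF p q] is_queue_le[OF q p z] that by (simp add: antisym)
  then have "p (left_site L s) = q (left_site L s)" if "s \<in> S" for s
    using that S left_site_less by blast
  then show ?thesis unfolding d by auto
qed

section \<open>Effect of a hop on a queue\<close>

lemma hop_subset: "A \<subseteq> {..<L} \<Longrightarrow> x < L \<Longrightarrow> hop L x A \<subseteq> {..<L}"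
  by (auto simp: hop_def left_site_less)

lemma card_hop: "finite A \<Longrightarrow> card (hop L x A) = card A"
  by (auto simp: hop_def card_insert_if card_Suc_Diff1 simp del: card_Diff_insert)

lemma eq_if_eq_below:
  fixes P :: "nat set"
  assumes "\<And>s. s < L \<Longrightarrow> s \<in> P \<longleftrightarrow> s \<in> Q" "P \<subseteq> {..<L}" "Q \<subseteq> {..<L}"
  shows "P = Q"
  using assms by blast

text \<open>A move between \<open>x\<close> and its left neighbour \<open>y\<close> changes the
  queue length at \<open>y\<close> only. The excluded situation, a service at \<open>y\<close> and
  none at \<open>x\<close>, is the one where a customer at \<open>x\<close> comes just too late for
  a service that could be used after the hop. Three sites are needed to keep \<open>x\<close>,
  \<open>y\<close> and the left neighbour \<open>w\<close> of \<open>y\<close> apart. A zero of the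
  new queue is recorded because \<open>departures_eq_queue\<close> asks for one.\<close>

lemma queue_hop:
  assumes L: "3 \<le> L" and x: "x < L" and q: "is_queue L A S q"
    and S': "S' = hop L x S \<and> (x \<in> S \<or> left_site L x \<notin> S) \<or>
             S' = S \<and> x \<in> S \<and> left_site L x \<notin> S"
    and z: "z < L" "q z = 0" and SL: "S \<subseteq> {..<L}"
  shows "\<exists>q' z'. is_queue L (hop L x A) S' q' \<and> z' < L \<and> q' z' = 0 \<and>
    {s \<in> S'. 0 < q' (left_site L s) + of_bool (s \<in> hop L x A)} =
    (if S' = S \<and> x \<in> S \<and> left_site L x \<notin> S then id else hop L x)
      {s \<in> S. 0 < q (left_site L s) + of_bool (s \<in> A)}"
proof -
  define y where "y = left_site L x"
  define w where "w = left_site L y"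
  have lt: "y < L" "w < L" using x by (auto simp: y_def w_def left_site_less)
  have ne: "x \<noteq> y" "y \<noteq> w" "x \<noteq> w"
    using x lt L unfolding y_def w_def by (auto simp: left_site_eq split: if_splits)
  have lx: "left_site L x = y" and ly: "left_site L y = w" by (auto simp: y_def w_def)
  have ls: "left_site L s \<noteq> y" if "s < L" "s \<noteq> x" for s
    using that x left_site_inj unfolding y_def by blast
  let ?A = "hop L x A"
  define q' where "q' = q(y := q w + of_bool (y \<in> ?A) - of_bool (y \<in> S'))"
  have qx: "q x = q y + of_bool (x \<in> A) - of_bool (x \<in> S)"
    and qy: "q y = q w + of_bool (y \<in> A) - of_bool (y \<in> S)"
    using q x lt lx ly unfolding is_queue_def by metis+
  have other: "s \<in> ?A \<longleftrightarrow> s \<in> A" "s \<in> S' \<longleftrightarrow> s \<in> S" if "s \<noteq> x" "s \<noteq> y" for s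
    using that S' by (auto simp: hop_def lx split: if_splits)
  have memA: "x \<in> ?A \<longleftrightarrow> x \<in> A \<and> y \<in> A" "y \<in> ?A \<longleftrightarrow> y \<in> A \<or> x \<in> A"
    using ne by (auto simp: hop_def lx)
  have memS: "(x \<in> hop L x S) = (x \<in> S \<and> y \<in> S)" "y \<in> hop L x S \<longleftrightarrow> y \<in> S \<or> x \<in> S"
    using ne by (auto simp: hop_def lx)
  have q'x: "q x = q' y + of_bool (x \<in> ?A) - of_bool (x \<in> S')"
    using S' unfolding qx qy q'_def memA lx by (auto simp: memS)
  have isq: "is_queue L ?A S' q'"
    unfolding is_queue_def
  proof (intro allI impI)
    fix s assume s: "s < L"
    consider "s = x" | "s = y" | "s \<noteq> x" "s \<noteq> y" by blast
    then show "q' s = q' (left_site L s) + of_bool (s \<in> ?A) - of_bool (s \<in> S')"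
    proof cases
      case 1
      then show ?thesis using q'x ne by (simp add: lx q'_def)
    next
      case 2
      then show ?thesis using ne by (simp add: ly q'_def)
    next
      case 3
      then show ?thesis using ls[OF s 3(1)] q s other[OF 3] by (simp add: q'_def is_queue_def)
    qed
  qed
  \<comment> \<open>Only the case that \<open>y\<close> was the empty site needs care. Then
    \<open>x\<close> is empty too, unless there is an arrival and no service at \<open>x\<close>; in
    that case there is no service at \<open>y\<close> either, so the queue was already empty at
    \<open>w\<close>.\<close>
  have zero: "\<exists>z'<L. q' z' = 0"
  proof (cases "z = y")
    case False
    then show ?thesis using z by (auto simp: q'_def)
  next
    case True
    have "q x = 0 \<or> q w = 0"
      using qx qy z True S' unfolding lx by (auto split: if_splits)
    moreover have "q' x = q x" "q' w = q w" using ne by (simp_all add: q'_def)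
    ultimately show ?thesis using x lt by metis
  qed
  have ext: "s \<in> {s \<in> S'. 0 < q' (left_site L s) + of_bool (s \<in> ?A)} \<longleftrightarrow>
     s \<in> (if S' = S \<and> x \<in> S \<and> y \<notin> S then id else hop L x)
      {s \<in> S. 0 < q (left_site L s) + of_bool (s \<in> A)}" if "s < L" for s
  proof -
    let ?D = "{s \<in> S. 0 < q (left_site L s) + of_bool (s \<in> A)}"
    have hD: "x \<in> hop L x ?D \<longleftrightarrow> x \<in> ?D \<and> y \<in> ?D" "y \<in> hop L x ?D \<longleftrightarrow> y \<in> ?D \<or> x \<in> ?D"
      using ne by (auto simp: hop_def lx)
    consider "s = x" | "s = y" | "s \<noteq> x" "s \<noteq> y" by blast
    then show ?thesis
    proof cases
      case 1
      show ?thesis unfolding 1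
        using S' hD(1) ne unfolding lx q'_def by (auto simp: memA memS lx ly qy)
    next
      case 2
      show ?thesis unfolding 2
        using S' hD(2) ne unfolding lx q'_def by (auto simp: memA memS lx ly qy)
    next
      case 3
      then have "s \<in> hop L x ?D \<longleftrightarrow> s \<in> ?D" by (auto simp: hop_def lx)
      then show ?thesis using 3 ls[OF that 3(1)] other[OF 3] by (simp add: q'_def)
    qed
  qed
  have S'L: "{s \<in> S'. 0 < q' (left_site L s) + of_bool (s \<in> ?A)} \<subseteq> {..<L}"
    using S' SL hop_subset[OF SL x] by auto
  have "(if S' = S \<and> x \<in> S \<and> y \<notin> S then id else hop L x)
      {s \<in> S. 0 < q (left_site L s) + of_bool (s \<in> A)} \<subseteq> {..<L}"
    using SL hop_subset[OF _ x, of "{s \<in> S. 0 < q (left_site L s) + of_bool (s \<in> A)}"] by auto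
  note eq = eq_if_eq_below[OF ext S'L this]
  obtain z' where "z' < L" "q' z' = 0" using zero by blast
  with isq eq show ?thesis unfolding lx by (intro exI[of _ q'] exI[of _ z'] conjI)
qed

lemma departures_full:
  fixes L :: nat
  assumes "2 \<le> L" "A \<subseteq> {..<L}" "S \<subseteq> {..<L}" "card A = card S"
  shows "departures A S = S"
  using card_departures[OF assms(1-3)] assms(4) card_subset_eq[OF _ departures_subset]
    finite_subset[OF assms(3)] by simp

lemma departures_hop_aux:
  assumes L: "3 \<le> L" and x: "x < L" and A: "A \<subseteq> {..<L}" and S: "S \<subseteq> {..<L}"
    and c: "card A < card S"
    and S': "S' = hop L x S \<and> (x \<in> S \<or> left_site L x \<notin> S) \<or>
             S' = S \<and> x \<in> S \<and> left_site L x \<notin> S"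
  shows "departures (hop L x A) S' =
    (if S' = S \<and> x \<in> S \<and> left_site L x \<notin> S then id else hop L x) (departures A S)"
proof -
  have L2: "2 \<le> L" using L by simp
  obtain q where q: "is_queue L A S q"
    and d: "departures A S = {s \<in> S. 0 < q (left_site L s) + of_bool (s \<in> A)}"
    using queue_exists[OF L2 A S] c by auto
  have "card (departures A S) < card S" using card_departures[OF L2 A S] c by simp
  then obtain z where "z \<in> S" "z \<notin> departures A S"
    using departures_subset[of A S] by (metis less_irrefl subset_antisym subset_iff)
  then have z: "z < L" "q z = 0" using q S unfolding d is_queue_def by auto
  obtain q' z' where q': "is_queue L (hop L x A) S' q'" "z' < L" "q' z' = 0"
    and d': "{s \<in> S'. 0 < q' (left_site L s) + of_bool (s \<in> hop L x A)} =
    (if S' = S \<and> x \<in> S \<and> left_site L x \<notin> S then id else hop L x)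
      {s \<in> S. 0 < q (left_site L s) + of_bool (s \<in> A)}"
    using queue_hop[OF L x q S' z S] by blast
  have fin: "finite A" "finite S" using A S finite_subset by blast+
  have "card (hop L x A) < card S'" using c S' card_hop fin by auto
  moreover have "S' \<subseteq> {..<L}" using S' S x hop_subset by blast
  ultimately show ?thesis
    using departures_eq_queue[OF L2 hop_subset[OF A x] _ _ q'] d d' by simp
qed

text \<open>For equal cardinalities the queue length is not determined, but then every service is
  used and both sides are the service set after the hop.\<close>

lemma departures_hop:
  assumes L: "3 \<le> L" and x: "x < L" and A: "A \<subseteq> {..<L}" and S: "S \<subseteq> {..<L}"
    and c: "card A \<le> card S" and xS: "x \<in> S \<or> left_site L x \<notin> S"
  shows "departures (hop L x A) (hop L x S) = hop L x (departures A S)"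
proof (cases "card A = card S")
  case True
  have "finite A" "finite S" using A S finite_subset by blast+
  then have "card (hop L x A) = card (hop L x S)" using True by (simp add: card_hop)
  then show ?thesis
    using departures_full[OF _ hop_subset[OF A x] hop_subset[OF S x]] departures_full[OF _ A S] True L
    by simp
next
  case False
  have "\<not> (hop L x S = S \<and> x \<in> S \<and> left_site L x \<notin> S)"
    by (auto simp: hop_def)
  then show ?thesis using departures_hop_aux[OF L x A S _ disjI1] False c xS by auto
qed

text \<open>Of the two sites only \<open>x\<close> offers a service, and a customer arriving at
  either of them is in time for it.\<close>

lemma departures_hop_arrivals:
  assumes L: "3 \<le> L" and x: "x < L" and A: "A \<subseteq> {..<L}" and S: "S \<subseteq> {..<L}"
    and c: "card A \<le> card S" and xS: "x \<in> S" "left_site L x \<notin> S"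
  shows "departures (hop L x A) S = departures A S"
proof (cases "card A = card S")
  case True
  have "finite A" using A finite_subset by blast
  then have "card (hop L x A) = card S" using True by (simp add: card_hop)
  then show ?thesis
    using departures_full[OF _ hop_subset[OF A x] S] departures_full[OF _ A S] True L by simp
next
  case False
  then show ?thesis using departures_hop_aux[OF L x A S _ disjI2] c xS by auto
qed

lemma hop_departures_idle:
  assumes "x \<notin> S" shows "hop L x (departures A S) = departures A S"
  using assms departures_subset[of A S] by (auto simp: hop_def)

section \<open>Multiline queues\<close>

text \<open>
  \<open>mlq R r k\<close> is the set of sites carrying a label at most \<open>k\<close> in row \<open>r\<close> of the multiline queue with
  rows \<open>R 1, R 2, \<dots>\<close>: the queue respects priorities, so it acts on each of these sets separately.
\<close>

fun mlq :: "(nat \<Rightarrow> 'a::linorder set) \<Rightarrow> nat \<Rightarrow> nat \<Rightarrow> 'a set" where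
  "mlq R 0 k = {}"
| "mlq R (Suc r) k = (if r < k then R (Suc r) else departures (mlq R r k) (R (Suc r)))"

definition subsets_of_card :: "nat \<Rightarrow> nat \<Rightarrow> nat set set" where
  "subsets_of_card L c = {S. S \<subseteq> {..<L} \<and> card S = c}"

definition row_space :: "nat \<Rightarrow> (nat \<Rightarrow> nat) \<Rightarrow> nat \<Rightarrow> (nat \<Rightarrow> nat set) set" where
  "row_space L c r = PiE {1..r} (\<lambda>i. subsets_of_card L (c i))"

lemma finite_subsets_of_card [simp]: "finite (subsets_of_card L c)"
  by (rule finite_subset[of _ "Pow {..<L}"]) (auto simp: subsets_of_card_def)

lemma finite_row_space [simp]: "finite (row_space L c r)"
  by (auto simp: row_space_def intro!: finite_PiE)

lemma mlq_cong: "(\<And>i. i \<in> {1..r} \<Longrightarrow> R i = R' i) \<Longrightarrow> mlq R r k = mlq R' r k"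
  by (induction r) auto

lemma mlq_0 [simp]: "mlq R r 0 = {}"
  by (induction r) (auto simp: departures_def)

lemma mlq_top: "1 \<le> r \<Longrightarrow> r \<le> k \<Longrightarrow> mlq R r k = R r"
  by (cases r) auto

lemma mlq_subset_row: "1 \<le> r \<Longrightarrow> mlq R r k \<subseteq> R r"
  using departures_subset by (cases r) auto

lemma mlq_mono:
  assumes "\<And>i. i \<in> {1..r} \<Longrightarrow> finite (R i)" "k \<le> k'"
  shows "mlq R r k \<subseteq> mlq R r k'"
  using assms(1)
proof (induction r)
  case (Suc r)
  have fin: "finite (mlq R r k')"
  proof (cases "r = 0")
    case False
    then have "finite (R r)" using Suc.prems[of r] by simp
    then show ?thesis using mlq_subset_row[of r R k'] False finite_subset by auto
  qed simp
  have "mlq R r k \<subseteq> mlq R r k'" using Suc by auto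
  then show ?case
    using departures_mono[OF _ fin, of "mlq R r k" "R (Suc r)"] assms(2)
      departures_subset[of "mlq R r k" "R (Suc r)"] by auto
qed auto

lemma sum_row_space_Suc:
  "(\<Sum>R\<in>row_space L c (Suc r). G R) =
   (\<Sum>R\<in>row_space L c r. \<Sum>S\<in>subsets_of_card L (c (Suc r)). G (R(Suc r := S)))"
proof -
  have eq: "{1..Suc r} = insert (Suc r) {1..r}" by auto
  have "(\<Sum>R\<in>row_space L c (Suc r). G R) =
    (\<Sum>p\<in>subsets_of_card L (c (Suc r)) \<times> row_space L c r. G ((snd p)(Suc r := fst p)))"
    unfolding row_space_def eq PiE_insert_eq
    by (subst sum.reindex)
      (auto intro!: inj_combinator sum.cong simp: case_prod_beta inj_combinator)
  also have "\<dots> = (\<Sum>S\<in>subsets_of_card L (c (Suc r)). \<Sum>R\<in>row_space L c r. G (R(Suc r := S)))"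
    by (simp add: sum.cartesian_product case_prod_beta)
  finally show ?thesis by (subst sum.swap) simp
qed

text \<open>Row \<open>r\<close> carries the labels up to \<open>r\<close> only, whence the minimum.
  Growing rows guarantee enough services, so \<open>card_departures\<close> preserves the sizes from
  row to row.\<close>

lemma mlq_row_space:
  assumes L: "2 \<le> L" and c: "mono c" and R: "R \<in> row_space L c r"
  shows "mlq R r k \<subseteq> {..<L} \<and> card (mlq R r k) = (if r = 0 \<or> k = 0 then 0 else c (min k r))"
  using R
proof (induction r arbitrary: R)
  case (Suc r)
  have sub: "R (Suc r) \<subseteq> {..<L}" "card (R (Suc r)) = c (Suc r)"
    using Suc.prems by (auto simp: row_space_def subsets_of_card_def PiE_iff)
  have "restrict R {1..r} \<in> row_space L c r"
    using Suc.prems by (auto simp: row_space_def PiE_iff)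
  moreover have "mlq (restrict R {1..r}) r k = mlq R r k" by (rule mlq_cong) auto
  ultimately have IH: "mlq R r k \<subseteq> {..<L}"
    "card (mlq R r k) = (if r = 0 \<or> k = 0 then 0 else c (min k r))"
    using Suc.IH by fastforce+
  show ?case
  proof (cases "r < k")
    case False
    have "card (mlq R r k) \<le> card (R (Suc r))"
      using IH(2) sub(2) c by (auto simp: mono_def)
    then show ?thesis
      using False card_departures[OF L IH(1) sub(1)] IH sub departures_subset[of "mlq R r k" "R (Suc r)"]
      by (auto simp: min_def)
  qed (use sub in auto)
qed auto

section \<open>Stationarity of the multiline queue\<close>

lemma descents_eq_ascents:
  assumes "S \<subseteq> {..<L}"
  shows "card {x. x < L \<and> x \<notin> S \<and> left_site L x \<in> S} = card {x. x < L \<and> x \<in> S \<and> left_site L x \<notin> S}"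
proof -
  let ?l = "\<lambda>x. left_site L x \<in> S"
  \<comment> \<open>The shift is a bijection, so as many sites have their left neighbour in
    \<open>S\<close> as lie in \<open>S\<close>; sites with both properties are then removed from
    both counts.\<close>
  have eq: "(\<Sum>x<L. of_bool (?l x)) = (\<Sum>x<L. of_bool (x \<in> S) :: nat)"
    by (rule sum.reindex_bij_betw[OF bij_left_site])
  have s: "(\<Sum>x<L. of_bool (P x) :: nat) = card {x. x < L \<and> P x}" for P
    by (simp add: of_bool_def sum.If_cases Int_def)
  have "card {x. x < L \<and> ?l x} = card {x. x < L \<and> x \<in> S}" using eq unfolding s .
  moreover have "card {x. x < L \<and> ?l x} =
      card {x. x < L \<and> x \<notin> S \<and> ?l x} + card {x. x < L \<and> x \<in> S \<and> ?l x}"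
    by (subst card_Un_disjoint[symmetric]) (auto intro!: arg_cong[of _ _ card])
  moreover have "card {x. x < L \<and> x \<in> S} =
      card {x. x < L \<and> x \<in> S \<and> \<not> ?l x} + card {x. x < L \<and> x \<in> S \<and> ?l x}"
    by (subst card_Un_disjoint[symmetric]) (auto intro!: arg_cong[of _ _ card])
  ultimately show ?thesis by linarith
qed

text \<open>One row of \<open>mlq\<close> acting on all thresholds at once. In this form an
  observable of the new row becomes an observable of the previous one, as the induction over the
  rows requires.\<close>

definition serve :: "nat \<Rightarrow> (nat \<Rightarrow> nat set) \<Rightarrow> nat set \<Rightarrow> nat \<Rightarrow> nat set" where
  "serve r A S = (\<lambda>k. if r < k then S else departures (A k) S)"

text \<open>
  A hop at \<open>x\<close> commutes with the queue, except when \<open>x\<close> is a free site to the right of a service;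
  these exceptions are matched, service set by service set, with the sites where an arrival may
  hop without changing the departures.
\<close>

lemma sum_hop_serve:
  fixes \<phi> :: "(nat \<Rightarrow> nat set) \<Rightarrow> real"
  assumes L: "3 \<le> L" and A: "\<And>k. A k \<subseteq> {..<L}" and c: "\<And>k. k \<le> r \<Longrightarrow> card (A k) \<le> d"
  shows "(\<Sum>S\<in>subsets_of_card L d. \<Sum>x<L. \<phi> (\<lambda>k. hop L x (serve r A S k))) =
         (\<Sum>S\<in>subsets_of_card L d. \<Sum>x<L. \<phi> (serve r (\<lambda>k. hop L x (A k)) S))"
proof -
  let ?W = "subsets_of_card L d"
  have W: "S \<subseteq> {..<L}" "card S = d" if "S \<in> ?W" for S using that by (auto simp: subsets_of_card_def)
  let ?idle = "\<lambda>S x. x \<notin> S \<and> left_site L x \<in> S"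
  let ?free = "\<lambda>S x. x \<in> S \<and> left_site L x \<notin> S"
  have idle: "(\<lambda>k. hop L x (serve r A S k)) = serve r A S" if "x \<notin> S" for x S
    using that hop_departures_idle by (auto simp: serve_def hop_def fun_eq_iff)
  have com: "(\<lambda>k. hop L x (serve r A S k)) = serve r (\<lambda>k. hop L x (A k)) (hop L x S)"
    if "\<not> ?idle S x" "S \<in> ?W" "x < L" for x S
  proof
    fix k
    show "hop L x (serve r A S k) = serve r (\<lambda>k. hop L x (A k)) (hop L x S) k"
    proof (cases "r < k")
      case False
      then show ?thesis
        using departures_hop[OF L that(3) A W(1)[OF that(2)], of k] that c[of k] W[OF that(2)]
        by (auto simp: serve_def)
    qed (simp add: serve_def)
  qed
  have free: "serve r (\<lambda>k. hop L x (A k)) S = serve r A S" if "?free S x" "S \<in> ?W" "x < L" for x S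
  proof
    fix k
    show "serve r (\<lambda>k. hop L x (A k)) S k = serve r A S k"
    proof (cases "r < k")
      case False
      then show ?thesis
        using departures_hop_arrivals[OF L that(3) A W(1)[OF that(2)], of k] that c[of k] W[OF that(2)]
        by (auto simp: serve_def)
    qed (simp add: serve_def)
  qed
  \<comment> \<open>A hop at \<open>x\<close> turns the sets with \<open>x\<close> only into those
    with the left neighbour only, and fixes the sets with both or neither. It is thus a bijection
    from the sets that are not idle at \<open>x\<close> onto those that are not free at
    \<open>x\<close>; the inverse moves the point back to \<open>x\<close>.\<close>
  have bij: "(\<Sum>S\<in>{S\<in>?W. \<not> ?idle S x}. F (hop L x S)) = (\<Sum>S\<in>{S\<in>?W. \<not> ?free S x}. F S)"
    if x: "x < L" for x and F :: "nat set \<Rightarrow> real"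
  proof (rule sum.reindex_bij_witness[where j = "hop L x" and
        i = "\<lambda>S. if ?idle S x then insert x (S - {left_site L x}) else S"], goal_cases)
    case (1 S)
    then show ?case by (auto simp: hop_def)
  next
    case (2 S)
    have "finite S" using 2 W(1) finite_subset by blast
    moreover have "left_site L x \<noteq> x" using x L by (intro left_site_neq) auto
    ultimately show ?case using 2 hop_subset[OF _ x, of S] card_hop[of S]
      by (auto simp: subsets_of_card_def hop_def)
  next
    case (3 S)
    then show ?case using left_site_neq[OF x] L by (auto simp: hop_def)
  next
    case (4 S)
    have "finite S" using 4 W(1) finite_subset by blast
    moreover have "left_site L x \<noteq> x" using x L by (intro left_site_neq) auto
    ultimately show ?case using 4 x
      by (auto simp: subsets_of_card_def card_insert_if card_Suc_Diff1 simp del: card_Diff_insert)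
  qed simp
  have split: "(\<Sum>S\<in>?W. F S) = (\<Sum>S\<in>{S\<in>?W. P S}. F S) + (\<Sum>S\<in>{S\<in>?W. \<not> P S}. F S)"
    for F :: "nat set \<Rightarrow> real" and P
    by (subst sum.union_disjoint[symmetric]) (auto intro!: sum.cong)
  have "(\<Sum>S\<in>?W. \<Sum>x<L. \<phi> (\<lambda>k. hop L x (serve r A S k))) =
    (\<Sum>x<L. (\<Sum>S\<in>{S\<in>?W. ?idle S x}. \<phi> (serve r A S)) +
       (\<Sum>S\<in>{S\<in>?W. \<not> ?idle S x}. \<phi> (serve r (\<lambda>k. hop L x (A k)) (hop L x S))))"
    by (subst sum.swap, intro sum.cong refl, subst split[where P = "\<lambda>S. ?idle S _"])
       (intro arg_cong2[of _ _ _ _ "(+)"] sum.cong refl, auto simp: idle com)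
  also have "\<dots> = (\<Sum>x<L. (\<Sum>S\<in>{S\<in>?W. ?idle S x}. \<phi> (serve r A S))) +
       (\<Sum>x<L. (\<Sum>S\<in>{S\<in>?W. \<not> ?free S x}. \<phi> (serve r (\<lambda>k. hop L x (A k)) S)))"
    unfolding sum.distrib by (intro arg_cong2[of _ _ _ _ "(+)"] sum.cong refl bij) auto
  also have "(\<Sum>x<L. (\<Sum>S\<in>{S\<in>?W. ?idle S x}. \<phi> (serve r A S))) =
     (\<Sum>S\<in>?W. card {x. x < L \<and> ?idle S x} * \<phi> (serve r A S))"
    by (subst sum.swap_restrict) (auto intro!: sum.cong)
  \<comment> \<open>For a fixed \<open>S\<close> the observable has the same value at all
    exceptional sites of either kind, so only the numbers of these sites matter.\<close>
  also have "\<dots> = (\<Sum>S\<in>?W. card {x. x < L \<and> ?free S x} * \<phi> (serve r A S))"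
    using descents_eq_ascents W(1) by (intro sum.cong) auto
  also have "\<dots> = (\<Sum>x<L. (\<Sum>S\<in>{S\<in>?W. ?free S x}. \<phi> (serve r A S)))"
    by (subst sum.swap_restrict) (auto intro!: sum.cong)
  also have "\<dots> = (\<Sum>x<L. (\<Sum>S\<in>{S\<in>?W. ?free S x}. \<phi> (serve r (\<lambda>k. hop L x (A k)) S)))"
    using free by (intro sum.cong refl) auto
  also have "\<dots> + (\<Sum>x<L. (\<Sum>S\<in>{S\<in>?W. \<not> ?free S x}. \<phi> (serve r (\<lambda>k. hop L x (A k)) S))) =
    (\<Sum>x<L. \<Sum>S\<in>?W. \<phi> (serve r (\<lambda>k. hop L x (A k)) S))"
    by (subst sum.distrib[symmetric], intro sum.cong refl, rule split[symmetric])
  also have "\<dots> = (\<Sum>S\<in>?W. \<Sum>x<L. \<phi> (serve r (\<lambda>k. hop L x (A k)) S))"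
    by (rule sum.swap)
  finally show ?thesis .
qed

text \<open>Each row hands the hop to the previous row until it arrives at row 0, which is empty and
  unaffected. The observable is arbitrary because it absorbs the services already processed.\<close>

lemma mlq_stationary:
  fixes \<phi> :: "(nat \<Rightarrow> nat set) \<Rightarrow> real"
  assumes L: "3 \<le> L" and c: "mono c"
  shows "(\<Sum>R\<in>row_space L c r. \<Sum>x<L. \<phi> (\<lambda>k. hop L x (mlq R r k))) =
         real L * (\<Sum>R\<in>row_space L c r. \<phi> (mlq R r))"
proof (induction r arbitrary: \<phi>)
  case 0
  have "hop L x {} = {}" for x by (simp add: hop_def)
  then show ?case by (simp add: row_space_def)
next
  case (Suc r)
  have upd: "mlq (R(Suc r := S)) (Suc r) = serve r (mlq R r) S" for R S
    using mlq_cong[of r "R(Suc r := S)" R] by (auto simp: serve_def fun_eq_iff)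
  let ?W = "subsets_of_card L (c (Suc r))"
  have "(\<Sum>R\<in>row_space L c (Suc r). \<Sum>x<L. \<phi> (\<lambda>k. hop L x (mlq R (Suc r) k))) =
    (\<Sum>R\<in>row_space L c r. \<Sum>S\<in>?W. \<Sum>x<L. \<phi> (\<lambda>k. hop L x (serve r (mlq R r) S k)))"
    by (simp add: sum_row_space_Suc upd del: mlq.simps)
  also have "\<dots> = (\<Sum>R\<in>row_space L c r. \<Sum>S\<in>?W. \<Sum>x<L. \<phi> (serve r (\<lambda>k. hop L x (mlq R r k)) S))"
  proof (rule sum.cong[OF refl], rule sum_hop_serve[OF L])
    fix R k assume R: "R \<in> row_space L c r"
    show "mlq R r k \<subseteq> {..<L}" using mlq_row_space[OF _ c R] L by auto
    show "card (mlq R r k) \<le> c (Suc r)"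
      using mlq_row_space[OF _ c R, of k] L c by (auto simp: mono_def)
  qed
  also have "\<dots> = (\<Sum>S\<in>?W. \<Sum>R\<in>row_space L c r. \<Sum>x<L. \<phi> (serve r (\<lambda>k. hop L x (mlq R r k)) S))"
    by (rule sum.swap)
  also have "\<dots> = (\<Sum>S\<in>?W. real L * (\<Sum>R\<in>row_space L c r. \<phi> (serve r (mlq R r) S)))"
    by (intro sum.cong refl Suc.IH)
  also have "\<dots> = real L * (\<Sum>R\<in>row_space L c r. \<Sum>S\<in>?W. \<phi> (serve r (mlq R r) S))"
    by (subst sum.swap) (simp add: sum_distrib_left)
  finally show ?case by (simp add: sum_row_space_Suc upd del: mlq.simps)
qed

section \<open>Uniqueness of the stationary distribution\<close>

definition bell :: "nat list \<Rightarrow> nat \<Rightarrow> nat list" where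
  "bell w x = (if w ! left_site (length w) x > w ! x then swap_left w x else w)"

text \<open>
  Invariance under a bell at a uniformly chosen site, scaled by \<open>L\<close>. Bells without effect cancel
  against the diagonal of the generator, so this is stationarity.
\<close>

definition balanced :: "nat \<Rightarrow> nat list set \<Rightarrow> (nat list \<Rightarrow> real) \<Rightarrow> bool" where
  "balanced L W p \<longleftrightarrow>
     (\<forall>v\<in>W. (\<Sum>w\<in>W. p w * real (card {x. x < L \<and> bell w x = v})) = real L * p v)"

text \<open>Equal multisets make the sorted word, the target of bubble sort, unique.\<close>

definition bell_closed :: "nat \<Rightarrow> nat list set \<Rightarrow> bool" where
  "bell_closed L W \<longleftrightarrow>
     finite W \<and> (\<forall>w\<in>W. length w = L \<and> (\<forall>x<L. bell w x \<in> W)) \<and> (\<forall>v\<in>W. \<forall>w\<in>W. mset v = mset w)"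

lemma bell_Suc:
  assumes "Suc x < length w" "w ! x > w ! Suc x"
  shows "bell w (Suc x) = w[x := w ! Suc x, Suc x := w ! x]"
  using assms by (simp add: bell_def swap_left_def left_site_eq)

text \<open>Earlier sites have larger weight, so moving the smaller letter forward lowers the sum.
  This is the termination measure of bubble sort.\<close>

lemma weighted_sum_swap_less:
  fixes w :: "nat list"
  assumes x: "Suc x < length w" and d: "w ! x > w ! Suc x"
  defines "v \<equiv> w[x := w ! Suc x, Suc x := w ! x]"
  shows "(\<Sum>i<length w. (length w - i) * v ! i) < (\<Sum>i<length w. (length w - i) * w ! i)"
proof -
  let ?L = "length w"
  have split: "(\<Sum>i<?L. (?L - i) * u ! i) =
      (?L - x) * u ! x + ((?L - Suc x) * u ! Suc x + (\<Sum>i\<in>{..<?L} - {x} - {Suc x}. (?L - i) * u ! i))"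
    for u :: "nat list"
    using x by (subst sum.remove[of _ x], simp, simp, subst sum.remove[of _ "Suc x"]) auto
  have "(\<Sum>i\<in>{..<?L} - {x} - {Suc x}. (?L - i) * v ! i) = (\<Sum>i\<in>{..<?L} - {x} - {Suc x}. (?L - i) * w ! i)"
    by (intro sum.cong) (auto simp: v_def)
  moreover have "(?L - x) * v ! x + (?L - Suc x) * v ! Suc x < (?L - x) * w ! x + (?L - Suc x) * w ! Suc x"
  proof -
    have "?L - x = Suc (?L - Suc x)" using x by simp
    then show ?thesis using x d by (simp add: v_def algebra_simps)
  qed
  ultimately show ?thesis unfolding split[of v] split[of w] by linarith
qed

text \<open>
  Summing the triangle inequality over all words shows that \<open>\<bar>h\<bar>\<close> is balanced as well, so its zero set
  is closed under predecessors; bubble sort leads from every word to the sorted one.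
\<close>

lemma balanced_zero:
  assumes W: "bell_closed L W" and b: "balanced L W h"
    and w0: "w0 \<in> W" "sorted w0" "h w0 = 0" and w: "w \<in> W"
  shows "h w = 0"
proof -
  let ?N = "\<lambda>w v. real (card {x. x < L \<and> bell w x = v})"
  have fin: "finite W" using W by (simp add: bell_closed_def)
  have N_sum: "(\<Sum>v\<in>W. ?N w v) = real L" if "w \<in> W" for w
  proof -
    have "(\<Sum>v\<in>W. card {x. x < L \<and> bell w x = v}) = card (\<Union>v\<in>W. {x. x < L \<and> bell w x = v})"
      by (rule card_UN_disjoint[symmetric]) (use fin in auto)
    also have "(\<Union>v\<in>W. {x. x < L \<and> bell w x = v}) = {..<L}"
      using W that by (auto simp: bell_closed_def)
    finally show ?thesis by (simp flip: of_nat_sum)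
  qed
  have le: "real L * \<bar>h v\<bar> \<le> (\<Sum>w\<in>W. \<bar>h w\<bar> * ?N w v)" if "v \<in> W" for v
  proof -
    have "real L * \<bar>h v\<bar> = \<bar>\<Sum>w\<in>W. h w * ?N w v\<bar>"
      using b that by (simp add: balanced_def abs_mult)
    also have "\<dots> \<le> (\<Sum>w\<in>W. \<bar>h w * ?N w v\<bar>)" by (rule sum_abs)
    finally show ?thesis by (simp add: abs_mult)
  qed
  have "(\<Sum>v\<in>W. (\<Sum>w\<in>W. \<bar>h w\<bar> * ?N w v) - real L * \<bar>h v\<bar>) = 0"
    unfolding sum_subtractf
    by (subst sum.swap) (simp add: N_sum mult.commute flip: sum_distrib_left)
  then have "(\<Sum>w\<in>W. \<bar>h w\<bar> * ?N w v) - real L * \<bar>h v\<bar> = 0" if "v \<in> W" for v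
    using le that fin by (subst (asm) sum_nonneg_eq_0_iff) auto
  then have eq: "(\<Sum>w\<in>W. \<bar>h w\<bar> * ?N w v) = real L * \<bar>h v\<bar>" if "v \<in> W" for v
    using that by simp
  have pre: "h w = 0" if "w \<in> W" "x < L" "h (bell w x) = 0" for w x
  proof -
    have "bell w x \<in> W" using W that unfolding bell_closed_def by blast
    from eq[OF this] have "(\<Sum>u\<in>W. \<bar>h u\<bar> * ?N u (bell w x)) = 0" using that by simp
    then have "\<bar>h w\<bar> * ?N w (bell w x) = 0"
      using that fin by (subst (asm) sum_nonneg_eq_0_iff) auto
    moreover have "{y. y < L \<and> bell w y = bell w x} \<noteq> {}" using that by auto
    ultimately show ?thesis by auto
  qed
  show ?thesis
    using w
  proof (induction w rule: measure_induct_rule[of "\<lambda>w. \<Sum>i<length w. (length w - i) * w ! i"])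
    case (less w)
    show ?case
    proof (cases "sorted w")
      case True
      have "mset w = mset w0" using W less.prems w0 unfolding bell_closed_def by blast
      then have "w = w0" using True w0 by (metis properties_for_sort)
      then show ?thesis using w0 by simp
    next
      case False
      then obtain x where x: "Suc x < length w" "w ! x > w ! Suc x"
        by (auto simp: sorted_iff_nth_Suc not_le)
      have len: "length w = L" using W less.prems unfolding bell_closed_def by blast
      have "bell w (Suc x) \<in> W" using W less.prems x len unfolding bell_closed_def by blast
      moreover have "length (bell w (Suc x)) = length w"
        using bell_Suc[OF x] by simp
      ultimately have "h (bell w (Suc x)) = 0"
        using less.IH[of "bell w (Suc x)"] weighted_sum_swap_less[OF x] bell_Suc[OF x] by simp
      then show ?thesis using pre less.prems x len by auto
    qed
  qed
qed

text \<open>Infinite descent: an unsorted word yields another word of the set with smaller weighted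
  sum.\<close>

lemma bell_closed_sorted:
  assumes W: "bell_closed L W" and "W \<noteq> {}"
  shows "\<exists>w\<in>W. sorted w"
proof (rule ccontr)
  assume no: "\<not> ?thesis"
  have "w \<notin> W" for w
  proof (induction w rule: measure_induct_rule[of "\<lambda>w. \<Sum>i<length w. (length w - i) * w ! i"])
    case (less w)
    show ?case
    proof
      assume w: "w \<in> W"
      then obtain x where x: "Suc x < length w" "w ! x > w ! Suc x"
        using no by (auto simp: sorted_iff_nth_Suc not_le)
      then have "bell w (Suc x) \<in> W" using W w unfolding bell_closed_def by metis
      moreover have "length (bell w (Suc x)) = length w"
        using bell_Suc[OF x] by simp
      ultimately show False
        using less.IH[of "bell w (Suc x)"] weighted_sum_swap_less[OF x] bell_Suc[OF x] by simp
    qed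
  qed
  then show False using assms by auto
qed

text \<open>The combination \<open>h\<close> is made to vanish at the sorted word \<open>w0\<close>,
  hence vanishes everywhere by \<open>balanced_zero\<close>. So \<open>p\<close> and
  \<open>q\<close> are proportional, and total mass 1 fixes the factor; \<open>q w0\<close> cannot
  be 0, since otherwise \<open>q\<close> would vanish identically.\<close>

lemma balanced_unique:
  assumes W: "bell_closed L W" and p: "balanced L W p" and q: "balanced L W q"
    and sums: "(\<Sum>w\<in>W. p w) = 1" "(\<Sum>w\<in>W. q w) = 1" and w: "w \<in> W"
  shows "p w = q w"
proof -
  obtain w0 where w0: "w0 \<in> W" "sorted w0" using bell_closed_sorted[OF W] w by blast
  define h where "h v = q w0 * p v - p w0 * q v" for v
  have "balanced L W h"
    unfolding balanced_def
  proof
    fix v assume v: "v \<in> W"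
    let ?N = "\<lambda>w. real (card {x. x < L \<and> bell w x = v})"
    have "(\<Sum>w\<in>W. h w * ?N w) = q w0 * (\<Sum>w\<in>W. p w * ?N w) - p w0 * (\<Sum>w\<in>W. q w * ?N w)"
      by (simp add: h_def sum_distrib_left sum_subtractf[symmetric] algebra_simps)
    then show "(\<Sum>w\<in>W. h w * ?N w) = real L * h v"
      using p q v by (simp add: balanced_def h_def algebra_simps)
  qed
  moreover have "h w0 = 0" by (simp add: h_def)
  ultimately have h0: "h v = 0" if "v \<in> W" for v
    using balanced_zero[OF W _ w0 _ that] by blast
  have "0 = (\<Sum>v\<in>W. h v)" using h0 by simp
  also have "\<dots> = q w0 - p w0"
    using sums by (simp add: h_def sum_subtractf flip: sum_distrib_left)
  finally have eq: "p w0 = q w0" by simp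
  have "q w0 \<noteq> 0"
  proof
    assume "q w0 = 0"
    then have "(\<Sum>w\<in>W. q w) = 0" using balanced_zero[OF W q w0] by simp
    then show False using sums by simp
  qed
  then show ?thesis using h0[OF w] eq by (simp add: h_def)
qed

section \<open>Stationarity of the TASEP as balance of bells\<close>

lemma length_bell [simp]: "length (bell w x) = length w"
  by (simp add: bell_def swap_left_def)

lemma mset_bell:
  assumes "x < length w" shows "mset (bell w x) = mset w"
  using assms mset_swap[of x w "left_site (length w) x"] left_site_less[OF assms]
  by (auto simp: bell_def swap_left_def list_update_swap)

lemma mset_tasep_states:
  assumes w: "w \<in> tasep_states n L" shows "count (mset w) k =
    (if k \<in> {1..n} then 1 else if k = n + 1 then L - n else 0)"
proof -
  have w': "length w = L" "set w \<subseteq> {1..n + 1}" "\<And>k. k \<in> {1..n} \<Longrightarrow> count (mset w) k = 1"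
    using w by (auto simp: tasep_states_def count_mset)
  have "L = (\<Sum>k\<in>set w. count (mset w) k)" using w'(1) by (metis size_mset size_multiset_overloaded_eq set_mset_mset)
  also have "\<dots> = (\<Sum>k\<in>{1..n+1}. count (mset w) k)"
    using w'(2) by (intro sum.mono_neutral_left) (auto simp: count_eq_zero_iff)
  also have "\<dots> = n + count (mset w) (n + 1)"
    using w'(3) by simp
  finally have "count (mset w) (n + 1) = L - n" by simp
  moreover have "count (mset w) k = 0" if "k \<notin> {1..n + 1}"
    using that w'(2) by (auto simp: count_eq_zero_iff)
  ultimately show ?thesis using w'(3)[of k] by auto
qed

lemma tasep_states_mset_cong:
  "w \<in> tasep_states n L \<Longrightarrow> mset v = mset w \<Longrightarrow> v \<in> tasep_states n L"
  unfolding tasep_states_def mem_Collect_eq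
  by (metis count_mset mset_eq_length mset_eq_setD)

lemma finite_tasep_states: "finite (tasep_states n L)"
  by (rule finite_subset[OF _ finite_lists_length_eq[of "{1..n + 1}" L]])
     (auto simp: tasep_states_def)

lemma bell_closed_tasep_states: "bell_closed L (tasep_states n L)"
  unfolding bell_closed_def
proof (intro conjI ballI allI impI)
  show "finite (tasep_states n L)" by (rule finite_tasep_states)
  fix w assume w: "w \<in> tasep_states n L"
  show len: "length w = L" using w by (simp add: tasep_states_def)
  show "bell w x \<in> tasep_states n L" if "x < L" for x
    using tasep_states_mset_cong[OF w] mset_bell that len by blast
  fix v assume "v \<in> tasep_states n L"
  then show "mset w = mset v" using w mset_tasep_states by (intro multiset_eqI) simp
qed

lemma tasep_stationary_iff_balanced:
  "tasep_stationary n L p \<longleftrightarrow>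
     set_pmf p \<subseteq> tasep_states n L \<and> balanced L (tasep_states n L) (pmf p)"
proof -
  let ?W = "tasep_states n L"
  let ?act = "\<lambda>w. {s. s < L \<and> w ! left_site L s > w ! s}"
  have fin: "finite ?W" by (rule finite_tasep_states)
  have len: "length w = L" if "w \<in> ?W" for w using that by (simp add: tasep_states_def)
  have N: "real (card {x. x < L \<and> bell w x = v}) =
      tasep_rate w v + (if w = v then real L - real (card (?act w)) else 0)" if w: "w \<in> ?W" for w v
  proof -
    have "{x. x < L \<and> bell w x = v} =
      {s. s < L \<and> w ! left_site L s > w ! s \<and> swap_left w s = v} \<union>
      (if w = v then {..<L} - ?act w else {})"
      using len[OF w] by (auto simp: bell_def split: if_splits)
    moreover have "card ({..<L} - ?act w) = L - card (?act w)"
      by (subst card_Diff_subset) auto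
    then have "card ({s. s < L \<and> w ! left_site L s > w ! s \<and> swap_left w s = v} \<union>
      (if w = v then {..<L} - ?act w else {})) = card {s. s < L \<and> w ! left_site L s > w ! s \<and> swap_left w s = v} +
      (if w = v then L - card (?act w) else 0)"
      by (subst card_Un_disjoint) auto
    moreover have "card (?act w) \<le> L" using card_mono[of "{..<L}" "?act w"] by auto
    moreover have "tasep_rate w v =
        real (card {s. s < L \<and> w ! left_site L s > w ! s \<and> swap_left w s = v})"
      using len[OF w] by (simp add: tasep_rate_def)
    ultimately show ?thesis by (cases "w = v") (simp_all add: of_nat_diff)
  qed
  \<comment> \<open>The exit rate of a word is its number of active sites, because every jump leads
    to a word of the same state space.\<close>
  have out: "(\<Sum>v\<in>?W. tasep_rate w v) = real (card (?act w))" if w: "w \<in> ?W" for w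
  proof -
    have "(\<Sum>v\<in>?W. card {s. s < L \<and> w ! left_site L s > w ! s \<and> swap_left w s = v}) =
      card (\<Union>v\<in>?W. {s. s < L \<and> w ! left_site L s > w ! s \<and> swap_left w s = v})"
      by (rule card_UN_disjoint[symmetric]) (use fin in auto)
    also have "(\<Union>v\<in>?W. {s. s < L \<and> w ! left_site L s > w ! s \<and> swap_left w s = v}) = ?act w"
    proof -
      have "swap_left w s \<in> ?W" if "s \<in> ?act w" for s
      proof -
        have "bell w s \<in> ?W"
          using bell_closed_tasep_states[of L n] w that unfolding bell_closed_def by blast
        then show ?thesis using that len[OF w] by (simp add: bell_def)
      qed
      then show ?thesis by blast
    qed
    finally show ?thesis using len[OF w] by (simp add: tasep_rate_def flip: of_nat_sum)
  qed
  have bal: "(\<Sum>w\<in>?W. pmf p w * real (card {x. x < L \<and> bell w x = v})) =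
     (\<Sum>w\<in>?W. pmf p w * tasep_rate w v) + (real L - real (card (?act v))) * pmf p v" if v: "v \<in> ?W" for v
  proof -
    have "(\<Sum>w\<in>?W. pmf p w * real (card {x. x < L \<and> bell w x = v})) =
      (\<Sum>w\<in>?W. pmf p w * tasep_rate w v + (if w = v then (real L - real (card (?act v))) * pmf p v else 0))"
      by (intro sum.cong refl) (auto simp: N algebra_simps)
    then show ?thesis using v fin by (simp add: sum.distrib)
  qed
  have "(\<Sum>w\<in>?W. pmf p w * tasep_rate w v) = pmf p v * (\<Sum>w\<in>?W. tasep_rate v w) \<longleftrightarrow>
    (\<Sum>w\<in>?W. pmf p w * real (card {x. x < L \<and> bell w x = v})) = real L * pmf p v"
    if v: "v \<in> ?W" for v
    unfolding bal[OF v] out[OF v] by (auto simp: algebra_simps)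
  then show ?thesis
    unfolding tasep_stationary_def balanced_def by simp
qed

text \<open>Existence and uniqueness of a stationary distribution together resolve the definite
  description in \<open>tasep_pmf\<close>.\<close>

lemma tasep_pmf_eqI:
  assumes "set_pmf p \<subseteq> tasep_states n L" "balanced L (tasep_states n L) (pmf p)"
  shows "tasep_pmf n L = p"
  unfolding tasep_pmf_def
proof (rule the_equality)
  show "tasep_stationary n L p" using assms by (simp add: tasep_stationary_iff_balanced)
  fix q assume q: "tasep_stationary n L q"
  then have q': "set_pmf q \<subseteq> tasep_states n L" "balanced L (tasep_states n L) (pmf q)"
    by (auto simp: tasep_stationary_iff_balanced)
  have "pmf q w = pmf p w" for w
  proof (cases "w \<in> tasep_states n L")
    case True
    then show ?thesis
      using balanced_unique[OF bell_closed_tasep_states q'(2) assms(2)]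
        sum_pmf_eq_1[OF finite_tasep_states] q'(1) assms(1) by blast
  next
    case False
    then show ?thesis using q'(1) assms(1) by (metis pmf_eq_0_set_pmf subsetD)
  qed
  then show "q = p" by (intro pmf_eqI)
qed

section \<open>Words of a multiline queue\<close>

text \<open>For nested sets the letter at \<open>s\<close> is the first threshold that catches
  \<open>s\<close>; \<open>Suc r\<close> is the default and marks the empty sites.\<close>

definition word :: "nat \<Rightarrow> nat \<Rightarrow> (nat \<Rightarrow> nat set) \<Rightarrow> nat list" where
  "word L r A = map (\<lambda>s. LEAST k. k = Suc r \<or> s \<in> A k) [0..<L]"

lemma length_word [simp]: "length (word L r A) = L"
  by (simp add: word_def)

lemma word_le_iff:
  assumes "mono A" "s < L" "k \<le> r"
  shows "word L r A ! s \<le> k \<longleftrightarrow> s \<in> A k"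
proof -
  let ?P = "\<lambda>k. k = Suc r \<or> s \<in> A k"
  have eq: "word L r A ! s = (LEAST k. ?P k)" using assms by (simp add: word_def)
  have "?P (LEAST k. ?P k)" by (rule LeastI[of ?P "Suc r"]) simp
  moreover have "(LEAST k. ?P k) \<le> k" if "s \<in> A k" using that by (intro Least_le) simp
  ultimately show ?thesis unfolding eq using assms by (auto dest: monoD)
qed

lemma word_le_Suc: "s < L \<Longrightarrow> word L r A ! s \<le> Suc r"
  by (auto simp: word_def intro: Least_le)

lemma eq_if_same_thresholds:
  fixes a b :: nat
  assumes "a \<le> Suc r" "b \<le> Suc r" "\<And>k. k \<le> r \<Longrightarrow> a \<le> k \<longleftrightarrow> b \<le> k"
  shows "a = b"
  using assms(3)[of a] assms(3)[of b] assms(1,2) by (cases "a \<le> r"; cases "b \<le> r") auto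

lemma bell_nth:
  assumes x: "x < length w" "2 \<le> length w" and s: "s < length w"
  shows "bell w x ! s = (if s = x then max (w ! x) (w ! left_site (length w) x)
     else if s = left_site (length w) x then min (w ! x) (w ! left_site (length w) x) else w ! s)"
  using left_site_less[OF x(1)] left_site_neq[OF x] s x
  by (auto simp: bell_def swap_left_def nth_list_update)

lemma hop_mono: "A \<subseteq> B \<Longrightarrow> x < L \<Longrightarrow> 2 \<le> L \<Longrightarrow> hop L x A \<subseteq> hop L x B"
  using left_site_neq[of x L] by (auto simp: hop_def split: if_splits)

text \<open>A bell puts the larger of two letters at \<open>x\<close> and the smaller at its left
  neighbour. Being at most \<open>k\<close> then requires both letters at \<open>x\<close> and one
  of them at the neighbour, which is a hop of each threshold set.\<close>

lemma bell_word:
  assumes A: "mono A" and x: "x < L" and L: "2 \<le> L"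
  shows "bell (word L r A) x = word L r (\<lambda>k. hop L x (A k))"
proof (rule nth_equalityI)
  fix s assume "s < length (bell (word L r A) x)"
  then have s: "s < L" by simp
  have mono: "mono (\<lambda>k. hop L x (A k))"
    using A hop_mono[OF _ x L] by (auto simp: mono_def)
  let ?y = "left_site L x"
  have y: "?y < L" "?y \<noteq> x" using left_site_less left_site_neq x L by auto
  show "bell (word L r A) x ! s = word L r (\<lambda>k. hop L x (A k)) ! s"
  proof (rule eq_if_same_thresholds[where r = r])
    show "bell (word L r A) x ! s \<le> Suc r"
      using word_le_Suc s x y L by (subst bell_nth) (auto simp: min_le_iff_disj)
    show "word L r (\<lambda>k. hop L x (A k)) ! s \<le> Suc r" using word_le_Suc s by simp
    fix k assume k: "k \<le> r"
    have "bell (word L r A) x ! s \<le> k \<longleftrightarrow>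
      (if s = x then x \<in> A k \<and> ?y \<in> A k else if s = ?y then x \<in> A k \<or> ?y \<in> A k else s \<in> A k)"
      using x L s y word_le_iff[OF A _ k] by (subst bell_nth) (auto simp: min_le_iff_disj)
    also have "\<dots> \<longleftrightarrow> s \<in> hop L x (A k)" using y by (auto simp: hop_def)
    also have "\<dots> \<longleftrightarrow> word L r (\<lambda>k. hop L x (A k)) ! s \<le> k"
      using word_le_iff[OF mono s k] by simp
    finally show "bell (word L r A) x ! s \<le> k \<longleftrightarrow> word L r (\<lambda>k. hop L x (A k)) ! s \<le> k" .
  qed
qed simp

text \<open>A uniformly random index is meant to give a stationary word. The last clause states
  invariance under a hop at a uniform site, for observables of all threshold sets jointly.\<close>

definition stationary_family :: "nat \<Rightarrow> nat \<Rightarrow> (nat \<Rightarrow> nat) \<Rightarrow> 'i set \<Rightarrow> ('i \<Rightarrow> nat \<Rightarrow> nat set) \<Rightarrow> bool" where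
  "stationary_family L r d I C \<longleftrightarrow>
     finite I \<and> I \<noteq> {} \<and>
     (\<forall>i\<in>I. mono (C i) \<and> (\<forall>k\<le>r. C i k \<subseteq> {..<L} \<and> card (C i k) = d k)) \<and>
     (\<forall>\<phi> :: (nat \<Rightarrow> nat set) \<Rightarrow> real.
       (\<Sum>i\<in>I. \<Sum>x<L. \<phi> (\<lambda>k. hop L x (C i k))) = real L * (\<Sum>i\<in>I. \<phi> (C i)))"

lemma balanced_stationary_family:
  assumes f: "stationary_family L r d I C" and L: "2 \<le> L" and W: "finite W" "\<And>i. i \<in> I \<Longrightarrow> word L r (C i) \<in> W"
  shows "balanced L W (\<lambda>w. real (card {i\<in>I. word L r (C i) = w}) / real (card I))"
  unfolding balanced_def
proof
  fix v
  have fin: "finite I" using f by (simp add: stationary_family_def)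
  let ?N = "\<lambda>w. real (card {x. x < L \<and> bell w x = v})"
  have N: "?N w = (\<Sum>x<L. of_bool (bell w x = v))" for w
    by (simp add: of_bool_def sum.If_cases Int_def)
  have avg: "(\<Sum>w\<in>W. real (card {i\<in>I. word L r (C i) = w}) * F w) = (\<Sum>i\<in>I. F (word L r (C i)))" for F
  proof -
    have "(\<Sum>i\<in>I. F (word L r (C i))) = (\<Sum>w\<in>W. \<Sum>i\<in>{i\<in>I. word L r (C i) = w}. F (word L r (C i)))"
      using W fin by (intro sum.group[symmetric]) auto
    also have "\<dots> = (\<Sum>w\<in>W. real (card {i\<in>I. word L r (C i) = w}) * F w)"
      by (intro sum.cong) auto
    finally show ?thesis by simp
  qed
  assume v: "v \<in> W"
  have "(\<Sum>w\<in>W. real (card {i\<in>I. word L r (C i) = w}) * ?N w) = (\<Sum>i\<in>I. ?N (word L r (C i)))"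
    by (rule avg)
  also have "\<dots> = (\<Sum>i\<in>I. \<Sum>x<L. of_bool (word L r (\<lambda>k. hop L x (C i k)) = v))"
    unfolding N using f L by (intro sum.cong refl) (auto simp: stationary_family_def bell_word)
  also have "\<dots> = real L * (\<Sum>i\<in>I. of_bool (word L r (C i) = v))"
    using f unfolding stationary_family_def by (elim conjE) (erule spec)
  also have "(\<Sum>i\<in>I. of_bool (word L r (C i) = v) :: real) = real (card {i\<in>I. word L r (C i) = v})"
    using fin by (simp add: of_bool_def sum.If_cases Int_def)
  finally have "(\<Sum>w\<in>W. real (card {i\<in>I. word L r (C i) = w}) * ?N w) / real (card I) =
    real L * real (card {i\<in>I. word L r (C i) = v}) / real (card I)" by simp
  then show "(\<Sum>w\<in>W. real (card {i\<in>I. word L r (C i) = w}) / real (card I) * ?N w) =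
      real L * (real (card {i\<in>I. word L r (C i) = v}) / real (card I))"
    by (simp add: sum_divide_distrib)
qed

definition type_words :: "nat \<Rightarrow> nat \<Rightarrow> (nat \<Rightarrow> nat) \<Rightarrow> nat list set" where
  "type_words L r d = {w. length w = L \<and> set w \<subseteq> {..Suc r} \<and>
     (\<forall>k\<le>r. card {s. s < L \<and> w ! s \<le> k} = d k)}"

lemma word_in_type_words:
  assumes "mono A" "\<And>k. k \<le> r \<Longrightarrow> A k \<subseteq> {..<L} \<and> card (A k) = d k"
  shows "word L r A \<in> type_words L r d"
proof -
  have "{s. s < L \<and> word L r A ! s \<le> k} = A k" if "k \<le> r" for k
    using word_le_iff[OF assms(1) _ that] assms(2)[OF that] by auto
  then show ?thesis
    using assms(2) word_le_Suc[of _ L r A] by (auto simp: type_words_def in_set_conv_nth)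
qed

lemma type_words_mset:
  assumes "v \<in> type_words L r d" "w \<in> type_words L r d"
  shows "mset v = mset w"
proof (rule multiset_eqI)
  fix k
  have cnt: "count (mset u) k + card {s. s < L \<and> u ! s < k} = card {s. s < L \<and> u ! s \<le> k}"
    if "u \<in> type_words L r d" for u
  proof -
    have "length u = L" using that by (simp add: type_words_def)
    then have "count (mset u) k = card {s. s < L \<and> u ! s = k}"
      by (simp add: count_mset count_list_eq_length_filter length_filter_conv_card eq_commute)
    moreover have "{s. s < L \<and> u ! s \<le> k} = {s. s < L \<and> u ! s = k} \<union> {s. s < L \<and> u ! s < k}"
      by auto
    ultimately show ?thesis by (simp, subst card_Un_disjoint) auto
  qed
  have le: "card {s. s < L \<and> v ! s \<le> k} = card {s. s < L \<and> w ! s \<le> k}" for k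
  proof (cases "k \<le> r")
    case False
    have "{s. s < L \<and> u ! s \<le> k} = {..<L}" if "u \<in> type_words L r d" for u
    proof -
      have "u ! s \<le> Suc r" if "s < L" for s
        using that \<open>u \<in> _\<close> by (auto simp: type_words_def subset_iff)
      then show ?thesis using False by (auto intro: le_trans[of _ "Suc r"])
    qed
    then show ?thesis using assms by simp
  qed (use assms in \<open>simp add: type_words_def\<close>)
  have lt: "card {s. s < L \<and> v ! s < k} = card {s. s < L \<and> w ! s < k}"
    using le[of "k - 1"] by (cases k) (auto simp: less_Suc_eq_le)
  show "count (mset v) k = count (mset w) k"
    using cnt[OF assms(1)] cnt[OF assms(2)] le[of k] lt by linarith
qed

lemma bell_closed_type_words:
  assumes L: "2 \<le> L" shows "bell_closed L (type_words L r d)"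
  unfolding bell_closed_def
proof (intro conjI ballI allI impI)
  show "finite (type_words L r d)"
    by (rule finite_subset[OF _ finite_lists_length_eq[of "{..Suc r}" L]]) (auto simp: type_words_def)
  fix w assume w: "w \<in> type_words L r d"
  show len: "length w = L" using w by (simp add: type_words_def)
  fix v assume "v \<in> type_words L r d"
  then show "mset w = mset v" using w type_words_mset by blast
next
  fix w x assume w: "w \<in> type_words L r d" and x: "x < L"
  have len: "length w = L" using w by (simp add: type_words_def)
  have ms: "mset (bell w x) = mset w" using mset_bell x len by simp
  have "card {s. s < L \<and> bell w x ! s \<le> k} = card {s. s < L \<and> w ! s \<le> k}" for k
  proof -
    have c: "card {s. s < L \<and> u ! s \<le> k} = size (filter_mset (\<lambda>a. a \<le> k) (mset u))" if "length u = L" for u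
      using that by (simp add: length_filter_conv_card flip: mset_filter)
    show ?thesis using len ms by (simp add: c)
  qed
  moreover have "set (bell w x) = set w" using ms by (rule mset_eq_setD)
  ultimately show "bell w x \<in> type_words L r d" using w by (simp add: type_words_def)
qed

text \<open>
  Applied to coarsened labels, this lets three lines replace the \<open>n\<close> lines of the full multiline queue.
\<close>

lemma stationary_family_avg_eq:
  fixes \<psi> :: "nat list \<Rightarrow> real"
  assumes L: "2 \<le> L" and f: "stationary_family L r d I C" and g: "stationary_family L r d J D"
  shows "(\<Sum>i\<in>I. \<psi> (word L r (C i))) / real (card I) = (\<Sum>j\<in>J. \<psi> (word L r (D j))) / real (card J)"
proof -
  let ?W = "type_words L r d"
  have fin: "finite ?W" using bell_closed_type_words[OF L] by (simp add: bell_closed_def)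
  have avg: "(\<Sum>w\<in>?W. real (card {i\<in>K. word L r (E i) = w}) / real (card K) * F w) =
      (\<Sum>i\<in>K. F (word L r (E i))) / real (card K)" and WK: "\<forall>i\<in>K. word L r (E i) \<in> ?W"
    and K: "finite K" "K \<noteq> {}"
    if "stationary_family L r d K E" for F and K :: "'k set" and E
  proof -
    show K: "finite K" "K \<noteq> {}" using that by (auto simp: stationary_family_def)
    show WK: "\<forall>i\<in>K. word L r (E i) \<in> ?W"
      using that by (auto simp: stationary_family_def intro!: word_in_type_words)
    have "(\<Sum>i\<in>K. F (word L r (E i))) = (\<Sum>w\<in>?W. \<Sum>i\<in>{i\<in>K. word L r (E i) = w}. F (word L r (E i)))"
      using WK K fin by (intro sum.group[symmetric]) auto
    also have "\<dots> = (\<Sum>w\<in>?W. real (card {i\<in>K. word L r (E i) = w}) * F w)"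
      by (intro sum.cong) auto
    finally show "(\<Sum>w\<in>?W. real (card {i\<in>K. word L r (E i) = w}) / real (card K) * F w) =
      (\<Sum>i\<in>K. F (word L r (E i))) / real (card K)" by (simp add: sum_divide_distrib)
  qed
  have "real (card {i\<in>I. word L r (C i) = w}) / real (card I) =
        real (card {j\<in>J. word L r (D j) = w}) / real (card J)" if "w \<in> ?W" for w
  proof (rule balanced_unique[OF bell_closed_type_words[OF L] balanced_stationary_family[OF f L fin]
        balanced_stationary_family[OF g L fin] _ _ that])
    show "(\<Sum>w\<in>?W. real (card {i\<in>I. word L r (C i) = w}) / real (card I)) = 1"
      using avg[OF f, of "\<lambda>_. 1"] K[OF f] by simp
    show "(\<Sum>w\<in>?W. real (card {i\<in>J. word L r (D i) = w}) / real (card J)) = 1"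
      using avg[OF g, of "\<lambda>_. 1"] K[OF g] by simp
  qed (use WK[OF f] WK[OF g] in auto)
  then have "(\<Sum>w\<in>?W. real (card {i\<in>I. word L r (C i) = w}) / real (card I) * \<psi> w) =
    (\<Sum>w\<in>?W. real (card {j\<in>J. word L r (D j) = w}) / real (card J) * \<psi> w)" by simp
  then show ?thesis unfolding avg[OF f] avg[OF g] .
qed

lemma subsets_of_card_nonempty: "c \<le> L \<Longrightarrow> subsets_of_card L c \<noteq> {}"
  by (auto simp: subsets_of_card_def intro!: exI[of _ "{..<c}"])

lemma row_space_nonempty: "(\<And>i. i \<in> {1..r} \<Longrightarrow> c i \<le> L) \<Longrightarrow> row_space L c r \<noteq> {}"
  using subsets_of_card_nonempty by (auto simp: row_space_def PiE_eq_empty_iff)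

lemma row_space_finite_row: "R \<in> row_space L c r \<Longrightarrow> i \<in> {1..r} \<Longrightarrow> finite (R i)"
  using finite_subset[OF _ finite_lessThan, of "R i" L]
  by (auto simp: row_space_def subsets_of_card_def PiE_iff)

text \<open>The map \<open>t\<close> merges the labels above \<open>t (k - 1)\<close> and up to
  \<open>t k\<close> into one class. Invariance is inherited, since an observable of the classes is
  an observable of the labels.\<close>

lemma stationary_family_mlq:
  assumes L: "3 \<le> L" and c: "mono c" "c 0 = 0" "c r \<le> L" and t: "mono t" "t m \<le> r"
  shows "stationary_family L m (\<lambda>k. c (t k)) (row_space L c r) (\<lambda>R k. mlq R r (t k))"
  unfolding stationary_family_def
proof (intro conjI ballI allI impI)
  show "row_space L c r \<noteq> {}"
    using c by (intro row_space_nonempty) (auto dest: monoD intro: le_trans)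
  fix R assume R: "R \<in> row_space L c r"
  show "mono (\<lambda>k. mlq R r (t k))"
    using mlq_mono[OF row_space_finite_row[OF R]] monoD[OF t(1)] by (intro monoI) simp
  fix k assume k: "k \<le> m"
  have "t k \<le> r" using monoD[OF t(1) k] t(2) by simp
  then show "mlq R r (t k) \<subseteq> {..<L}" "card (mlq R r (t k)) = c (t k)"
    using mlq_row_space[OF _ c(1) R, of "t k"] L c(2) by (auto simp: min_def)
next
  fix \<phi> :: "(nat \<Rightarrow> nat set) \<Rightarrow> real"
  show "(\<Sum>R\<in>row_space L c r. \<Sum>x<L. \<phi> (\<lambda>k. hop L x (mlq R r (t k)))) =
    real L * (\<Sum>R\<in>row_space L c r. \<phi> (\<lambda>k. mlq R r (t k)))"
    using mlq_stationary[OF L c(1), of "\<lambda>A. \<phi> (\<lambda>k. A (t k))" r] by simp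
qed simp

text \<open>The theorem of Ferrari and Martin for rows of \<open>1, ..., n\<close> points: the word
  of the last row is balanced, and balance determines the law. The bound \<open>n \<le> L\<close>
  makes such rows exist.\<close>

lemma tasep_pmf_eq:
  assumes L: "3 \<le> L" "n \<le> L"
  shows "tasep_pmf n L = map_pmf (\<lambda>R. word L n (mlq R n)) (pmf_of_set (row_space L (\<lambda>i. i) n))"
proof -
  let ?I = "row_space L (\<lambda>i. i) n"
  have f: "stationary_family L n (\<lambda>k. k) ?I (\<lambda>R. mlq R n)"
    using stationary_family_mlq[OF L(1), of "\<lambda>i. i" n "\<lambda>k. k" n] L by (simp add: mono_def)
  have I: "finite ?I" "?I \<noteq> {}" using f by (auto simp: stationary_family_def)
  have st: "word L n (mlq R n) \<in> tasep_states n L" if R: "R \<in> ?I" for R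
  proof -
    let ?w = "word L n (mlq R n)"
    have w: "?w \<in> type_words L n (\<lambda>k. k)"
      using f R by (auto simp: stationary_family_def intro!: word_in_type_words)
    have card: "card {s. s < L \<and> ?w ! s \<le> k} = k" if "k \<le> n" for k
      using w that by (simp add: type_words_def)
    have "{s. s < L \<and> ?w ! s \<le> 0} = {}" using card[of 0] by (auto simp: card_eq_0_iff)
    then have "\<forall>s<L. ?w ! s \<noteq> 0" by auto
    then have "0 \<notin> set ?w" by (auto simp: in_set_conv_nth)
    then have "set ?w \<subseteq> {1..n + 1}"
      using w by (auto simp: type_words_def Suc_le_eq intro!: gr0I)
    moreover have "count_list ?w k = 1" if k: "k \<in> {1..n}" for k
    proof -
      have "count_list ?w k = card {s. s < L \<and> ?w ! s = k}"
        by (simp add: count_list_eq_length_filter length_filter_conv_card eq_commute)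
      moreover have "card {s. s < L \<and> ?w ! s \<le> k} = card {s. s < L \<and> ?w ! s = k} + card {s. s < L \<and> ?w ! s \<le> k - 1}"
        using k by (subst card_Un_disjoint[symmetric]) (auto intro!: arg_cong[of _ _ card])
      ultimately show ?thesis using card[of k] card[of "k - 1"] k by auto
    qed
    ultimately show ?thesis by (simp add: tasep_states_def)
  qed
  have pmf: "pmf (map_pmf (\<lambda>R. word L n (mlq R n)) (pmf_of_set ?I)) w =
      real (card {R\<in>?I. word L n (mlq R n) = w}) / real (card ?I)" for w
    using I by (simp add: pmf_map measure_pmf_of_set vimage_def Int_def)
  show ?thesis
  proof (rule tasep_pmf_eqI)
    show "set_pmf (map_pmf (\<lambda>R. word L n (mlq R n)) (pmf_of_set ?I)) \<subseteq> tasep_states n L"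
      using I st by auto
    show "balanced L (tasep_states n L) (pmf (map_pmf (\<lambda>R. word L n (mlq R n)) (pmf_of_set ?I)))"
      unfolding pmf using balanced_stationary_family[OF f _ finite_tasep_states] st L by auto
  qed
qed

section \<open>Ballot words\<close>

text \<open>
  The letters of a word are \<open>0\<close> (empty site), \<open>1\<close>, \<open>2\<close> and \<open>3\<close> (points of the rows \<open>X\<close>, \<open>Y\<close>, \<open>Z\<close> of a
  three-line queue).
\<close>

primrec ballot :: "nat list \<Rightarrow> bool" where
  "ballot [] = True"
| "ballot (x # v) = (ballot v \<and> count_list (x # v) 1 \<le> count_list (x # v) 2 \<and>
     count_list (x # v) 2 \<le> count_list (x # v) 3)"

text \<open>Some \<open>2\<close> precedes every \<open>3\<close>. In terms of rows, there is a
  point of \<open>Y\<close> before the next service.\<close>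

primrec two_first :: "nat list \<Rightarrow> bool" where
  "two_first [] = False"
| "two_first (x # v) = (x = 2 \<or> (x \<noteq> 3 \<and> two_first v))"

text \<open>No \<open>1\<close> stands to the left of a \<open>2\<close> that precedes all
  \<open>3\<close>. After a \<open>1\<close> this forbids any further such \<open>2\<close>; from
  the first \<open>3\<close> on nothing remains to be checked.\<close>

primrec twos_clean :: "nat list \<Rightarrow> bool" where
  "twos_clean [] = True"
| "twos_clean (x # v) = (x = 3 \<or> (x = 1 \<and> \<not> two_first v) \<or> (x \<noteq> 1 \<and> x \<noteq> 3 \<and> twos_clean v))"

definition ballots :: "nat \<Rightarrow> nat \<Rightarrow> nat \<Rightarrow> nat \<Rightarrow> (nat list \<Rightarrow> bool) \<Rightarrow> nat list set" where
  "ballots m a b c P = {v. length v = m \<and> set v \<subseteq> {..3} \<and> count_list v 3 = a \<and> count_list v 2 = b \<and>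
     count_list v 1 = c \<and> ballot v \<and> P v}"

lemma finite_ballots [simp]: "finite (ballots m a b c P)"
  by (rule finite_subset[OF _ finite_lists_length_eq[of "{..3::nat}" m]]) (auto simp: ballots_def)

lemma ballots_empty: "\<not> (c \<le> b \<and> b \<le> a) \<Longrightarrow> ballots m a b c P = {}"
proof -
  have "count_list v 1 \<le> count_list v 2 \<and> count_list v 2 \<le> count_list v 3" if "ballot v" for v
    using that by (cases v) auto
  then show "\<not> (c \<le> b \<and> b \<le> a) \<Longrightarrow> ballots m a b c P = {}" by (auto simp: ballots_def)
qed

lemma ballots_0: "ballots 0 a b c P = (if a = 0 \<and> b = 0 \<and> c = 0 \<and> P [] then {[]} else {})"
  by (auto simp: ballots_def)

text \<open>Ballot conditions concern suffixes, so the first letter may be dropped; putting it back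
  adds only the condition on the total counts, which is assumed.\<close>

lemma card_ballots_Suc:
  assumes "c \<le> b" "b \<le> a"
  shows "card (ballots (Suc m) a b c P) =
    card (ballots m a b c (\<lambda>v. P (0 # v)))
    + (if c = 0 then 0 else card (ballots m a b (c - 1) (\<lambda>v. P (1 # v))))
    + (if b = 0 then 0 else card (ballots m a (b - 1) c (\<lambda>v. P (2 # v))))
    + (if a = 0 then 0 else card (ballots m (a - 1) b c (\<lambda>v. P (3 # v))))"
proof -
  let ?S = "\<lambda>x. {v. x # v \<in> ballots (Suc m) a b c P}"
  have cases: "x \<in> {0,1,2,3}" if "x # v \<in> ballots (Suc m) a b c P" for x v
    using that by (auto simp: ballots_def)
  have eq: "ballots (Suc m) a b c P = (\<Union>x\<in>{0,1,2,3}. (#) x ` ?S x)"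
  proof (intro set_eqI iffI)
    fix v assume v: "v \<in> ballots (Suc m) a b c P"
    then obtain x u where "v = x # u" by (cases v) (auto simp: ballots_def)
    then show "v \<in> (\<Union>x\<in>{0,1,2,3}. (#) x ` ?S x)" using v cases by blast
  qed auto
  have fin: "finite (?S x)" for x
    by (rule finite_imageD[of "(#) x"]) (auto intro: finite_subset[OF _ finite_ballots[of "Suc m" a b c P]])
  have "card (ballots (Suc m) a b c P) = card (\<Union>x\<in>{0,1,2,3}. (#) x ` ?S x)"
    by (rule arg_cong[OF eq])
  also have "\<dots> = (\<Sum>x\<in>{0,1,2,3}. card ((#) x ` ?S x))"
  proof (rule card_UN_disjoint)
    show "\<forall>x\<in>{0,1,2,3::nat}. finite ((#) x ` ?S x)" by (intro ballI finite_imageI fin)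
  qed auto
  also have "\<dots> = (\<Sum>x\<in>{0,1,2,3::nat}. card (?S x))"
    by (intro sum.cong refl card_image) auto
  also have "\<dots> = card (?S 0) + card (?S 1) + card (?S 2) + card (?S 3)" by simp
  also have "?S 0 = ballots m a b c (\<lambda>v. P (0 # v))" using assms by (auto simp: ballots_def)
  also have "card (?S 1) = (if c = 0 then 0 else card (ballots m a b (c - 1) (\<lambda>v. P (1 # v))))"
    using assms by (cases c) (auto simp: ballots_def intro!: arg_cong[of _ _ card])
  also have "card (?S 2) = (if b = 0 then 0 else card (ballots m a (b - 1) c (\<lambda>v. P (2 # v))))"
    using assms by (cases b) (auto simp: ballots_def intro!: arg_cong[of _ _ card])
  also have "card (?S 3) = (if a = 0 then 0 else card (ballots m (a - 1) b c (\<lambda>v. P (3 # v))))"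
    using assms by (cases a) (auto simp: ballots_def intro!: arg_cong[of _ _ card])
  finally show ?thesis .
qed

text \<open>
  The hook length formula for the shape \<open>(a, b, c)\<close>. The next numbers are the closed forms of the
  recursions \<open>late_number_rec\<close> and \<open>clean_number_rec\<close>; \<open>gap_limit\<close> is read off from the formula to be proved.
\<close>

definition ballot_number :: "nat \<Rightarrow> nat \<Rightarrow> nat \<Rightarrow> real" where
  "ballot_number a b c = (if c \<le> b \<and> b \<le> a then
     fact (a + b + c) * (real a - real b + 1) * (real b - real c + 1) * (real a - real c + 2) /
     (fact (a + 2) * fact (b + 1) * fact c) else 0)"

definition late_number :: "nat \<Rightarrow> nat \<Rightarrow> nat \<Rightarrow> real" where
  "late_number a b c = (if c \<le> b \<and> b \<le> a then if a = 0 then 1 else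
     fact (a + b + c) * (real a - real b) *
       ((real a + 1) * (real b + 1) / (real a + real b) - real c
         + real c * (real c - 1) / (real a + real b + 2)) /
     (fact (a + 1) * fact (b + 1) * fact c) else 0)"

definition gap_limit :: "nat \<Rightarrow> nat \<Rightarrow> nat \<Rightarrow> real" where
  "gap_limit n k l = real k * (real n - real k) / (real n + real k)
     + 2 * real n * real k / ((real n + real k) * (real n + real k - 1))
     - 2 * real l * (real n - real k) / (real n + real l)
     - 2 * real n * real l / ((real n + real l) * (real n + real l - 1))
     + real l * (real n - real k) / (real n + real k)"

definition clean_number :: "nat \<Rightarrow> nat \<Rightarrow> nat \<Rightarrow> real" where
  "clean_number a b c = (if c \<le> b \<and> b \<le> a then if a = 0 then 1 else
     fact (a + b + c + 1) * gap_limit (a + 1) (b + 1) c / (fact (a + 1) * fact (b + 1) * fact c) else 0)"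

section \<open>Recursions for the closed forms\<close>

lemma ballot_number_inside:
  "c \<le> b \<Longrightarrow> b \<le> a \<Longrightarrow> ballot_number a b c = fact (a + b + c) / (fact (a + 2) * fact (b + 1) * fact c) *
     ((real a - real b + 1) * (real b - real c + 1) * (real a - real c + 2))"
  by (simp add: ballot_number_def del: fact_Suc)

lemma late_number_inside:
  "c \<le> b \<Longrightarrow> b \<le> a \<Longrightarrow> 0 < a \<Longrightarrow> late_number a b c = fact (a + b + c) / (fact (a + 1) * fact (b + 1) * fact c) *
     ((real a - real b) * ((real a + 1) * (real b + 1) / (real a + real b) - real c
         + real c * (real c - 1) / (real a + real b + 2)))"
  by (simp add: late_number_def del: fact_Suc)

lemma clean_number_inside:
  "c \<le> b \<Longrightarrow> b \<le> a \<Longrightarrow> 0 < a \<Longrightarrow> clean_number a b c =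
     fact (a + b + c + 1) / (fact (a + 1) * fact (b + 1) * fact c) * gap_limit (a + 1) (b + 1) c"
  by (simp add: clean_number_def del: fact_Suc)

lemma cancel_factor:
  fixes k :: real
  assumes "k \<noteq> 0"
  shows "x / (k * A * B * C) * k = x / (A * B * C)" "x / (A * (k * B) * C) * k = x / (A * B * C)"
    "x / (A * B * (k * C)) * k = x / (A * B * C)"
  using assms by auto

lemma fact_add_one: "fact (m + 1) = (real m + 1) * fact m" "fact (m + 2) = (real m + 2) * fact (m + 1)"
  by (simp_all add: algebra_simps)

text \<open>Removal of the largest entry of a standard Young tableau. With the common factor
  \<open>K\<close> split off, each term is a polynomial that vanishes where the smaller shape is not
  a partition, so the boundary cases obey the same identity.\<close>

lemma ballot_number_rec:
  assumes "c \<le> b" "b \<le> a" "0 < a"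
  shows "ballot_number a b c = (if c = 0 then 0 else ballot_number a b (c - 1)) + (if b = 0 then 0 else ballot_number a (b - 1) c)
     + ballot_number (a - 1) b c"
proof -
  define s where "s = a + b + c - 1"
  have s: "a + b + c = s + 1" using assms by (simp add: s_def)
  have rs: "real s + 1 = real a + real b + real c" using s by (metis of_nat_1 of_nat_add)
  define K :: real where "K = fact s / (fact (a + 2) * fact (b + 1) * fact c)"
  let ?a = "real a" and ?b = "real b" and ?c = "real c"
  have 0: "ballot_number a b c = K * ((?a + ?b + ?c) * (?a - ?b + 1) * (?b - ?c + 1) * (?a - ?c + 2))"
    unfolding ballot_number_inside[OF assms(1,2)] s fact_add_one(1)[of s] rs K_def by simp
  have 1: "(if c = 0 then 0 else ballot_number a b (c - 1)) =
      K * ?c * ((?a - ?b + 1) * (?b - (?c - 1) + 1) * (?a - (?c - 1) + 2))"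
  proof (cases "c = 0")
    case False
    define d where "d = c - 1"
    have c: "c = d + 1" and d: "a + b + d = s" using s False by (auto simp: d_def)
    have "K * ?c = fact s / (fact (a + 2) * fact (b + 1) * fact d)"
    proof -
      have rc: "?c = real d + 1" by (simp add: c)
      show ?thesis unfolding K_def rc unfolding c fact_add_one(1)[of d]
        by (rule cancel_factor(3)) linarith
    qed
    moreover have "real d = ?c - 1" by (simp add: c)
    ultimately show ?thesis using ballot_number_inside[of d b a] assms False d by (simp add: d_def)
  qed simp
  have 2: "(if b = 0 then 0 else ballot_number a (b - 1) c) =
      K * (?b + 1) * ((?a - (?b - 1) + 1) * (?b - 1 - ?c + 1) * (?a - ?c + 2))"
  proof (cases "c = b")
    case True
    then show ?thesis by (simp add: ballot_number_def)
  next
    case False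
    define d where "d = b - 1"
    have b: "b = d + 1" "c \<le> d" "d \<le> a" and d: "a + d + c = s" using s False assms by (auto simp: d_def)
    have "K * (?b + 1) = fact s / (fact (a + 2) * fact (d + 1) * fact c)"
      unfolding K_def fact_add_one(1)[of b] unfolding b(1)[symmetric]
      by (rule cancel_factor(2)) linarith
    moreover have "real d = ?b - 1" by (simp add: b)
    ultimately have "ballot_number a d c = K * (?b + 1) * ((?a - (?b - 1) + 1) * (?b - 1 - ?c + 1) * (?a - ?c + 2))"
      using ballot_number_inside[OF b(2,3)] d by simp
    moreover have "b \<noteq> 0" using b by simp
    ultimately show ?thesis unfolding d_def by simp
  qed
  have 3: "ballot_number (a - 1) b c = K * (?a + 2) * ((?a - 1 - ?b + 1) * (?b - ?c + 1) * (?a - 1 - ?c + 2))"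
  proof (cases "b = a")
    case True
    then show ?thesis using assms by (auto simp: ballot_number_def)
  next
    case False
    define d where "d = a - 1"
    have a: "a = d + 1" "b \<le> d" and d: "d + b + c = s" "d + 2 = a + 1" using s False assms by (auto simp: d_def)
    have K: "K * (?a + 2) = fact s / (fact (a + 1) * fact (b + 1) * fact c)"
      unfolding K_def fact_add_one(2)[of a] by (rule cancel_factor(1)) linarith
    have rd: "real d = ?a - 1" by (simp add: a)
    have "ballot_number d b c = K * (?a + 2) * ((?a - 1 - ?b + 1) * (?b - ?c + 1) * (?a - 1 - ?c + 2))"
      using ballot_number_inside[OF assms(1) a(2), unfolded d rd] unfolding K .
    then show ?thesis unfolding d_def .
  qed
  show ?thesis unfolding 0 1 2 3 by algebra
qed

text \<open>Apart from empty sites, a ballot word in which no \<open>2\<close> precedes all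
  \<open>3\<close> starts with a \<open>1\<close> followed by a word of the same kind, or with a
  \<open>3\<close> followed by any ballot word.\<close>

lemma late_number_rec:
  assumes "c \<le> b" "b \<le> a" "0 < a"
  shows "late_number a b c = (if c = 0 then 0 else late_number a b (c - 1)) + ballot_number (a - 1) b c"
proof -
  define s where "s = a + b + c - 1"
  have s: "a + b + c = s + 1" using assms by (simp add: s_def)
  have rs: "real s + 1 = real a + real b + real c" using s by (metis of_nat_1 of_nat_add)
  define K :: real where "K = fact s / (fact (a + 1) * fact (b + 1) * fact c)"
  let ?a = "real a" and ?b = "real b" and ?c = "real c"
  \<comment> \<open>The two fractions become indeterminates with one polynomial relation each, so
    that only polynomial identities are left.\<close>
  define P where "P = (?a + 1) * (?b + 1) / (?a + ?b)"
  define Q where "Q = 1 / (?a + ?b + 2)"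
  have PQ: "P * (?a + ?b) = (?a + 1) * (?b + 1)" "Q * (?a + ?b + 2) = 1"
    using assms by (auto simp: P_def Q_def add_pos_nonneg)
  have q: "(?a + 1) * (?b + 1) / (?a + ?b) - x + x * y / (?a + ?b + 2) = P - x + x * y * Q" for x y
    by (simp add: P_def Q_def)
  have 0: "late_number a b c = K * ((?a + ?b + ?c) * ((?a - ?b) * (P - ?c + ?c * (?c - 1) * Q)))"
    unfolding late_number_inside[OF assms] s fact_add_one(1)[of s] rs K_def q by simp
  have 1: "(if c = 0 then 0 else late_number a b (c - 1)) =
      K * ?c * ((?a - ?b) * (P - (?c - 1) + (?c - 1) * (?c - 1 - 1) * Q))"
  proof (cases "c = 0")
    case False
    define d where "d = c - 1"
    have c: "c = d + 1" and d: "a + b + d = s" using s False by (auto simp: d_def)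
    have "K * ?c = fact s / (fact (a + 1) * fact (b + 1) * fact d)"
    proof -
      have rc: "?c = real d + 1" by (simp add: c)
      show ?thesis unfolding K_def rc unfolding c fact_add_one(1)[of d]
        by (rule cancel_factor(3)) linarith
    qed
    moreover have "real d = ?c - 1" by (simp add: c)
    ultimately show ?thesis using late_number_inside[of d b a, unfolded q] assms False d by (simp add: d_def)
  qed simp
  have 3: "ballot_number (a - 1) b c = K * ((?a - 1 - ?b + 1) * (?b - ?c + 1) * (?a - 1 - ?c + 2))"
  proof (cases "b = a")
    case True
    then show ?thesis using assms by (auto simp: ballot_number_def)
  next
    case False
    define d where "d = a - 1"
    have a: "a = d + 1" "b \<le> d" and d: "d + b + c = s" "d + 2 = a + 1" using s False assms by (auto simp: d_def)
    have rd: "real d = ?a - 1" by (simp add: a)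
    have "ballot_number d b c = K * ((?a - 1 - ?b + 1) * (?b - ?c + 1) * (?a - 1 - ?c + 2))"
      using ballot_number_inside[OF assms(1) a(2), unfolded d rd] unfolding K_def .
    then show ?thesis unfolding d_def .
  qed
  have "(?a + ?b + ?c) * (P - ?c + ?c * (?c - 1) * Q) =
      ?c * (P - (?c - 1) + (?c - 1) * (?c - 1 - 1) * Q) + (?b - ?c + 1) * (?a - ?c + 1)"
    using PQ by algebra
  then show ?thesis unfolding 0 1 3 by algebra
qed

lemma gap_limit_diag: "gap_limit n k k = 0"
  by (simp add: gap_limit_def)

text \<open>This is the recursion for \<open>clean_number\<close> in its second argument, cleared of
  factorials.\<close>

lemma gap_limit_rec:
  assumes n: "2 \<le> n" and k: "1 \<le> k"
  shows "(real n + real k + real l - 1) * gap_limit n k l - real k * gap_limit n (k - 1) l =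
    (real n - real k) * (real n * real k / (real n + real k - 2) - real l
       + real l * (real l - 1) / (real n + real k))"
proof -
  define x y z where "x = real n" and "y = real k" and "z = real l"
  have ge: "2 \<le> x" "1 \<le> y" "0 \<le> z" using n k by (auto simp: x_def y_def z_def)
  have y1: "real (k - 1) = y - 1" using k by (simp add: y_def of_nat_diff)
  have ne: "x + y \<noteq> 0" "x + y - 1 \<noteq> 0" "x + y - 2 \<noteq> 0" "x + z \<noteq> 0" "x + z - 1 \<noteq> 0"
    using ge by auto
  \<comment> \<open>The terms with denominators in \<open>x + z\<close> go into \<open>v\<close> and
    all others into \<open>u\<close>. The recursion reduces \<open>v\<close> to the polynomial
    \<open>2 * z * (x - y)\<close>, so the two families of denominators never meet.\<close>
  define u where "u y = y * (x - y) / (x + y) + 2 * x * y / ((x + y) * (x + y - 1)) + z * (x - y) / (x + y)" for y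
  define v where "v y = 2 * z * (x - y) / (x + z) + 2 * x * z / ((x + z) * (x + z - 1))" for y
  have U: "gap_limit n k l = u y - v y" "gap_limit n (k - 1) l = u (y - 1) - v (y - 1)"
    unfolding gap_limit_def u_def v_def y1 by (simp_all add: x_def y_def z_def)
  have "(x + y + z - 1) * v y - y * v (y - 1) = 2 * z * (x - y)"
    unfolding v_def using ne by (simp add: divide_simps) algebra
  moreover have "(x + y + z - 1) * u y - y * u (y - 1) =
      (x - y) * (x * y / (x + y - 2) + z + z * (z - 1) / (x + y))"
    unfolding u_def using ne by (simp add: divide_simps) algebra
  ultimately have "(x + y + z - 1) * (u y - v y) - y * (u (y - 1) - v (y - 1)) =
      (x - y) * (x * y / (x + y - 2) - z + z * (z - 1) / (x + y))"
    by (simp add: algebra_simps)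
  then show ?thesis unfolding U by (simp add: x_def y_def z_def)
qed

text \<open>By the first proper letter: after a \<open>1\<close> no \<open>2\<close> may precede all
  \<open>3\<close>, after a \<open>2\<close> the rest must still be clean, after a \<open>3\<close>
  it is arbitrary. By \<open>late_number_rec\<close> the first and third cases add up to
  \<open>late_number a b c\<close>, which reduces the claim to \<open>gap_limit_rec\<close>.\<close>

lemma clean_number_rec:
  assumes "c \<le> b" "b \<le> a" "0 < a"
  shows "clean_number a b c = (if c = 0 then 0 else late_number a b (c - 1)) + (if b = 0 then 0 else clean_number a (b - 1) c)
     + ballot_number (a - 1) b c"
proof -
  define K :: real where "K = fact (a + b + c) / (fact (a + 1) * fact (b + 1) * fact c)"
  let ?a = "real a" and ?b = "real b" and ?c = "real c"
  define q where "q = (?a + 1) * (?b + 1) / (?a + ?b) - ?c + ?c * (?c - 1) / (?a + ?b + 2)"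
  have 0: "clean_number a b c = K * ((?a + ?b + ?c + 1) * gap_limit (a + 1) (b + 1) c)"
    unfolding clean_number_inside[OF assms] fact_add_one(1)[of "a + b + c"] K_def by simp
  have 1: "(if b = 0 then 0 else clean_number a (b - 1) c) = K * (?b + 1) * gap_limit (a + 1) b c"
  proof (cases "c = b")
    case True
    then show ?thesis by (auto simp: clean_number_def gap_limit_diag)
  next
    case False
    define d where "d = b - 1"
    have b: "b = d + 1" "c \<le> d" "d \<le> a" "a + d + c + 1 = a + b + c"
      using False assms by (auto simp: d_def)
    have K: "K * (?b + 1) = fact (a + b + c) / (fact (a + 1) * fact b * fact c)"
      unfolding K_def fact_add_one(1)[of b] by (rule cancel_factor(2)) linarith
    have "clean_number a d c = K * (?b + 1) * gap_limit (a + 1) b c"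
      using clean_number_inside[OF b(2,3) assms(3)] unfolding K b(4) b(1)[symmetric] .
    moreover have "b \<noteq> 0" using b by simp
    ultimately show ?thesis unfolding d_def by simp
  qed
  have 2: "late_number a b c = K * ((?a - ?b) * q)"
    unfolding late_number_inside[OF assms] by (simp add: K_def q_def)
  have "(?a + ?b + ?c + 1) * gap_limit (a + 1) (b + 1) c = (?b + 1) * gap_limit (a + 1) b c + (?a - ?b) * q"
    using gap_limit_rec[of "a + 1" "b + 1" c] assms by (simp add: q_def algebra_simps)
  then have "clean_number a b c = (if b = 0 then 0 else clean_number a (b - 1) c) + late_number a b c"
    unfolding 0 1 2 by algebra
  then show ?thesis unfolding late_number_rec[OF assms] by simp
qed

lemma ballot_numbers_zero [simp]: "ballot_number 0 0 0 = 1" "late_number 0 0 0 = 1" "clean_number 0 0 0 = 1"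
  by (auto simp: ballot_number_def clean_number_def late_number_def)

lemma ballot_numbers_outside: "\<not> (c \<le> b \<and> b \<le> a) \<Longrightarrow> ballot_number a b c = 0"
   "\<not> (c \<le> b \<and> b \<le> a) \<Longrightarrow> clean_number a b c = 0" "\<not> (c \<le> b \<and> b \<le> a) \<Longrightarrow> late_number a b c = 0"
  by (auto simp: ballot_number_def clean_number_def late_number_def)

section \<open>Enumeration of ballot words\<close>

lemma choose_Suc_real:
  "0 < s \<Longrightarrow> real (Suc m choose s) = real (m choose s) + real (m choose (s - 1))"
  by (cases s) auto

text \<open>Positions and arrangement of the proper letters are independent. Pascal's rule for the
  positions separates words that start with an empty site from the others, and the recursion for
  \<open>x\<close> distributes the latter over their first letter.\<close>

lemma pascal_step:
  assumes "0 < a" "x0 = real (m choose (a + b + c)) * (x::real)"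
    and "c \<noteq> 0 \<Longrightarrow> x1 = real (m choose (a + b + (c - 1))) * y1"
    and "b \<noteq> 0 \<Longrightarrow> x2 = real (m choose (a + (b - 1) + c)) * y2"
    and "x3 = real (m choose (a - 1 + b + c)) * y3"
    and "x = (if c = 0 then 0 else y1) + (if b = 0 then 0 else y2) + y3"
  shows "x0 + (if c = 0 then 0 else x1) + (if b = 0 then 0 else x2) + x3 =
     real (Suc m choose (a + b + c)) * x"
proof -
  have "a + b + c - 1 = a - 1 + b + c" using assms(1) by simp
  moreover have "c \<noteq> 0 \<Longrightarrow> a + b + (c - 1) = a - 1 + b + c" "b \<noteq> 0 \<Longrightarrow> a + (b - 1) + c = a - 1 + b + c"
    using assms(1) by auto
  ultimately show ?thesis
    using assms choose_Suc_real[of "a + b + c" m] by (auto simp: algebra_simps)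
qed

lemma card_ballots_all: "real (card (ballots m a b c (\<lambda>_. True))) = real (m choose (a + b + c)) * ballot_number a b c"
proof (induction m arbitrary: a b c)
  case 0
  then show ?case by (auto simp: ballots_0)
next
  case (Suc m)
  consider "\<not> (c \<le> b \<and> b \<le> a)" | "c \<le> b" "b \<le> a" "a = 0" | "c \<le> b" "b \<le> a" "0 < a" by auto
  then show ?case
  proof cases
    case 3
    show ?thesis
      unfolding card_ballots_Suc[OF 3(1,2)] of_nat_add
      using 3(3) pascal_step[OF 3(3) Suc Suc Suc Suc ballot_number_rec[OF 3]]
      by (simp add: if_distrib[of real] cong: if_cong)
  qed (auto simp: ballots_empty ballot_numbers_outside card_ballots_Suc Suc.IH)
qed

lemma card_ballots_not_two_first:
  "real (card (ballots m a b c (\<lambda>v. \<not> two_first v))) = real (m choose (a + b + c)) * late_number a b c"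
proof (induction m arbitrary: a b c)
  case 0
  then show ?case by (auto simp: ballots_0)
next
  case (Suc m)
  consider "\<not> (c \<le> b \<and> b \<le> a)" | "c \<le> b" "b \<le> a" "a = 0" | "c \<le> b" "b \<le> a" "0 < a" by auto
  then show ?case
  proof cases
    case 3
    \<comment> \<open>A leading \<open>2\<close> is forbidden; the zero summand only fits the
      recursion to \<open>pascal_step\<close>.\<close>
    have r: "late_number a b c = (if c = 0 then 0 else late_number a b (c - 1)) + (if b = 0 then 0 else 0) + ballot_number (a - 1) b c"
      using late_number_rec[OF 3] by simp
    show ?thesis
      unfolding card_ballots_Suc[OF 3(1,2)] of_nat_add
      using 3(3) pascal_step[OF 3(3) Suc Suc _ card_ballots_all r, where ?x2.0 = 0]
      by (simp add: if_distrib[of real] ballots_def[of _ _ _ _ "\<lambda>_. False"] cong: if_cong)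
  qed (auto simp: ballots_empty ballot_numbers_outside card_ballots_Suc Suc.IH)
qed

lemma card_ballots_clean:
  "real (card (ballots m a b c twos_clean)) = real (m choose (a + b + c)) * clean_number a b c"
proof (induction m arbitrary: a b c)
  case 0
  then show ?case by (auto simp: ballots_0)
next
  case (Suc m)
  have sel: "(\<lambda>v. twos_clean (0 # v)) = twos_clean" "(\<lambda>v. twos_clean (2 # v)) = twos_clean"
    "(\<lambda>v. twos_clean (1 # v)) = (\<lambda>v. \<not> two_first v)" "(\<lambda>v. twos_clean (3 # v)) = (\<lambda>_. True)"
    by auto
  consider "\<not> (c \<le> b \<and> b \<le> a)" | "c \<le> b" "b \<le> a" "a = 0" | "c \<le> b" "b \<le> a" "0 < a" by auto
  then show ?case
  proof cases
    case 3
    show ?thesis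
      unfolding card_ballots_Suc[OF 3(1,2)] of_nat_add sel
      using 3(3) pascal_step[OF 3(3) Suc card_ballots_not_two_first Suc card_ballots_all clean_number_rec[OF 3]]
      by (simp add: if_distrib[of real] cong: if_cong)
  qed (auto simp: ballots_empty ballot_numbers_outside card_ballots_Suc sel Suc.IH)
qed

text \<open>The first proper letter must be a \<open>2\<close>: a \<open>1\<close> would stand
  before a \<open>2\<close> that precedes all \<open>3\<close>, and a \<open>3\<close> would precede
  every \<open>2\<close>. The rest need only be clean, which explains
  \<open>clean_number a b c\<close> with one \<open>2\<close> less.\<close>

lemma card_ballots_second_gap:
  "c \<le> Suc b \<Longrightarrow> real (card (ballots m a (Suc b) c (\<lambda>v. two_first v \<and> twos_clean v))) =
     (if Suc b \<le> a then real (m choose (a + Suc b + c)) * clean_number a b c else 0)"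
proof (induction m)
  case 0
  then show ?case by (auto simp: ballots_0)
next
  case (Suc m)
  have sel: "(\<lambda>v. two_first (0 # v) \<and> twos_clean (0 # v)) = (\<lambda>v. two_first v \<and> twos_clean v)"
    "(\<lambda>v. two_first (2 # v) \<and> twos_clean (2 # v)) = twos_clean"
    "(\<lambda>v. two_first (1 # v) \<and> twos_clean (1 # v)) = (\<lambda>_. False)"
    "(\<lambda>v. two_first (3 # v) \<and> twos_clean (3 # v)) = (\<lambda>_. False)"
    by auto
  have ne: "ballots m x y z (\<lambda>_. False) = {}" for x y z by (simp add: ballots_def)
  show ?case
  proof (cases "Suc b \<le> a")
    case True
    have "card (ballots (Suc m) a (Suc b) c (\<lambda>v. two_first v \<and> twos_clean v)) =
      card (ballots m a (Suc b) c (\<lambda>v. two_first v \<and> twos_clean v)) + card (ballots m a b c twos_clean)"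
      using Suc.prems True by (subst card_ballots_Suc) (auto simp: sel ne)
    then show ?thesis using Suc True by (simp add: card_ballots_clean algebra_simps)
  qed (auto simp: ballots_empty)
qed

section \<open>Gaps behind idle services\<close>

text \<open>Departures depend on the cyclic order alone. This serves both for rotations of the ring
  and for the passage from real points to cells.\<close>

lemma departures_image:
  fixes f :: "'a::linorder \<Rightarrow> 'b::linorder"
  assumes inj: "inj_on f (A \<union> S)"
    and cyc: "\<And>t s u. t \<in> A \<Longrightarrow> s \<in> S \<Longrightarrow> u \<in> A \<union> S \<Longrightarrow> f u \<in> cyc_int (f t) (f s) \<longleftrightarrow> u \<in> cyc_int t s"
  shows "departures (f ` A) (f ` S) = f ` departures A S"
proof -
  have im: "card (f ` B \<inter> cyc_int (f t) (f s)) = card (B \<inter> cyc_int t s)"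
    if "B \<subseteq> A \<union> S" "t \<in> A" "s \<in> S" for B t s
  proof -
    have "f ` B \<inter> cyc_int (f t) (f s) = f ` (B \<inter> cyc_int t s)" using cyc that by blast
    moreover have "inj_on f (B \<inter> cyc_int t s)" using inj by (rule inj_on_subset) (use that in auto)
    ultimately show ?thesis by (simp add: card_image)
  qed
  have "(\<exists>t\<in>f ` A. card (f ` S \<inter> cyc_int t (f s)) \<le> card (f ` A \<inter> cyc_int t (f s))) \<longleftrightarrow>
        (\<exists>t\<in>A. card (S \<inter> cyc_int t s) \<le> card (A \<inter> cyc_int t s))" if "s \<in> S" for s
    using that im[of S _ s] im[of A _ s] by auto
  then show ?thesis unfolding departures_def by blast
qed

definition rot :: "nat \<Rightarrow> nat \<Rightarrow> nat" where
  "rot L s = (if Suc s = L then 0 else Suc s)"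

lemma rot_less: "s < L \<Longrightarrow> rot L s < L"
  by (auto simp: rot_def)

lemma rot_inj: "inj_on (rot L) {..<L}"
  by (auto simp: rot_def inj_on_def split: if_splits)

lemma rot_image_inj: "X \<subseteq> {..<L} \<Longrightarrow> Y \<subseteq> {..<L} \<Longrightarrow> rot L ` X = rot L ` Y \<Longrightarrow> X = Y"
  using inj_on_image_eq_iff[OF rot_inj] by blast

lemma rot_cyc_int:
  "t < L \<Longrightarrow> s < L \<Longrightarrow> u < L \<Longrightarrow> rot L u \<in> cyc_int (rot L t) (rot L s) \<longleftrightarrow> u \<in> cyc_int t s"
  by (auto simp: rot_def cyc_int_def split: if_splits)

lemma departures_rot:
  assumes "A \<subseteq> {..<L}" "S \<subseteq> {..<L}"
  shows "departures (rot L ` A) (rot L ` S) = rot L ` departures A S"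
  using assms rot_cyc_int by (intro departures_image inj_on_subset[OF rot_inj]) blast+

text \<open>
  The service at \<open>a\<close> is unused by \<open>Y\<close>, and the next service is used by the first class customers.
  As the queue is empty at \<open>a\<close>, the latter happens iff one of them arrives in between.
\<close>

definition first_gap :: "nat set \<Rightarrow> nat set \<Rightarrow> nat set \<Rightarrow> nat \<Rightarrow> bool" where
  "first_gap X Y Z a \<longleftrightarrow> a \<in> Z - departures Y Z \<and>
     (\<exists>b\<in>departures (departures X Y) Z. b \<noteq> a \<and> Z \<inter> cyc_int a b = {a, b})"

lemma first_gap_rot:
  assumes X: "X \<subseteq> {..<L}" and Y: "Y \<subseteq> {..<L}" and Z: "Z \<subseteq> {..<L}" and a: "a < L"
  shows "first_gap (rot L ` X) (rot L ` Y) (rot L ` Z) (rot L a) \<longleftrightarrow> first_gap X Y Z a"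
proof -
  have sub: "departures X Y \<subseteq> {..<L}" "departures Y Z \<subseteq> {..<L}" "departures (departures X Y) Z \<subseteq> {..<L}"
    using departures_subset X Y Z by blast+
  have mem: "rot L s \<in> rot L ` B \<longleftrightarrow> s \<in> B" if "s < L" "B \<subseteq> {..<L}" for s B
    using that rot_inj[of L] by (auto simp: inj_on_image_mem_iff)
  have eq: "rot L ` Z \<inter> cyc_int (rot L a) (rot L b) = {rot L a, rot L b} \<longleftrightarrow> Z \<inter> cyc_int a b = {a, b}"
    if b: "b < L" for b
  proof -
    have "rot L ` Z \<inter> cyc_int (rot L a) (rot L b) = rot L ` (Z \<inter> cyc_int a b)"
      using rot_cyc_int[OF a b] Z by blast
    moreover have "{rot L a, rot L b} = rot L ` {a, b}" by simp
    ultimately show ?thesis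
      using inj_on_image_eq_iff[OF rot_inj, of "Z \<inter> cyc_int a b" L "{a, b}"] Z a b by auto
  qed
  have ne: "rot L b \<noteq> rot L a \<longleftrightarrow> b \<noteq> a" if "b < L" for b
    using that a rot_inj[of L] by (auto simp: inj_on_def)
  have D: "departures (rot L ` Y) (rot L ` Z) = rot L ` departures Y Z"
    "departures (departures (rot L ` X) (rot L ` Y)) (rot L ` Z) = rot L ` departures (departures X Y) Z"
    using departures_rot X Y Z sub by simp_all
  have "(\<exists>b\<in>rot L ` departures (departures X Y) Z. b \<noteq> rot L a \<and>
      rot L ` Z \<inter> cyc_int (rot L a) b = {rot L a, b}) \<longleftrightarrow>
    (\<exists>b\<in>departures (departures X Y) Z. b \<noteq> a \<and> Z \<inter> cyc_int a b = {a, b})"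
    using sub(3) eq ne by (auto simp: subset_iff)
  moreover have "rot L a \<in> rot L ` Z - rot L ` departures Y Z \<longleftrightarrow> a \<in> Z - departures Y Z"
    using mem[OF a Z] mem[OF a sub(2)] by auto
  ultimately show ?thesis unfolding first_gap_def D by blast
qed

text \<open>Rotations permute the triples of rows, so all sites contribute equally and the idle
  service can be placed at 0.\<close>

lemma sum_card_first_gap:
  fixes L l k n :: nat
  defines "T \<equiv> subsets_of_card L l \<times> subsets_of_card L k \<times> subsets_of_card L n"
  shows "(\<Sum>(X, Y, Z)\<in>T. card {a. a < L \<and> first_gap X Y Z a}) =
    L * card {(X, Y, Z). (X, Y, Z) \<in> T \<and> first_gap X Y Z 0}"
proof -
  have fin: "finite T" by (simp add: T_def)
  let ?K = "\<lambda>a. card {(X, Y, Z). (X, Y, Z) \<in> T \<and> first_gap X Y Z a}"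
  define r where "r = (\<lambda>(X, Y, Z). (rot L ` X, rot L ` Y, rot L ` Z))"
  have sub: "X \<subseteq> {..<L}" "card X = c" if "X \<in> subsets_of_card L c" for X c
    using that by (auto simp: subsets_of_card_def)
  have rot_sub: "rot L ` X \<in> subsets_of_card L c" if "X \<in> subsets_of_card L c" for X c
    using sub[OF that] rot_less rot_inj
    by (auto simp: subsets_of_card_def intro!: card_image[THEN trans] inj_on_subset[OF rot_inj])
  have "inj_on r T"
  proof (rule inj_onI)
    fix p q assume pq: "p \<in> T" "q \<in> T" "r p = r q"
    obtain X Y Z X' Y' Z' where e: "p = (X, Y, Z)" "q = (X', Y', Z')" by (metis prod_cases3)
    have "X \<subseteq> {..<L}" "X' \<subseteq> {..<L}" "Y \<subseteq> {..<L}" "Y' \<subseteq> {..<L}" "Z \<subseteq> {..<L}" "Z' \<subseteq> {..<L}"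
      using pq sub(1) unfolding e T_def by blast+
    moreover have "rot L ` X = rot L ` X'" "rot L ` Y = rot L ` Y'" "rot L ` Z = rot L ` Z'"
      using pq(3) by (simp_all add: e r_def)
    ultimately show "p = q"
      using rot_image_inj[of X L X'] rot_image_inj[of Y L Y'] rot_image_inj[of Z L Z'] by (simp add: e)
  qed
  moreover have "r ` T \<subseteq> T" using rot_sub by (auto simp: r_def T_def)
  ultimately have rT: "r ` T = T" using endo_inj_surj[OF fin] by blast
  have step: "?K (rot L a) = ?K a" if a: "a < L" for a
  proof -
    have "{(X, Y, Z). (X, Y, Z) \<in> T \<and> first_gap X Y Z (rot L a)} =
        r ` {(X, Y, Z). (X, Y, Z) \<in> T \<and> first_gap X Y Z a}" (is "?A = r ` ?B")
    proof (intro subset_antisym subsetI)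
      fix p assume p: "p \<in> ?A"
      then have "p \<in> r ` T" using rT by auto
      then obtain X Y Z where q: "(X, Y, Z) \<in> T" "p = r (X, Y, Z)" by (metis imageE prod_cases3)
      then have "first_gap X Y Z a" using p first_gap_rot[of X L Y Z a] sub(1) a by (auto simp: r_def T_def)
      then show "p \<in> r ` ?B" using q by blast
    next
      fix p assume "p \<in> r ` ?B"
      then obtain X Y Z where q: "(X, Y, Z) \<in> T" "first_gap X Y Z a" "p = r (X, Y, Z)" by auto
      then have "p \<in> T" using rT by blast
      moreover have "first_gap (rot L ` X) (rot L ` Y) (rot L ` Z) (rot L a)"
        using q first_gap_rot[of X L Y Z a] sub(1) a by (auto simp: T_def)
      ultimately show "p \<in> ?A" using q by (simp add: r_def)
    qed
    moreover have "inj_on r ?B" by (rule inj_on_subset[OF \<open>inj_on r T\<close>]) auto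
    ultimately show ?thesis by (simp add: card_image)
  qed
  have K0: "?K a = ?K 0" if "a < L" for a
    using that
  proof (induction a)
    case (Suc a)
    then have "rot L a = Suc a" by (simp add: rot_def)
    then show ?case using step[of a] Suc by simp
  qed simp
  have "(\<Sum>(X, Y, Z)\<in>T. card {a. a < L \<and> first_gap X Y Z a}) =
      (\<Sum>p\<in>T. \<Sum>a<L. of_bool (case p of (X, Y, Z) \<Rightarrow> first_gap X Y Z a))"
    by (intro sum.cong refl) (auto simp: of_bool_def sum.If_cases Int_def)
  also have "\<dots> = (\<Sum>a<L. ?K a)"
  proof (subst sum.swap, intro sum.cong refl)
    fix a
    show "(\<Sum>p\<in>T. of_bool (case p of (X, Y, Z) \<Rightarrow> first_gap X Y Z a)) = ?K a"
      using fin by (simp add: of_bool_def sum.If_cases) (auto intro!: arg_cong[of _ _ card])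
  qed
  also have "\<dots> = (\<Sum>a<L. ?K 0)" by (intro sum.cong refl K0) simp
  also have "\<dots> = L * ?K 0" by simp
  finally show ?thesis .
qed

lemma first_gap_0_iff:
  assumes X: "X \<subseteq> {..<L}" and Y: "Y \<subseteq> {..<L}" and Z: "Z \<subseteq> {..<L}" and Z2: "2 \<le> card Z"
  shows "first_gap X Y Z 0 \<longleftrightarrow>
    0 \<in> Z - departures Y Z \<and> (\<exists>y\<in>departures X Y. \<forall>z\<in>Z - {0}. y \<le> z)"
proof (cases "0 \<in> Z - departures Y Z")
  case False
  then show ?thesis by (auto simp: first_gap_def)
next
  case True
  define A where "A = departures X Y"
  have AY: "A \<subseteq> Y" by (simp add: A_def departures_subset)
  have fin: "finite Y" "finite Z" "finite A" using finite_subset[OF Y] finite_subset[OF Z] finite_subset[OF AY] by auto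
  have "card (Z - {0}) \<noteq> 0" using Z2 by (simp add: card_Diff_singleton_if)
  then have "Z - {0} \<noteq> {}" by force
  define b where "b = Min (Z - {0})"
  have b: "b \<in> Z - {0}" "\<And>z. z \<in> Z - {0} \<Longrightarrow> b \<le> z"
    using fin Min_in[OF _ \<open>Z - {0} \<noteq> {}\<close>] unfolding b_def by auto
  have bs: "Z \<inter> cyc_int 0 c = {0, c} \<and> c \<noteq> 0 \<longleftrightarrow> c = b" for c
  proof -
    have c: "cyc_int 0 c = {..c}" by (auto simp: cyc_int_def)
    show ?thesis
    proof
      assume h: "Z \<inter> cyc_int 0 c = {0, c} \<and> c \<noteq> 0"
      then have "c \<in> Z - {0}" by blast
      then have "b \<in> Z \<inter> cyc_int 0 c" using b(1) b(2)[of c] unfolding c by simp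
      then show "c = b" using h b(1) by simp
    next
      assume eq: "c = b"
      have "z \<in> {0, b}" if "z \<in> Z" "z \<le> b" for z using b(2)[of z] that by (cases "z = 0") auto
      then show "Z \<inter> cyc_int 0 c = {0, c} \<and> c \<noteq> 0" using b(1) True c unfolding eq by auto
    qed
  qed
  have "first_gap X Y Z 0 \<longleftrightarrow> (\<exists>c\<in>departures A Z. Z \<inter> cyc_int 0 c = {0, c} \<and> c \<noteq> 0)"
    using True unfolding first_gap_def A_def by (simp add: conj_commute)
  also have "\<dots> \<longleftrightarrow> b \<in> departures A Z"
    unfolding bs by simp
  also have "\<dots> \<longleftrightarrow> (\<exists>y\<in>A. y \<le> b)"
  proof
    assume "b \<in> departures A Z"
    then obtain t where t: "t \<in> A" "card (Z \<inter> cyc_int t b) \<le> card (A \<inter> cyc_int t b)"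
      by (auto simp: departures_def)
    show "\<exists>y\<in>A. y \<le> b"
    proof (cases "t \<le> b")
      case False
      \<comment> \<open>An interval that wraps around passes the idle service at 0, and up to there
        services outnumber arrivals. If the arrivals have caught up at \<open>b\<close>, one of them
        lies at or before \<open>b\<close>.\<close>
      have ints: "cyc_int t b = {t..} \<union> {..b}" "cyc_int t 0 = {t..} \<union> {0}"
        using False by (auto simp: cyc_int_def)
      have "\<not> card (Z \<inter> cyc_int t 0) \<le> card (Y \<inter> cyc_int t 0)"
        using True t AY by (auto simp: departures_def)
      moreover have "card (A \<inter> {t..}) \<le> card (Y \<inter> cyc_int t 0)"
        using AY fin ints by (intro card_mono) auto
      moreover have "card (Z \<inter> cyc_int t 0) \<le> card (Z \<inter> cyc_int t b)"
        using fin ints by (intro card_mono) auto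
      ultimately have "card (A \<inter> {t..}) < card (A \<inter> cyc_int t b)" using t by linarith
      then have "A \<inter> cyc_int t b \<noteq> A \<inter> {t..}" by auto
      then show ?thesis using ints by auto
    qed (use t in auto)
  next
    assume "\<exists>y\<in>A. y \<le> b"
    then obtain y where y: "y \<in> A" "y \<le> b" by blast
    have "y \<noteq> 0"
    proof
      assume "y = 0"
      then have "0 \<in> Y" using y AY by auto
      then have "0 \<in> departures Y Z" using True by (auto simp: departures_def cyc_int_self intro!: bexI[of _ 0])
      then show False using True by simp
    qed
    have "Z \<inter> cyc_int y b = {b}"
    proof -
      have "z = b" if "z \<in> Z" "y \<le> z" "z \<le> b" for z
        using b(2)[of z] that \<open>y \<noteq> 0\<close> by auto
      then show ?thesis using y b(1) by (auto simp: cyc_int_def)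
    qed
    moreover have "y \<in> A \<inter> cyc_int y b" using y by (auto simp: cyc_int_def)
    then have "0 < card (A \<inter> cyc_int y b)" using fin by (auto simp: card_gt_0_iff)
    ultimately show "b \<in> departures A Z" using y b by (auto simp: departures_def intro!: bexI[of _ y])
  qed
  also have "\<dots> \<longleftrightarrow> (\<exists>y\<in>A. \<forall>z\<in>Z - {0}. y \<le> z)"
  proof
    assume "\<exists>y\<in>A. y \<le> b"
    then show "\<exists>y\<in>A. \<forall>z\<in>Z - {0}. y \<le> z" using b(2) by (meson le_trans)
  qed (use b(1) in blast)
  finally show ?thesis using True unfolding A_def by simp
qed

text \<open>
  As for \<open>first_gap X Y Z 0\<close>, but with only second class arrivals in between.
\<close>

definition second_gap :: "nat set \<Rightarrow> nat set \<Rightarrow> nat set \<Rightarrow> bool" where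
  "second_gap X Y Z \<longleftrightarrow> 0 \<in> Z - departures Y Z \<and> (\<exists>y\<in>Y. \<forall>z\<in>Z - {0}. y \<le> z) \<and>
     \<not> (\<exists>y\<in>departures X Y. \<forall>z\<in>Z - {0}. y \<le> z)"

definition second_gap_count :: "nat \<Rightarrow> nat \<Rightarrow> nat \<Rightarrow> nat \<Rightarrow> nat" where
  "second_gap_count L l k n = card {(X, Y, Z). (X, Y, Z) \<in> subsets_of_card L l \<times> subsets_of_card L k \<times> subsets_of_card L n
     \<and> second_gap X Y Z}"

lemma card_subsets_of_card: "card (subsets_of_card L c) = L choose c"
  unfolding subsets_of_card_def using n_subsets[of "{..<L}" c] by simp

lemma subsets_of_card_0: "subsets_of_card L 0 = {{}}"
  by (auto simp: subsets_of_card_def dest: finite_subset[OF _ finite_lessThan])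

text \<open>The condition \<open>E\<close>, a point of \<open>Y\<close> before the next service,
  splits into the two kinds of gap. It does not involve \<open>X\<close>, and for empty
  \<open>X\<close> it is the same as \<open>second_gap\<close>; hence the right-hand side.\<close>

lemma card_first_gap_0:
  assumes n: "2 \<le> n"
  shows "card {(X, Y, Z). (X, Y, Z) \<in> subsets_of_card L l \<times> subsets_of_card L k \<times> subsets_of_card L n \<and> first_gap X Y Z 0}
     + second_gap_count L l k n = (L choose l) * second_gap_count L 0 k n"
proof -
  let ?T = "\<lambda>l. subsets_of_card L l \<times> subsets_of_card L k \<times> subsets_of_card L n"
  define E where "E Y Z \<longleftrightarrow> 0 \<in> Z - departures Y Z \<and> (\<exists>y\<in>Y. \<forall>z\<in>Z - {0}. y \<le> z)" for Y Z :: "nat set"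
  have fin: "finite (?T l)" for l by simp
  have second_gap: "second_gap X Y Z \<longleftrightarrow> E Y Z \<and> \<not> (\<exists>y\<in>departures X Y. \<forall>z\<in>Z - {0}. y \<le> z)" for X Y Z
    by (auto simp: second_gap_def E_def)
  have second_gap_E: "second_gap X Y Z \<Longrightarrow> E Y Z" for X Y Z by (simp add: second_gap)
  have first_gap: "first_gap X Y Z 0 \<longleftrightarrow> E Y Z \<and> \<not> second_gap X Y Z"
    if "X \<in> subsets_of_card L l" "Y \<in> subsets_of_card L k" "Z \<in> subsets_of_card L n" for X Y Z
  proof -
    have "X \<subseteq> {..<L}" "Y \<subseteq> {..<L}" "Z \<subseteq> {..<L}" "2 \<le> card Z"
      using that n by (auto simp: subsets_of_card_def)
    from first_gap_0_iff[OF this] show ?thesis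
      using departures_subset[of X Y] unfolding second_gap E_def by blast
  qed
  have "card {(X, Y, Z). (X, Y, Z) \<in> ?T l \<and> first_gap X Y Z 0} + second_gap_count L l k n =
     card ({(X, Y, Z). (X, Y, Z) \<in> ?T l \<and> first_gap X Y Z 0} \<union> {(X, Y, Z). (X, Y, Z) \<in> ?T l \<and> second_gap X Y Z})"
    unfolding second_gap_count_def using first_gap
    by (intro card_Un_disjoint[symmetric] finite_subset[OF _ fin[of l]]) auto
  also have "{(X, Y, Z). (X, Y, Z) \<in> ?T l \<and> first_gap X Y Z 0} \<union> {(X, Y, Z). (X, Y, Z) \<in> ?T l \<and> second_gap X Y Z} =
     subsets_of_card L l \<times> {(Y, Z). (Y, Z) \<in> subsets_of_card L k \<times> subsets_of_card L n \<and> E Y Z}"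
    using first_gap second_gap_E by auto
  also have "card \<dots> = (L choose l) * card {(Y, Z). (Y, Z) \<in> subsets_of_card L k \<times> subsets_of_card L n \<and> E Y Z}"
    by (simp only: card_cartesian_product card_subsets_of_card)
  also have "card {(Y, Z). (Y, Z) \<in> subsets_of_card L k \<times> subsets_of_card L n \<and> E Y Z} = second_gap_count L 0 k n"
  proof -
    have "{(X, Y, Z). (X, Y, Z) \<in> ?T 0 \<and> second_gap X Y Z} =
      Pair {} ` {(Y, Z). (Y, Z) \<in> subsets_of_card L k \<times> subsets_of_card L n \<and> E Y Z}"
      by (auto simp: subsets_of_card_0 second_gap departures_def)
    then show ?thesis unfolding second_gap_count_def by (simp add: card_image inj_on_def)
  qed
  finally show ?thesis .
qed

section \<open>Gaps as ballot words\<close>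

lemma nat_set_least:
  fixes B :: "nat set"
  assumes "B \<noteq> {}"
  shows "\<exists>u. u \<in> B \<and> (\<forall>y\<in>B. u \<le> y)"
  using assms LeastI_ex[of "\<lambda>u. u \<in> B"] Least_le[of "\<lambda>u. u \<in> B"]
  by (intro exI[of _ "LEAST u. u \<in> B"]) auto

text \<open>Letters are numbered from 1, because site 0 is reserved for the idle service.\<close>

primrec letter_sites :: "nat \<Rightarrow> nat list \<Rightarrow> nat set" where
  "letter_sites x [] = {}"
| "letter_sites x (y # v) = (if y = x then {1} else {}) \<union> Suc ` letter_sites x v"

lemma mem_letter_sites: "s \<in> letter_sites x v \<longleftrightarrow> 1 \<le> s \<and> s \<le> length v \<and> v ! (s - 1) = x"
proof (induction v arbitrary: s)
  case (Cons y v)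
  show ?case
  proof (cases s)
    case (Suc u)
    show ?thesis using Cons[of u] by (cases u) (auto simp: Suc)
  qed auto
qed auto

lemma letter_sites_pos: "s \<in> letter_sites x v \<Longrightarrow> 1 \<le> s"
  by (simp add: mem_letter_sites)

lemma finite_letter_sites [simp]: "finite (letter_sites x v)"
  by (induction v) auto

lemma card_letter_sites: "card (letter_sites x v) = count_list v x"
proof (induction v)
  case (Cons y v)
  have "1 \<notin> Suc ` letter_sites x v" using letter_sites_pos by fastforce
  then show ?case using Cons by (auto simp: card_image)
qed simp

lemma ballot_iff:
  "ballot v \<longleftrightarrow> (\<forall>t\<ge>1. card (letter_sites 1 v \<inter> {t..}) \<le> card (letter_sites 2 v \<inter> {t..}) \<and>
     card (letter_sites 2 v \<inter> {t..}) \<le> card (letter_sites 3 v \<inter> {t..}))"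
proof (induction v)
  case (Cons y v)
  let ?c = "\<lambda>x v t. card (letter_sites x v \<inter> {t..})"
  have one: "?c x (y # v) 1 = count_list (y # v) x" for x
  proof -
    have "letter_sites x (y # v) \<inter> {1..} = letter_sites x (y # v)" using letter_sites_pos by fastforce
    then show ?thesis by (simp only: card_letter_sites)
  qed
  have suc: "?c x (y # v) (Suc t) = ?c x v t" if "1 \<le> t" for x t
  proof -
    have "letter_sites x (y # v) \<inter> {Suc t..} = Suc ` (letter_sites x v \<inter> {t..})" using that by auto
    then show ?thesis by (simp add: card_image)
  qed
  have all: "(\<forall>t\<ge>1. P t) \<longleftrightarrow> P 1 \<and> (\<forall>t\<ge>1. P (Suc t))" for P :: "nat \<Rightarrow> bool"
  proof (intro iffI allI impI)
    fix t :: nat assume P: "P 1 \<and> (\<forall>t\<ge>1. P (Suc t))" and t: "1 \<le> t"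
    show "P t"
    proof (cases "t = 1")
      case False
      then have "t = Suc (t - 1)" "1 \<le> t - 1" using t by auto
      then show ?thesis using P by metis
    qed (use P in simp)
  qed auto
  have "(\<forall>t\<ge>1. ?c 1 (y # v) t \<le> ?c 2 (y # v) t \<and> ?c 2 (y # v) t \<le> ?c 3 (y # v) t) \<longleftrightarrow>
      (?c 1 (y # v) 1 \<le> ?c 2 (y # v) 1 \<and> ?c 2 (y # v) 1 \<le> ?c 3 (y # v) 1) \<and>
      (\<forall>t\<ge>1. ?c 1 (y # v) (Suc t) \<le> ?c 2 (y # v) (Suc t) \<and> ?c 2 (y # v) (Suc t) \<le> ?c 3 (y # v) (Suc t))"
    by (rule all)
  also have "\<dots> \<longleftrightarrow> ballot (y # v)"
    unfolding one ballot.simps Cons using suc by auto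
  finally show ?case by simp
qed simp

lemma two_first_iff: "two_first v \<longleftrightarrow> (\<exists>y\<in>letter_sites 2 v. \<forall>z\<in>letter_sites 3 v. y \<le> z)"
proof (induction v)
  case (Cons x v)
  consider "x = 2" | "x = 3" | "x \<noteq> 2" "x \<noteq> 3" by blast
  then show ?case
  proof cases
    case 1
    then show ?thesis by (auto intro!: bexI[of _ 1])
  next
    case 2
    then show ?thesis using letter_sites_pos by fastforce
  next
    case 3
    then show ?thesis using Cons by simp
  qed
qed simp

lemma twos_clean_iff:
  "twos_clean v \<longleftrightarrow>
     (\<forall>y\<in>letter_sites 2 v. (\<forall>z\<in>letter_sites 3 v. y \<le> z) \<longrightarrow> (\<forall>x\<in>letter_sites 1 v. y \<le> x))"
proof (induction v)
  case (Cons x v)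
  consider "x = 2" | "x = 3" | "x = 1" | "x \<noteq> 2" "x \<noteq> 3" "x \<noteq> 1" by blast
  then show ?case
  proof cases
    case 1
    then show ?thesis using Cons by auto
  next
    case 2
    then show ?thesis using letter_sites_pos by fastforce
  next
    case 3
    have "y \<noteq> 0" if "y \<in> letter_sites 2 v" for y using letter_sites_pos[OF that] by simp
    then have "(\<forall>y\<in>letter_sites 2 v. (\<forall>z\<in>letter_sites 3 v. y \<le> z) \<longrightarrow> y = 0 \<and> (\<forall>x\<in>letter_sites 1 v. y \<le> x))
      \<longleftrightarrow> \<not> two_first v"
      unfolding two_first_iff by blast
    then show ?thesis using 3 by simp
  next
    case 4
    then show ?thesis using Cons by simp
  qed
qed simp

text \<open>A suffix may be shortened until it starts with a point of \<open>Y\<close>: the count in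
  \<open>Y\<close> stays and the count in \<open>Z\<close> can only drop.\<close>

lemma suffix_le_extend:
  fixes Y Z :: "nat set"
  assumes "finite Y" "finite Z" "\<forall>t\<in>Y. card (Y \<inter> {t..}) \<le> card (Z \<inter> {t..})"
  shows "card (Y \<inter> {t..}) \<le> card (Z \<inter> {t..})"
proof (cases "Y \<inter> {t..} = {}")
  case False
  then obtain u where "u \<in> Y \<inter> {t..} \<and> (\<forall>y\<in>Y \<inter> {t..}. u \<le> y)"
    using nat_set_least by meson
  then have u: "u \<in> Y \<inter> {t..}" "\<And>y. y \<in> Y \<inter> {t..} \<Longrightarrow> u \<le> y" by auto
  have "Y \<inter> {t..} = Y \<inter> {u..}" using u by auto
  moreover have "card (Z \<inter> {u..}) \<le> card (Z \<inter> {t..})" using u assms by (intro card_mono) auto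
  moreover have "card (Y \<inter> {u..}) \<le> card (Z \<inter> {u..})" using assms(3) u by blast
  ultimately show ?thesis by simp
qed simp

text \<open>The three conditions on words emerge here: the suffix inequalities say that the service
  at 0 is idle and that no first class customer is carried over past 0, and the last clause excludes
  first class arrivals that would be served before the next service.\<close>

lemma second_gap_disjoint_iff:
  assumes pos: "\<And>s. s \<in> X \<union> Y \<union> Z \<Longrightarrow> 1 \<le> s" and fin: "finite X" "finite Y" "finite Z"
    and disj: "X \<inter> Y = {}" "Y \<inter> Z = {}"
  shows "second_gap X Y (insert 0 Z) \<longleftrightarrow>
    (\<forall>t\<ge>1. card (X \<inter> {t..}) \<le> card (Y \<inter> {t..}) \<and> card (Y \<inter> {t..}) \<le> card (Z \<inter> {t..})) \<and>
    (\<exists>y\<in>Y. \<forall>z\<in>Z. y \<le> z) \<and> (\<forall>y\<in>Y. (\<forall>z\<in>Z. y \<le> z) \<longrightarrow> (\<forall>x\<in>X. y \<le> x))"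
proof -
  have Z0: "0 \<notin> Z" "0 \<notin> Y" "0 \<notin> X" using pos by fastforce+
  \<comment> \<open>An interval ending at 0 is a suffix together with the service at 0. This one
    extra service turns "used" into a strict excess of \<open>Y\<close> in the suffix.\<close>
  have zero: "0 \<notin> departures Y (insert 0 Z) \<longleftrightarrow> (\<forall>t\<ge>1. card (Y \<inter> {t..}) \<le> card (Z \<inter> {t..}))"
  proof -
    have "card (insert 0 Z \<inter> cyc_int t 0) \<le> card (Y \<inter> cyc_int t 0) \<longleftrightarrow> \<not> card (Y \<inter> {t..}) \<le> card (Z \<inter> {t..})"
      if "t \<in> Y" for t
    proof -
      have "cyc_int t 0 = {t..} \<union> {0}" using pos that by (auto simp: cyc_int_def)
      then have "insert 0 Z \<inter> cyc_int t 0 = insert 0 (Z \<inter> {t..})" "Y \<inter> cyc_int t 0 = Y \<inter> {t..}"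
        using Z0 by auto
      then show ?thesis using Z0 fin by auto
    qed
    then have "0 \<notin> departures Y (insert 0 Z) \<longleftrightarrow> (\<forall>t\<in>Y. card (Y \<inter> {t..}) \<le> card (Z \<inter> {t..}))"
      by (auto simp: departures_def)
    also have "\<dots> \<longleftrightarrow> (\<forall>t\<ge>1. card (Y \<inter> {t..}) \<le> card (Z \<inter> {t..}))"
      using suffix_le_extend[OF fin(2,3)] pos by auto
    finally show ?thesis .
  qed
  let ?pre = "\<lambda>y. \<forall>z\<in>Z. y \<le> z"
  have free: "\<not> (\<exists>y\<in>departures X Y. ?pre y) \<longleftrightarrow>
    (\<forall>t\<ge>1. card (X \<inter> {t..}) \<le> card (Y \<inter> {t..})) \<and> (\<forall>y\<in>Y. ?pre y \<longrightarrow> (\<forall>x\<in>X. y \<le> x))"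
    if ex: "\<exists>y\<in>Y. ?pre y"
  proof (intro iffI conjI)
    assume no: "\<not> (\<exists>y\<in>departures X Y. ?pre y)"
    show clean: "\<forall>y\<in>Y. ?pre y \<longrightarrow> (\<forall>x\<in>X. y \<le> x)"
    proof (intro ballI impI, rule ccontr)
      fix y x assume y: "y \<in> Y" "?pre y" and x: "x \<in> X" "\<not> y \<le> x"
      \<comment> \<open>The first point \<open>u\<close> of \<open>Y\<close> from \<open>x\<close>
        on would serve the arrival at \<open>x\<close>, and it comes no later than
        \<open>y\<close>.\<close>
      have "Y \<inter> {x..} \<noteq> {}" using y x by auto
      then obtain u where "u \<in> Y \<inter> {x..} \<and> (\<forall>y\<in>Y \<inter> {x..}. u \<le> y)"
        using nat_set_least by meson
      then have u: "u \<in> Y \<inter> {x..}" "\<And>y. y \<in> Y \<inter> {x..} \<Longrightarrow> u \<le> y" by auto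
      have "u \<le> y" using u y x by auto
      then have "?pre u" using y by (meson le_trans)
      have "w = u" if "w \<in> Y" "x \<le> w" "w \<le> u" for w using u(2)[of w] that by simp
      then have "Y \<inter> cyc_int x u = {u}" using u(1) by (auto simp: cyc_int_def)
      moreover have "x \<in> X \<inter> cyc_int x u" using x u by (auto simp: cyc_int_def)
      then have "0 < card (X \<inter> cyc_int x u)" using fin by (auto simp: card_gt_0_iff)
      ultimately have "u \<in> departures X Y" using u x by (auto simp: departures_def intro!: bexI[of _ x])
      then show False using no \<open>?pre u\<close> by blast
    qed
    show "\<forall>t\<ge>1. card (X \<inter> {t..}) \<le> card (Y \<inter> {t..})"
    proof -
      have "Y \<noteq> {}" using ex by blast
      then obtain u where "u \<in> Y \<and> (\<forall>y\<in>Y. u \<le> y)" using nat_set_least by meson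
      then have u: "u \<in> Y" "\<And>y. y \<in> Y \<Longrightarrow> u \<le> y" by auto
      have "?pre u" using ex u by (meson le_trans)
      have "card (X \<inter> {t..}) \<le> card (Y \<inter> {t..})" if t: "t \<in> X" for t
      proof (rule ccontr)
        assume less: "\<not> ?thesis"
        \<comment> \<open>An excess of \<open>X\<close> over \<open>Y\<close> in the suffix would be
          carried around the ring to \<open>u\<close>, the first point of \<open>Y\<close>, and make
          it a departure.\<close>
        have "u \<le> t" "u \<noteq> t" using clean u \<open>?pre u\<close> t disj by auto
        then have c: "cyc_int t u = {t..} \<union> {..u}" by (auto simp: cyc_int_def)
        have "Y \<inter> cyc_int t u = insert u (Y \<inter> {t..})" unfolding c using u(1) antisym[OF _ u(2)] by auto
        then have "card (Y \<inter> cyc_int t u) \<le> Suc (card (Y \<inter> {t..}))" using fin by (simp add: card_insert_if)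
        also have "\<dots> \<le> card (X \<inter> {t..})" using less by simp
        also have "\<dots> \<le> card (X \<inter> cyc_int t u)" unfolding c using fin by (intro card_mono) auto
        finally have "u \<in> departures X Y" using u t by (auto simp: departures_def)
        then show False using no \<open>?pre u\<close> by blast
      qed
      then show ?thesis using suffix_le_extend[OF fin(1,2)] by blast
    qed
  next
    assume R: "(\<forall>t\<ge>1. card (X \<inter> {t..}) \<le> card (Y \<inter> {t..})) \<and> (\<forall>y\<in>Y. ?pre y \<longrightarrow> (\<forall>x\<in>X. y \<le> x))"
    show "\<not> (\<exists>y\<in>departures X Y. ?pre y)"
    proof
      assume "\<exists>y\<in>departures X Y. ?pre y"
      then obtain y t where y: "y \<in> Y" "?pre y" and t: "t \<in> X" "card (Y \<inter> cyc_int t y) \<le> card (X \<inter> cyc_int t y)"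
        by (auto simp: departures_def)
      have gt: "y < x" if "x \<in> X" for x 
      proof -
        have "y \<le> x" "y \<noteq> x" using R y that disj by auto
        then show ?thesis by simp
      qed
      \<comment> \<open>All points of \<open>X\<close> lie after \<open>y\<close>, so the interval
        wraps around. It meets \<open>X\<close> in a suffix only, but contains \<open>y\<close> in
        addition to the suffix of \<open>Y\<close>; equality or excess in the interval thus violates
        the suffix inequality.\<close>
      have c: "cyc_int t y = {t..} \<union> {..y}" using gt[OF t(1)] by (auto simp: cyc_int_def)
      have "X \<inter> cyc_int t y = X \<inter> {t..}" unfolding c using gt by fastforce
      moreover have "insert y (Y \<inter> {t..}) \<subseteq> Y \<inter> cyc_int t y" unfolding c using y by auto
      then have "card (insert y (Y \<inter> {t..})) \<le> card (Y \<inter> cyc_int t y)" using fin by (intro card_mono) auto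
      moreover have "y \<notin> {t..}" using gt[OF t(1)] by simp
      ultimately have "card (Y \<inter> {t..}) < card (X \<inter> {t..})" using t fin by (simp add: card_insert_if)
      then show False using R pos t by (metis UnCI leD)
    qed
  qed
  have ins: "insert 0 Z - {0} = Z" using Z0 by auto
  show ?thesis unfolding second_gap_def ins using zero free by blast
qed

text \<open>Disjoint rows put at most one letter on each of the sites \<open>1, ..., m\<close>. One
  point of \<open>Z\<close> sits at 0, which leaves \<open>n - 1\<close> letters
  \<open>3\<close>.\<close>

lemma card_second_gap_disjoint:
  fixes m :: nat
  assumes n: "1 \<le> n"
  shows "card {(X, Y, Z). (X, Y, Z) \<in> subsets_of_card (Suc m) l \<times> subsets_of_card (Suc m) k \<times> subsets_of_card (Suc m) n
      \<and> second_gap X Y Z \<and> X \<inter> Y = {} \<and> X \<inter> Z = {} \<and> Y \<inter> Z = {}} =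
    card (ballots m (n - 1) k l (\<lambda>v. two_first v \<and> twos_clean v))" (is "card ?S = card ?B")
proof -
  let ?g = "\<lambda>v. (letter_sites 1 v, letter_sites 2 v, insert 0 (letter_sites 3 v))"
  have badv: "second_gap (letter_sites 1 v) (letter_sites 2 v) (insert 0 (letter_sites 3 v)) \<longleftrightarrow>
      ballot v \<and> two_first v \<and> twos_clean v" for v
  proof -
    have "letter_sites 1 v \<inter> letter_sites 2 v = {}" "letter_sites 2 v \<inter> letter_sites 3 v = {}"
      by (auto simp: mem_letter_sites)
    then show ?thesis unfolding ballot_iff two_first_iff twos_clean_iff
      by (intro second_gap_disjoint_iff) (auto dest: letter_sites_pos)
  qed
  have inj: "inj_on ?g ?B"
  proof (rule inj_onI)
    fix v w assume v: "v \<in> ?B" and w: "w \<in> ?B" and eq: "?g v = ?g w"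
    have len: "length v = m" "length w = m" using v w by (auto simp: ballots_def)
    have 3: "letter_sites 3 v = letter_sites 3 w"
    proof -
      have "0 \<notin> letter_sites 3 v" "0 \<notin> letter_sites 3 w" using letter_sites_pos by fastforce+
      then show ?thesis using eq by (simp add: insert_ident)
    qed
    show "v = w"
    proof (rule nth_equalityI)
      fix i assume i: "i < length v"
      have "v ! i = x \<longleftrightarrow> w ! i = x" if "x \<in> {1,2,3}" for x
      proof -
        have "Suc i \<in> letter_sites x v \<longleftrightarrow> Suc i \<in> letter_sites x w" using eq 3 that by auto
        then show ?thesis using i len by (simp add: mem_letter_sites)
      qed
      from this[of 1] this[of 2] this[of 3]
      have "v ! i = 1 \<longleftrightarrow> w ! i = 1" "v ! i = 2 \<longleftrightarrow> w ! i = 2" "v ! i = 3 \<longleftrightarrow> w ! i = 3" by auto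
      moreover have "v ! i \<le> 3" "w ! i \<le> 3"
        using v w i len nth_mem[of i v] nth_mem[of i w] by (auto simp: ballots_def subset_iff)
      ultimately show "v ! i = w ! i" by linarith
    qed (use len in simp)
  qed
  have "?g ` ?B = ?S"
  proof (intro subset_antisym subsetI)
    fix p assume "p \<in> ?g ` ?B"
    then obtain v where v: "v \<in> ?B" "p = ?g v" by blast
    have sub: "letter_sites x v \<subseteq> {..<Suc m}" for x
      using v by (auto simp: mem_letter_sites ballots_def)
    have "0 \<notin> letter_sites 3 v" using letter_sites_pos by fastforce
    then have "card (insert 0 (letter_sites 3 v)) = n"
      using v n by (simp add: card_letter_sites ballots_def)
    then show "p \<in> ?S"
      using v sub badv by (auto simp: ballots_def subsets_of_card_def card_letter_sites mem_letter_sites)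
  next
    fix p assume p: "p \<in> ?S"
    then obtain X Y Z where q: "p = (X, Y, Z)" "X \<subseteq> {..<Suc m}" "card X = l" "Y \<subseteq> {..<Suc m}" "card Y = k"
      "Z \<subseteq> {..<Suc m}" "card Z = n" "second_gap X Y Z" "X \<inter> Y = {}" "X \<inter> Z = {}" "Y \<inter> Z = {}"
      by (auto simp: subsets_of_card_def)
    have 0: "0 \<in> Z" using q by (simp add: second_gap_def)
    define v where "v = map (\<lambda>i. if i \<in> X then 1 else if i \<in> Y then 2 else if i \<in> Z then 3 else (0::nat)) [1..<Suc m]"
    have nth: "v ! (s - 1) = (if s \<in> X then 1 else if s \<in> Y then 2 else if s \<in> Z then 3 else 0)"
      if "1 \<le> s" "s \<le> m" for s using that by (simp add: v_def del: upt_Suc)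
    have len: "length v = m" by (simp add: v_def)
    have mem: "s \<in> letter_sites x v \<longleftrightarrow> 1 \<le> s \<and> s \<le> m \<and>
       (if s \<in> X then 1 else if s \<in> Y then 2 else if s \<in> Z then 3 else 0) = x" for s x
      using nth by (auto simp: mem_letter_sites len)
    have X0: "0 \<notin> X" "0 \<notin> Y" using 0 q by auto
    have L1: "letter_sites 1 v = X"
      using q(2) X0 unfolding set_eq_iff mem by (auto simp: Suc_le_eq intro!: gr0I split: if_splits)
    have L2: "letter_sites 2 v = Y"
      using q(2,4,9) X0 unfolding set_eq_iff mem by (auto simp: Suc_le_eq intro!: gr0I split: if_splits)
    have L3: "insert 0 (letter_sites 3 v) = Z"
      using q(6,10,11) 0 unfolding set_eq_iff insert_iff mem
      by (auto simp: Suc_le_eq intro!: gr0I split: if_splits)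
    have "ballot v \<and> two_first v \<and> twos_clean v" using badv[of v] q(8) unfolding L1 L2 L3 by simp
    moreover have "count_list v 1 = l" "count_list v 2 = k"
      using card_letter_sites[of 1 v] card_letter_sites[of 2 v] L1 L2 q by auto
    moreover have "count_list v 3 = n - 1"
    proof -
      have "0 \<notin> letter_sites 3 v" using letter_sites_pos by fastforce
      then have "card Z = Suc (count_list v 3)" using L3[symmetric] by (simp add: card_letter_sites)
      then show ?thesis using q by simp
    qed
    moreover have "set v \<subseteq> {..3}" by (auto simp: v_def)
    ultimately have "v \<in> ?B" using len by (simp add: ballots_def)
    moreover have "p = ?g v" using q(1) L1 L2 L3 by simp
    ultimately show "p \<in> ?g ` ?B" by blast
  qed
  then show ?thesis using card_image[OF inj] by simp
qed

section \<open>Asymptotic counts\<close>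

lemma tendsto_choose:
  "(\<lambda>L. real ((L - j) choose m) / real L ^ m) \<longlonglongrightarrow> 1 / fact m"
proof -
  have "(\<lambda>L. (\<Prod>i=0..<m. (real L - real j - real i) / real L) / fact m) \<longlonglongrightarrow> (\<Prod>i=0..<m. 1) / fact m"
  proof (intro tendsto_intros)
    fix i
    have "(\<lambda>L. 1 - (real j + real i) * inverse (real L)) \<longlonglongrightarrow> 1 - (real j + real i) * 0"
      by (intro tendsto_intros lim_inverse_n)
    moreover have "eventually (\<lambda>L. 1 - (real j + real i) * inverse (real L) = (real L - real j - real i) / real L) sequentially"
      using eventually_gt_at_top[of 0] by eventually_elim (simp add: field_simps)
    ultimately show "(\<lambda>L. (real L - real j - real i) / real L) \<longlonglongrightarrow> 1"
      by (simp add: tendsto_cong)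
  qed auto
  moreover have "eventually (\<lambda>L. (\<Prod>i=0..<m. (real L - real j - real i) / real L) / fact m =
      real ((L - j) choose m) / real L ^ m) sequentially"
    using eventually_ge_at_top[of j]
  proof eventually_elim
    case (elim L)
    have "real ((L - j) choose m) = (\<Prod>i=0..<m. real L - real j - real i) / fact m"
      using elim by (simp add: binomial_gbinomial gbinomial_prod_rev of_nat_diff)
    then show ?case by (simp add: prod_dividef)
  qed
  ultimately show ?thesis by (simp add: tendsto_cong)
qed

text \<open>The two counts have the same leading order in \<open>L\<close>, so rows that overlap
  will be negligible.\<close>

lemma card_marked_disjoint:
  fixes L l k n :: nat
  assumes L: "0 < L" and n: "1 \<le> n"
  defines "T \<equiv> subsets_of_card L l \<times> subsets_of_card L k \<times> subsets_of_card L n"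
  shows "card {(X, Y, Z). (X, Y, Z) \<in> T \<and> 0 \<in> Z} = (L choose l) * (L choose k) * ((L - 1) choose (n - 1))"
    and "card {(X, Y, Z). (X, Y, Z) \<in> T \<and> 0 \<in> Z \<and> X \<inter> Y = {} \<and> X \<inter> Z = {} \<and> Y \<inter> Z = {}} =
      ((L - 1) choose (n - 1)) * ((L - n) choose k) * ((L - n - k) choose l)"
proof -
  let ?M = "{Z \<in> subsets_of_card L n. 0 \<in> Z}"
  have "bij_betw (insert 0) {Z. Z \<subseteq> {1..<L} \<and> card Z = n - 1} ?M"
  proof (rule bij_betwI[where g = "\<lambda>Z. Z - {0}"])
    show "insert 0 \<in> {Z. Z \<subseteq> {1..<L} \<and> card Z = n - 1} \<rightarrow> ?M"
    proof
      fix Z assume Z: "Z \<in> {Z. Z \<subseteq> {1..<L} \<and> card Z = n - 1}"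
      then have "finite Z" "0 \<notin> Z" using finite_subset[of Z "{1..<L}"] by auto
      then show "insert 0 Z \<in> ?M" using Z n L by (auto simp: subsets_of_card_def)
    qed
    show "(\<lambda>Z. Z - {0}) \<in> ?M \<rightarrow> {Z. Z \<subseteq> {1..<L} \<and> card Z = n - 1}"
      by (auto simp: subsets_of_card_def Suc_le_eq)
  qed auto
  then have M: "card ?M = (L - 1) choose (n - 1)"
    using n_subsets[of "{1..<L}" "n - 1"] by (auto dest!: bij_betw_same_card)
  have "{(X, Y, Z). (X, Y, Z) \<in> T \<and> 0 \<in> Z} = subsets_of_card L l \<times> subsets_of_card L k \<times> ?M"
    by (auto simp: T_def)
  then show "card {(X, Y, Z). (X, Y, Z) \<in> T \<and> 0 \<in> Z} = (L choose l) * (L choose k) * ((L - 1) choose (n - 1))"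
    by (simp add: card_cartesian_product card_subsets_of_card M)
  let ?S = "{(X, Y, Z). (X, Y, Z) \<in> T \<and> 0 \<in> Z \<and> X \<inter> Y = {} \<and> X \<inter> Z = {} \<and> Y \<inter> Z = {}}"
  let ?B = "SIGMA Z:?M. SIGMA Y:{Y. Y \<subseteq> {..<L} - Z \<and> card Y = k}. {X. X \<subseteq> {..<L} - Z - Y \<and> card X = l}"
  have "?S = (\<lambda>(Z, Y, X). (X, Y, Z)) ` ?B"
  proof (intro subset_antisym subsetI)
    fix p assume "p \<in> ?S"
    then obtain X Y Z where p: "p = (X, Y, Z)" "X \<subseteq> {..<L}" "card X = l" "Y \<subseteq> {..<L}" "card Y = k"
      "Z \<in> ?M" "X \<inter> Y = {}" "X \<inter> Z = {}" "Y \<inter> Z = {}"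
      by (auto simp: T_def subsets_of_card_def)
    then have "(Z, Y, X) \<in> ?B" by auto
    then show "p \<in> (\<lambda>(Z, Y, X). (X, Y, Z)) ` ?B" using p(1) by (intro image_eqI[of _ _ "(Z, Y, X)"]) simp_all
  next
    fix p assume "p \<in> (\<lambda>(Z, Y, X). (X, Y, Z)) ` ?B"
    then show "p \<in> ?S" by (auto simp: T_def subsets_of_card_def)
  qed
  moreover have "inj_on (\<lambda>(Z, Y, X). (X, Y, Z)) ?B" by (auto simp: inj_on_def)
  ultimately have "card ?S = card ?B" by (simp add: card_image)
  also have "\<dots> = (\<Sum>Z\<in>?M. \<Sum>Y\<in>{Y. Y \<subseteq> {..<L} - Z \<and> card Y = k}. card {X. X \<subseteq> {..<L} - Z - Y \<and> card X = l})"
    by (subst card_SigmaI) (auto intro!: finite_SigmaI finite_subset[OF _ finite_subsets_of_card[of L n]])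
  also have "\<dots> = (\<Sum>Z\<in>?M. \<Sum>Y\<in>{Y. Y \<subseteq> {..<L} - Z \<and> card Y = k}. (L - n - k) choose l)"
  proof (intro sum.cong refl)
    fix Z Y assume Z: "Z \<in> ?M" and Y: "Y \<in> {Y. Y \<subseteq> {..<L} - Z \<and> card Y = k}"
    have "finite Z" "finite Y" using Z Y by (auto simp: subsets_of_card_def dest: finite_subset)
    then have "card ({..<L} - Z - Y) = L - n - k"
      using Z Y by (simp add: card_Diff_subset subsets_of_card_def)
    then show "card {X. X \<subseteq> {..<L} - Z - Y \<and> card X = l} = (L - n - k) choose l"
      using n_subsets[of "{..<L} - Z - Y" l] by simp
  qed
  also have "\<dots> = (\<Sum>Z\<in>?M. ((L - n) choose k) * ((L - n - k) choose l))"
  proof (intro sum.cong refl)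
    fix Z assume Z: "Z \<in> ?M"
    then have "finite Z" by (auto simp: subsets_of_card_def dest: finite_subset)
    then have "card ({..<L} - Z) = L - n"
      using Z by (simp add: card_Diff_subset subsets_of_card_def)
    then show "(\<Sum>Y\<in>{Y. Y \<subseteq> {..<L} - Z \<and> card Y = k}. (L - n - k) choose l) =
        ((L - n) choose k) * ((L - n - k) choose l)"
      using n_subsets[of "{..<L} - Z" k] by simp
  qed
  finally show "card ?S = ((L - 1) choose (n - 1)) * ((L - n) choose k) * ((L - n - k) choose l)"
    by (simp add: M)
qed

text \<open>\<open>D\<close> is the exact number for disjoint rows. The others are bounded crudely
  by all overlapping triples with a service at 0.\<close>

lemma second_gap_count_bounds:
  fixes L l k n :: nat
  assumes L: "0 < L" and n: "k < n" and k: "1 \<le> k" "l \<le> k"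
  defines "D \<equiv> real ((L - 1) choose (n - 1 + k + l)) *
      (fact (n + k + l - 1) * gap_limit n k l / (fact n * fact k * fact l))"
  shows "D \<le> real (second_gap_count L l k n)"
    and "real (second_gap_count L l k n) \<le> D + (real (L choose l) * real (L choose k) * real ((L - 1) choose (n - 1))
      - real ((L - 1) choose (n - 1)) * real ((L - n) choose k) * real ((L - n - k) choose l))"
proof -
  let ?T = "subsets_of_card L l \<times> subsets_of_card L k \<times> subsets_of_card L n"
  let ?dj = "\<lambda>X Y Z. X \<inter> Y = {} \<and> X \<inter> Z = {} \<and> Y \<inter> (Z::nat set) = {}"
  let ?B = "{(X, Y, Z). (X, Y, Z) \<in> ?T \<and> second_gap X Y Z}"
  let ?BD = "{(X, Y, Z). (X, Y, Z) \<in> ?T \<and> second_gap X Y Z \<and> ?dj X Y Z}"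
  let ?M = "{(X, Y, Z). (X, Y, Z) \<in> ?T \<and> 0 \<in> Z}"
  let ?MD = "{(X, Y, Z). (X, Y, Z) \<in> ?T \<and> 0 \<in> Z \<and> ?dj X Y Z}"
  have fin: "finite S" if "S \<subseteq> ?T" for S by (rule finite_subset[OF that]) simp
  have fM: "finite ?M" and fMD: "finite ?MD" and fB: "finite ?B" and fBD: "finite ?BD"
    by (rule fin, auto)+
  obtain m where m: "L = Suc m" using L by (cases L) auto
  obtain k' where k': "k = Suc k'" using k by (cases k) auto
  \<comment> \<open>Both shifts have a meaning: \<open>n - 1\<close> because one service is at 0,
    and \<open>k' = k - 1\<close> because the leading \<open>2\<close> has been split off.\<close>
  have F: "clean_number (n - 1) k' l = fact (n + k + l - 1) * gap_limit n k l / (fact n * fact k * fact l)"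
  proof (cases "l = k")
    case True
    then show ?thesis by (simp add: gap_limit_diag clean_number_def k')
  next
    case False
    have "n - 1 + 1 = n" "n - 1 + k' + l + 1 = n + k + l - 1" "k' + 1 = k" using n k' by auto
    then show ?thesis using False k n k' clean_number_inside[of l k' "n - 1"] by (simp del: fact_Suc)
  qed
  have "real (card ?BD) = real (card (ballots m (n - 1) k l (\<lambda>v. two_first v \<and> twos_clean v)))"
    using card_second_gap_disjoint[of n m l k] n unfolding m by simp
  also have "\<dots> = real (m choose (n - 1 + k + l)) * clean_number (n - 1) k' l"
  proof -
    have "k \<le> n - 1" using n by simp
    then show ?thesis using card_ballots_second_gap[of l k' m "n - 1"] k unfolding k'[symmetric] by simp
  qed
  also have "\<dots> = D" unfolding D_def F[symmetric] m by simp
  finally have BD: "real (card ?BD) = D" .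
  have "card ?BD \<le> card ?B" by (intro card_mono fB) auto
  then show "D \<le> real (second_gap_count L l k n)" unfolding BD[symmetric] second_gap_count_def by simp
  have "?B \<subseteq> ?BD \<union> (?M - ?MD)" by (auto simp: second_gap_def)
  then have "card ?B \<le> card (?BD \<union> (?M - ?MD))"
    by (intro card_mono finite_UnI finite_Diff fBD fM)
  also have "\<dots> \<le> card ?BD + card (?M - ?MD)" by (rule card_Un_le)
  also have "card (?M - ?MD) = card ?M - card ?MD" by (intro card_Diff_subset fMD) auto
  finally have "card ?B \<le> card ?BD + (card ?M - card ?MD)" .
  moreover have "card ?MD \<le> card ?M" by (intro card_mono fM) auto
  ultimately have "real (card ?B) \<le> real (card ?BD) + (real (card ?M) - real (card ?MD))" by linarith
  then show "real (second_gap_count L l k n) \<le> D + (real (L choose l) * real (L choose k) * real ((L - 1) choose (n - 1))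
      - real ((L - 1) choose (n - 1)) * real ((L - n) choose k) * real ((L - n - k) choose l))"
  proof -
    have n1: "1 \<le> n" using n by simp
    show ?thesis
      using \<open>real (card ?B) \<le> _\<close> unfolding BD card_marked_disjoint[OF L n1] second_gap_count_def of_nat_mult .
  qed
qed

text \<open>A sandwich between the bounds above. Both \<open>L\<close> times the main term and the
  denominator are of order \<open>L ^ (l + k + n)\<close>, and the factorials cancel to leave
  \<open>gap_limit\<close>.\<close>

lemma second_gap_count_limit:
  assumes n: "k < n" and k: "1 \<le> k" "l \<le> k"
  shows "(\<lambda>L. real L * real (second_gap_count L l k n) /
     (real (L choose l) * real (L choose k) * real (L choose n))) \<longlonglongrightarrow> gap_limit n k l"
proof -
  define c where "c j m L = real ((L - j) choose m) / real L ^ m" for j m L :: nat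
  have c: "c j m \<longlonglongrightarrow> 1 / fact m" for j m unfolding c_def[abs_def] by (rule tendsto_choose)
  define s where "s = n - 1 + k + l"
  have s: "n + k + l - 1 = s" using n by (simp add: s_def)
  define K where "K = fact s * gap_limit n k l / (fact n * fact k * fact l)"
  have ch: "real ((L - j) choose m) = c j m L * real L ^ m" if "0 < L" for j m L
    using that by (simp add: c_def)
  have Ls: "real L * real L ^ s = real L ^ l * real L ^ k * real L ^ n" for L
  proof -
    have "Suc s = l + k + n" using n by (simp add: s_def)
    then show ?thesis by (simp flip: power_add power_Suc)
  qed
  have Ln: "real L * real L ^ (n - 1) = real L ^ n" for L
    using n by (cases n) auto
  let ?tot = "\<lambda>L. real (L choose l) * real (L choose k) * real (L choose n)"
  let ?lo = "\<lambda>L. c 1 s L * K / (c 0 l L * c 0 k L * c 0 n L)"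
  let ?er = "\<lambda>L. c 1 (n - 1) L * (c 0 l L * c 0 k L - c n k L * c (n + k) l L) / (c 0 l L * c 0 k L * c 0 n L)"
  have tot: "?tot L = c 0 l L * c 0 k L * c 0 n L * (real L ^ l * real L ^ k * real L ^ n)" if "0 < L" for L
    using ch[OF that, of 0] by (simp add: mult_ac)
  have cancel: "x = y * w \<Longrightarrow> w \<noteq> 0 \<Longrightarrow> x / (z * w) = y / z" for w x y z :: real by simp
  have lo: "real L * (real ((L - 1) choose s) * K) / ?tot L = ?lo L" if L: "0 < L" for L
  proof -
    have "real L * (real ((L - 1) choose s) * K) = c 1 s L * K * (real L ^ l * real L ^ k * real L ^ n)"
      unfolding ch[OF L] Ls[symmetric] by simp
    then show ?thesis unfolding tot[OF L] by (rule cancel) (use L in simp)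
  qed
  have er: "real L * (real (L choose l) * real (L choose k) * real ((L - 1) choose (n - 1))
      - real ((L - 1) choose (n - 1)) * real ((L - n) choose k) * real ((L - n - k) choose l)) / ?tot L = ?er L"
    if L: "0 < L" for L
  proof -
    have "real L * (real (L choose l) * real (L choose k) * real ((L - 1) choose (n - 1))
      - real ((L - 1) choose (n - 1)) * real ((L - n) choose k) * real ((L - n - k) choose l)) =
      c 1 (n - 1) L * (c 0 l L * c 0 k L - c n k L * c (n + k) l L) * (real L ^ l * real L ^ k * real L ^ n)"
    proof -
      have e: "real (L choose l) = c 0 l L * real L ^ l" "real (L choose k) = c 0 k L * real L ^ k"
        "real ((L - n - k) choose l) = c (n + k) l L * real L ^ l"
        using ch[OF L, of 0] ch[OF L, of "n + k" l] by simp_all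
      show ?thesis unfolding e ch[OF L] Ln[of L, symmetric] by algebra
    qed
    then show ?thesis unfolding tot[OF L] by (rule cancel) (use L in simp)
  qed
  have lim_lo: "?lo \<longlonglongrightarrow> 1 / fact s * K / (1 / fact l * (1 / fact k) * (1 / fact n))"
    by (intro tendsto_intros c) auto
  \<comment> \<open>The bracket tends to 0, since shifting the upper argument of a binomial
    coefficient does not affect its leading term.\<close>
  have lim_er: "?er \<longlonglongrightarrow> 1 / fact (n - 1) * (1 / fact l * (1 / fact k) - 1 / fact k * (1 / fact l)) /
      (1 / fact l * (1 / fact k) * (1 / fact n))"
    by (intro tendsto_intros c) auto
  have eq: "1 / fact s * K / (1 / fact l * (1 / fact k) * (1 / fact n)) = gap_limit n k l"
    by (simp add: K_def)
  have lo': "?lo \<longlonglongrightarrow> gap_limit n k l" using lim_lo unfolding eq .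
  have hi': "(\<lambda>L. ?lo L + ?er L) \<longlonglongrightarrow> gap_limit n k l"
    using tendsto_add[OF lo' lim_er] by simp
  show ?thesis
  proof (rule tendsto_sandwich[OF _ _ lo' hi'])
    show "eventually (\<lambda>L. ?lo L \<le> real L * real (second_gap_count L l k n) / ?tot L) sequentially"
      using eventually_gt_at_top[of 0]
    proof eventually_elim
      case (elim L)
      have "real L * (real ((L - 1) choose s) * K) \<le> real L * real (second_gap_count L l k n)"
        using second_gap_count_bounds(1)[OF elim n k] unfolding s K_def by (intro mult_left_mono) (simp_all add: s_def)
      then show ?case unfolding lo[OF elim, symmetric] by (intro divide_right_mono) simp_all
    qed
    show "eventually (\<lambda>L. real L * real (second_gap_count L l k n) / ?tot L \<le> ?lo L + ?er L) sequentially"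
      using eventually_gt_at_top[of 0]
    proof eventually_elim
      case (elim L)
      have "real L * real (second_gap_count L l k n) \<le> real L * (real ((L - 1) choose s) * K +
        (real (L choose l) * real (L choose k) * real ((L - 1) choose (n - 1))
      - real ((L - 1) choose (n - 1)) * real ((L - n) choose k) * real ((L - n - k) choose l)))"
        using second_gap_count_bounds(2)[OF elim n k] unfolding s K_def by (intro mult_left_mono) (simp_all add: s_def)
      then show ?case unfolding lo[OF elim, symmetric] er[OF elim, symmetric] add_divide_distrib[symmetric]
        distrib_left[symmetric] by (intro divide_right_mono) simp_all
    qed
  qed
qed

lemma first_gap_avg_limit:
  fixes l k n :: nat
  assumes n: "k < n" and k: "1 \<le> k" "l \<le> k"
  defines "T \<equiv> \<lambda>L. subsets_of_card L l \<times> subsets_of_card L k \<times> subsets_of_card L n"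
  shows "(\<lambda>L. real (\<Sum>(X, Y, Z)\<in>T L. card {a. a < L \<and> first_gap X Y Z a}) / real (card (T L)))
    \<longlonglongrightarrow> gap_limit n k 0 - gap_limit n k l"
proof -
  have lim: "(\<lambda>L. real L * real (second_gap_count L 0 k n) / (real (L choose 0) * real (L choose k) * real (L choose n)) -
      real L * real (second_gap_count L l k n) / (real (L choose l) * real (L choose k) * real (L choose n)))
      \<longlonglongrightarrow> gap_limit n k 0 - gap_limit n k l"
    using n k by (intro tendsto_diff second_gap_count_limit) auto
  have "eventually (\<lambda>L. real L * real (second_gap_count L 0 k n) / (real (L choose 0) * real (L choose k) * real (L choose n)) -
      real L * real (second_gap_count L l k n) / (real (L choose l) * real (L choose k) * real (L choose n)) =
      real (\<Sum>(X, Y, Z)\<in>T L. card {a. a < L \<and> first_gap X Y Z a}) / real (card (T L))) sequentially"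
    using eventually_ge_at_top[of n]
  proof eventually_elim
    case (elim L)
    have pos: "real (L choose l) \<noteq> 0" using elim n k by simp
    have "card {(X, Y, Z). (X, Y, Z) \<in> T L \<and> first_gap X Y Z 0} + second_gap_count L l k n = (L choose l) * second_gap_count L 0 k n"
      using card_first_gap_0[of n L l k] n k unfolding T_def by simp
    from arg_cong[OF this, of real]
    have "real (card {(X, Y, Z). (X, Y, Z) \<in> T L \<and> first_gap X Y Z 0}) =
       real (L choose l) * real (second_gap_count L 0 k n) - real (second_gap_count L l k n)"
      by simp
    moreover have "card (T L) = (L choose l) * (L choose k) * (L choose n)"
      by (simp add: T_def card_cartesian_product card_subsets_of_card)
    moreover have "(\<Sum>(X, Y, Z)\<in>T L. card {a. a < L \<and> first_gap X Y Z a}) =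
       L * card {(X, Y, Z). (X, Y, Z) \<in> T L \<and> first_gap X Y Z 0}"
      unfolding T_def by (rule sum_card_first_gap)
    ultimately show ?case using pos
      by (simp add: right_diff_distrib diff_divide_distrib mult_ac)
  qed
  then show ?thesis using lim by (simp add: tendsto_cong)
qed

section \<open>Adjacent labels\<close>

definition adjacent :: "'a::linorder set \<Rightarrow> 'a \<Rightarrow> 'a \<Rightarrow> bool" where
  "adjacent P a b \<longleftrightarrow> b \<noteq> a \<and> P \<inter> cyc_int a b = {a, b}"

text \<open>A point has at most one right neighbour, so adjacent pairs can be counted by their left
  ends. With threshold sets for \<open>A\<close> and \<open>B\<close> this is the quantity whose
  mean is the \<open>N k l\<close> of the overview.\<close>

definition left_ends :: "nat set \<Rightarrow> nat set \<Rightarrow> nat set \<Rightarrow> nat set" where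
  "left_ends A B P = {a \<in> P - B. \<exists>b\<in>A. adjacent P a b}"

definition three_sizes :: "nat \<Rightarrow> nat \<Rightarrow> nat \<Rightarrow> nat \<Rightarrow> nat" where
  "three_sizes l k n i = (if i = 0 then 0 else if i = 1 then l else if i = 2 then k else n)"

lemma mono_three_sizes: "l \<le> k \<Longrightarrow> k \<le> n \<Longrightarrow> mono (three_sizes l k n)"
  by (auto simp: mono_def three_sizes_def)

lemma adjacent_unique:
  assumes "adjacent P a b" "adjacent P a c" shows "b = c"
proof -
  have "b \<in> P" "c \<in> P" "b \<noteq> a" "c \<noteq> a" using assms by (auto simp: adjacent_def)
  moreover have "b \<in> cyc_int a c \<or> c \<in> cyc_int a b" by (auto simp: cyc_int_def)
  ultimately show ?thesis using assms by (auto simp: adjacent_def)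
qed

lemma sum_row_space_3:
  "(\<Sum>R\<in>row_space L c 3. G (R 1) (R 2) (R 3)) =
   (\<Sum>(X, Y, Z)\<in>subsets_of_card L (c 1) \<times> subsets_of_card L (c 2) \<times> subsets_of_card L (c 3). G X Y Z)"
proof -
  have "row_space L c 0 = {\<lambda>_. undefined}" by (simp add: row_space_def)
  then have "(\<Sum>R\<in>row_space L c 3. G (R 1) (R 2) (R 3)) =
    (\<Sum>X\<in>subsets_of_card L (c 1). \<Sum>Y\<in>subsets_of_card L (c 2). \<Sum>Z\<in>subsets_of_card L (c 3). G X Y Z)"
    by (simp add: numeral_3_eq_3 numeral_2_eq_2 sum_row_space_Suc)
  then show ?thesis by (simp add: sum.cartesian_product)
qed

text \<open>The same number as a function of the word with classes 1, 2, 3 and empty sites 4,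
  because uniqueness of the stationary law is a statement about words.\<close>

definition count_left_ends :: "nat \<Rightarrow> nat list \<Rightarrow> real" where
  "count_left_ends L w = real (card {a. a < L \<and> w ! a = 3 \<and>
     (\<exists>b<L. w ! b \<le> 1 \<and> adjacent {z. z < L \<and> w ! z \<le> 3} a b)})"

lemma count_left_ends_word:
  assumes A: "mono A" and sub: "A 3 \<subseteq> {..<L}"
  shows "count_left_ends L (word L 3 A) = real (card (left_ends (A 1) (A 2) (A 3)))"
proof -
  have le: "word L 3 A ! s \<le> k \<longleftrightarrow> s \<in> A k" if "s < L" "k \<le> 3" for s k
    using word_le_iff[OF A that] .
  have P: "{z. z < L \<and> word L 3 A ! z \<le> 3} = A 3" using le sub by auto
  have three: "word L 3 A ! a = 3 \<longleftrightarrow> a \<in> A 3 - A 2" if "a < L" for a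
    using le[OF that, of 3] le[OF that, of 2] by auto
  have A1: "A 1 \<subseteq> {..<L}" using monoD[OF A, of 1 3] sub by simp
  have ex: "(\<exists>b<L. word L 3 A ! b \<le> 1 \<and> adjacent (A 3) a b) \<longleftrightarrow> (\<exists>b\<in>A 1. adjacent (A 3) a b)" for a
    using le[of _ 1] A1 by (metis lessThan_iff one_le_numeral subsetD)
  have "{a. a < L \<and> word L 3 A ! a = 3 \<and> (\<exists>b<L. word L 3 A ! b \<le> 1 \<and> adjacent (A 3) a b)} =
    left_ends (A 1) (A 2) (A 3)"
    unfolding ex left_ends_def using three sub by auto
  then show ?thesis unfolding count_left_ends_def P by simp
qed

lemma left_ends_avg_limit:
  assumes n: "k < n" and k: "1 \<le> k" "l \<le> k"
  shows "(\<lambda>L. (\<Sum>R\<in>row_space L (\<lambda>i. i) n. real (card (left_ends (mlq R n l) (mlq R n k) (mlq R n n))))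
      / real (card (row_space L (\<lambda>i. i) n))) \<longlonglongrightarrow> gap_limit n k 0 - gap_limit n k l"
proof -
  define t where "t = three_sizes l k n"
  have t: "mono t" "t 0 = 0" "t 1 = l" "t 2 = k" "t 3 = n"
    using mono_three_sizes n k by (auto simp: t_def three_sizes_def)
  let ?T = "\<lambda>L. subsets_of_card L l \<times> subsets_of_card L k \<times> subsets_of_card L n"
  have "eventually (\<lambda>L. real (\<Sum>(X, Y, Z)\<in>?T L. card {a. a < L \<and> first_gap X Y Z a}) / real (card (?T L)) =
      (\<Sum>R\<in>row_space L (\<lambda>i. i) n. real (card (left_ends (mlq R n l) (mlq R n k) (mlq R n n))))
      / real (card (row_space L (\<lambda>i. i) n))) sequentially"
    using eventually_ge_at_top[of "max 3 n"]
  proof eventually_elim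
    case (elim L)
    then have L: "3 \<le> L" "n \<le> L" by auto
    \<comment> \<open>The full queue with merged labels and the three-line queue have the common
      type \<open>t\<close>, so averages of any function of the word agree.\<close>
    have f: "stationary_family L 3 t (row_space L (\<lambda>i. i) n) (\<lambda>R k. mlq R n (t k))"
      using stationary_family_mlq[OF L(1), of "\<lambda>i. i" n t 3] t L by (simp add: mono_def)
    have g: "stationary_family L 3 t (row_space L t 3) (\<lambda>R. mlq R 3)"
      using stationary_family_mlq[OF L(1), of t 3 "\<lambda>k. k" 3] t L by (simp add: mono_def)
    have cnt: "(\<Sum>i\<in>K. count_left_ends L (word L 3 (E i))) =
        (\<Sum>i\<in>K. real (card (left_ends (E i 1) (E i 2) (E i 3))))"
      if "stationary_family L 3 t K E" for K :: "'k set" and E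
      using that by (intro sum.cong refl count_left_ends_word) (auto simp: stationary_family_def)
    have "(\<Sum>R\<in>row_space L (\<lambda>i. i) n. real (card (left_ends (mlq R n l) (mlq R n k) (mlq R n n))))
      / real (card (row_space L (\<lambda>i. i) n)) =
      (\<Sum>R\<in>row_space L t 3. real (card (left_ends (mlq R 3 1) (mlq R 3 2) (mlq R 3 3)))) / real (card (row_space L t 3))"
      using stationary_family_avg_eq[OF _ f g, of "count_left_ends L"] L
      unfolding cnt[OF f] cnt[OF g] t by simp
    moreover have "(\<Sum>R\<in>row_space L t 3. real (card (left_ends (mlq R 3 1) (mlq R 3 2) (mlq R 3 3)))) =
        (\<Sum>(X, Y, Z)\<in>?T L. real (card (left_ends (departures (departures X Y) Z) (departures Y Z) Z)))"
      using sum_row_space_3[of "\<lambda>X Y Z. real (card (left_ends (departures (departures X Y) Z) (departures Y Z) Z))" L t]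
      unfolding t by (simp add: numeral_3_eq_3 numeral_2_eq_2)
    moreover have "\<dots> = real (\<Sum>(X, Y, Z)\<in>?T L. card {a. a < L \<and> first_gap X Y Z a})"
    proof -
      have "left_ends (departures (departures X Y) Z) (departures Y Z) Z = {a. a < L \<and> first_gap X Y Z a}"
        if "Z \<in> subsets_of_card L n" for X Y Z
        using that by (auto simp: left_ends_def first_gap_def adjacent_def subsets_of_card_def)
      then show ?thesis unfolding of_nat_sum by (intro sum.cong refl) auto
    qed
    moreover have "real (card (row_space L t 3)) = real (card (?T L))"
      using sum_row_space_3[of "\<lambda>_ _ _. 1::real" L t] unfolding t by simp
    ultimately show ?case by simp
  qed
  then show ?thesis using first_gap_avg_limit[OF n k] by (simp add: tendsto_cong)
qed

definition label_site :: "(nat \<Rightarrow> 'a::linorder set) \<Rightarrow> nat \<Rightarrow> nat \<Rightarrow> 'a" where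
  "label_site R n k = (THE s. s \<in> mlq R n k - mlq R n (k - 1))"

lemma mlq_eq_insert_label_site:
  fixes R :: "nat \<Rightarrow> 'a::linorder set"
  assumes fin: "\<And>i. i \<in> {1..n} \<Longrightarrow> finite (R i)" and card: "\<And>k. k \<le> n \<Longrightarrow> card (mlq R n k) = k"
    and k: "1 \<le> k" "k \<le> n"
  shows "mlq R n k = insert (label_site R n k) (mlq R n (k - 1))"
    and "label_site R n k \<notin> mlq R n (k - 1)"
proof -
  have sub: "mlq R n (k - 1) \<subseteq> mlq R n k" by (rule mlq_mono[OF fin]) auto
  have "finite (mlq R n k)" using card[OF k(2)] k by (metis card.infinite not_one_le_zero)
  then have "card (mlq R n k - mlq R n (k - 1)) = 1"
    using sub card[of k] card[of "k - 1"] k by (subst card_Diff_subset) (auto intro: finite_subset)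
  then obtain s where s: "mlq R n k - mlq R n (k - 1) = {s}" by (auto simp: card_1_singleton_iff)
  then have "label_site R n k = s" by (simp add: label_site_def)
  then show "mlq R n k = insert (label_site R n k) (mlq R n (k - 1))"
    and "label_site R n k \<notin> mlq R n (k - 1)" using s sub by auto
qed

text \<open>The difference in the lower threshold singles out the label \<open>i\<close> on the
  left, the difference in the upper one the label \<open>j\<close> on the right; the latter uses
  that right neighbours are unique.\<close>

lemma adjacent_label_sites:
  fixes R :: "nat \<Rightarrow> nat set"
  assumes fin: "\<And>i. i \<in> {1..n} \<Longrightarrow> finite (R i)" and card: "\<And>k. k \<le> n \<Longrightarrow> card (mlq R n k) = k"
    and ij: "1 \<le> j" "j < i" "i \<le> n"
  defines "P \<equiv> mlq R n n"
  defines "e \<equiv> \<lambda>k l. real (card (left_ends (mlq R n l) (mlq R n k) P))"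
  shows "of_bool (adjacent P (label_site R n i) (label_site R n j)) =
     e (i - 1) j - e i j - e (i - 1) (j - 1) + e i (j - 1)"
proof -
  let ?a = "label_site R n i" and ?b = "label_site R n j"
  have i: "mlq R n i = insert ?a (mlq R n (i - 1))" "?a \<notin> mlq R n (i - 1)"
    using mlq_eq_insert_label_site[OF fin card, of i] ij by auto
  have j: "mlq R n j = insert ?b (mlq R n (j - 1))" "?b \<notin> mlq R n (j - 1)"
    using mlq_eq_insert_label_site[OF fin card, of j] ij by auto
  have "mlq R n i \<subseteq> P" unfolding P_def using ij by (intro mlq_mono[OF fin]) auto
  then have aP: "?a \<in> P" using i by auto
  have finP: "finite P" using card[of n] ij unfolding P_def by (metis card.infinite le_refl not_less_zero less_le_trans)
  have diff: "e (i - 1) l - e i l = of_bool (\<exists>b\<in>mlq R n l. adjacent P ?a b)" for l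
  proof -
    have eq: "left_ends (mlq R n l) (mlq R n (i - 1)) P =
      left_ends (mlq R n l) (mlq R n i) P \<union> (if \<exists>b\<in>mlq R n l. adjacent P ?a b then {?a} else {})"
      using i aP by (auto simp: left_ends_def)
    have "?a \<notin> left_ends (mlq R n l) (mlq R n i) P" using i by (simp add: left_ends_def)
    moreover have "finite (left_ends (mlq R n l) (mlq R n i) P)"
      using finP by (simp add: left_ends_def)
    ultimately show ?thesis unfolding e_def eq by simp
  qed
  have "(\<exists>b\<in>mlq R n j. adjacent P ?a b) \<longleftrightarrow> adjacent P ?a ?b \<or> (\<exists>b\<in>mlq R n (j - 1). adjacent P ?a b)"
    unfolding j(1) by auto
  moreover have "\<not> (adjacent P ?a ?b \<and> (\<exists>b\<in>mlq R n (j - 1). adjacent P ?a b))"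
    using adjacent_unique[of P ?a ?b] j(2) by blast
  ultimately have "of_bool (\<exists>b\<in>mlq R n j. adjacent P ?a b) - of_bool (\<exists>b\<in>mlq R n (j - 1). adjacent P ?a b) =
      (of_bool (adjacent P ?a ?b) :: real)" by auto
  then show ?thesis using diff[of j] diff[of "j - 1"] by simp
qed

lemma adjacent_avg_limit:
  assumes ij: "1 \<le> j" "j < i" "i \<le> n"
  shows "(\<lambda>L. (\<Sum>R\<in>row_space L (\<lambda>i. i) n.
       of_bool (adjacent (R n) (label_site R n i) (label_site R n j)))
      / real (card (row_space L (\<lambda>i. i) n))) \<longlonglongrightarrow>
    (if i < n then
       real n / real ((n + j) choose 2) - real n / real ((n + i) choose 2)
     else
       real n * (real j + 1) / real ((n + j) choose 2)
       - real n * (real j - 1) / real ((n + j - 1) choose 2)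
       - real n / real ((2 * n) choose 2))"
proof -
  define e where "e R k l = real (card (left_ends (mlq R n l) (mlq R n k) (mlq R n n)))" for R k l
  define N where "N k l = (\<lambda>L. (\<Sum>R\<in>row_space L (\<lambda>i. i) n. e R k l) / real (card (row_space L (\<lambda>i. i) n)))" for k l
  have N: "N k l \<longlonglongrightarrow> gap_limit n k 0 - gap_limit n k l" if "k < n" "1 \<le> k" "l \<le> k" for k l
    unfolding N_def e_def using left_ends_avg_limit[OF that] .
  \<comment> \<open>No label exceeds \<open>n\<close>. For \<open>i = n\<close> two of the four
    terms therefore vanish, which is the origin of the case distinction in the formula.\<close>
  have Nn: "N n l = (\<lambda>_. 0)" for l
    unfolding N_def e_def left_ends_def by simp
  have ev: "eventually (\<lambda>L. N (i - 1) j L - N i j L - N (i - 1) (j - 1) L + N i (j - 1) L =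
     (\<Sum>R\<in>row_space L (\<lambda>i. i) n. of_bool (adjacent (R n) (label_site R n i) (label_site R n j)))
      / real (card (row_space L (\<lambda>i. i) n))) sequentially"
    using eventually_ge_at_top[of 2]
  proof eventually_elim
    case (elim L)
    have "(\<Sum>R\<in>row_space L (\<lambda>i. i) n. of_bool (adjacent (R n) (label_site R n i) (label_site R n j))) =
      (\<Sum>R\<in>row_space L (\<lambda>i. i) n. e R (i - 1) j - e R i j - e R (i - 1) (j - 1) + e R i (j - 1))"
    proof (intro sum.cong refl)
      fix R assume R: "R \<in> row_space L (\<lambda>i. i) n"
      have fin: "finite (R i)" if "i \<in> {1..n}" for i using row_space_finite_row[OF R that] .
      have card: "card (mlq R n k) = k" if "k \<le> n" for k
        using mlq_row_space[OF elim _ R, of k] that by (auto simp: mono_def)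
      have Rn: "mlq R n n = R n" using mlq_top[of n n R] ij by simp
      show "of_bool (adjacent (R n) (label_site R n i) (label_site R n j)) =
        e R (i - 1) j - e R i j - e R (i - 1) (j - 1) + e R i (j - 1)"
        using adjacent_label_sites[OF fin card ij] unfolding e_def Rn by simp
    qed
    then show ?case unfolding N_def
      by (simp add: sum.distrib sum_subtractf add_divide_distrib diff_divide_distrib)
  qed
  have ch: "real (m choose 2) = real m * (real m - 1) / 2" for m
    by (cases m) (simp_all add: choose_two field_simps real_of_nat_div)
  define x y z where "x = real n" and "y = real i" and "z = real j"
  have ge: "1 \<le> z" "z + 1 \<le> y" "y \<le> x"
    using ij by (auto simp: x_def y_def z_def simp flip: of_nat_Suc)
  have sub: "real (i - 1) = y - 1" "real (j - 1) = z - 1" using ij by (auto simp: y_def z_def of_nat_diff)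
  show ?thesis
  proof (cases "i < n")
    case True
    have "(\<lambda>L. N (i - 1) j L - N i j L - N (i - 1) (j - 1) L + N i (j - 1) L) \<longlonglongrightarrow>
      (gap_limit n (i - 1) 0 - gap_limit n (i - 1) j) - (gap_limit n i 0 - gap_limit n i j)
      - (gap_limit n (i - 1) 0 - gap_limit n (i - 1) (j - 1)) + (gap_limit n i 0 - gap_limit n i (j - 1))"
      using ij True by (intro tendsto_intros N) auto
    moreover have "(gap_limit n (i - 1) 0 - gap_limit n (i - 1) j) - (gap_limit n i 0 - gap_limit n i j)
      - (gap_limit n (i - 1) 0 - gap_limit n (i - 1) (j - 1)) + (gap_limit n i 0 - gap_limit n i (j - 1)) =
      real n / real ((n + j) choose 2) - real n / real ((n + i) choose 2)"
    proof -
      have "- gap_limit n (i - 1) j + gap_limit n i j + gap_limit n (i - 1) (j - 1) - gap_limit n i (j - 1) =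
        2 * x / ((x + z) * (x + z - 1)) - 2 * x / ((x + y) * (x + y - 1))"
      proof -
        have ne: "x + z \<noteq> 0" "x + z - 1 \<noteq> 0" "x + y \<noteq> 0" "x + y - 1 \<noteq> 0" using ge by auto
        \<comment> \<open>In the mixed difference all terms of \<open>gap_limit\<close> that depend
          on only one of the last two arguments cancel; two terms survive.\<close>
        have "- gap_limit n (i - 1) j + gap_limit n i j + gap_limit n (i - 1) (j - 1) - gap_limit n i (j - 1) =
          (- 2 * z * (x - y) / (x + z) + 2 * z * (x - (y - 1)) / (x + z)
           + 2 * (z - 1) * (x - y) / (x + (z - 1)) - 2 * (z - 1) * (x - (y - 1)) / (x + (z - 1)))
          + ((x - y) / (x + y) - (x - (y - 1)) / (x + (y - 1)))"
          unfolding gap_limit_def sub x_def[symmetric] y_def[symmetric] z_def[symmetric]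
          by (simp add: algebra_simps add_divide_distrib diff_divide_distrib)
        also have "- 2 * z * (x - y) / (x + z) + 2 * z * (x - (y - 1)) / (x + z)
           + 2 * (z - 1) * (x - y) / (x + (z - 1)) - 2 * (z - 1) * (x - (y - 1)) / (x + (z - 1)) =
           2 * x / ((x + z) * (x + z - 1))"
          using ne by (simp add: divide_simps) algebra
        also have "(x - y) / (x + y) - (x - (y - 1)) / (x + (y - 1)) = - (2 * x / ((x + y) * (x + y - 1)))"
          using ne by (simp add: divide_simps) algebra
        finally show ?thesis by simp
      qed
      moreover have "real n / real ((n + j) choose 2) = 2 * x / ((x + z) * (x + z - 1))"
        "real n / real ((n + i) choose 2) = 2 * x / ((x + y) * (x + y - 1))"
        unfolding ch by (simp_all add: x_def y_def z_def)
      ultimately show ?thesis by linarith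
    qed
    ultimately show ?thesis using True ev by (simp add: tendsto_cong)
  next
    case False
    then have in_n: "i = n" using ij by simp
    have "(\<lambda>L. N (i - 1) j L - N i j L - N (i - 1) (j - 1) L + N i (j - 1) L) \<longlonglongrightarrow>
      (gap_limit n (n - 1) 0 - gap_limit n (n - 1) j) - 0
      - (gap_limit n (n - 1) 0 - gap_limit n (n - 1) (j - 1)) + 0"
      unfolding in_n Nn using ij in_n by (intro tendsto_intros N) auto
    moreover have "(gap_limit n (n - 1) 0 - gap_limit n (n - 1) j) - 0
      - (gap_limit n (n - 1) 0 - gap_limit n (n - 1) (j - 1)) + 0 =
       real n * (real j + 1) / real ((n + j) choose 2)
       - real n * (real j - 1) / real ((n + j - 1) choose 2)
       - real n / real ((2 * n) choose 2)"
    proof -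
      have xy: "x = y" using in_n by (simp add: x_def y_def)
      have ne: "x + z \<noteq> 0" "x + z - 1 \<noteq> 0" "x + z - 2 \<noteq> 0" "2 * x - 1 \<noteq> 0" "x \<noteq> 0" using ge xy by auto
      have rn: "real (n - 1) = x - 1" "real (n + j - 1) = x + z - 1" "real (n + j) = x + z" "real (2 * n) = 2 * x"
        using ij by (auto simp: x_def z_def of_nat_diff)
      have "- gap_limit n (n - 1) j + gap_limit n (n - 1) (j - 1) =
        (2 * z * (x - (x - 1)) / (x + z) + 2 * x * z / ((x + z) * (x + z - 1))
         - 2 * (z - 1) * (x - (x - 1)) / (x + (z - 1)) - 2 * x * (z - 1) / ((x + (z - 1)) * (x + (z - 1) - 1)))
         - (x - (x - 1)) / (x + (x - 1))"
        unfolding gap_limit_def sub rn x_def[symmetric] z_def[symmetric]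
        by (simp add: algebra_simps add_divide_distrib diff_divide_distrib)
      also have "2 * z * (x - (x - 1)) / (x + z) + 2 * x * z / ((x + z) * (x + z - 1))
         - 2 * (z - 1) * (x - (x - 1)) / (x + (z - 1)) - 2 * x * (z - 1) / ((x + (z - 1)) * (x + (z - 1) - 1)) =
         x * (z + 1) / ((x + z) * (x + z - 1) / 2) - x * (z - 1) / ((x + z - 1) * (x + z - 1 - 1) / 2)"
        using ne by (simp add: divide_simps) algebra
      also have "(x - (x - 1)) / (x + (x - 1)) = x / (2 * x * (2 * x - 1) / 2)"
        using ne by (simp add: divide_simps)
      finally show ?thesis unfolding ch rn by (simp add: x_def z_def)
    qed
    ultimately show ?thesis using False ev by (simp add: tendsto_cong)
  qed
qed

section \<open>Independent uniform points\<close>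

definition unit_meas :: "real measure" where
  "unit_meas = restrict_space lborel {0..<1}"

text \<open>The pair \<open>(r, m)\<close> stands for the \<open>m\<close>-th of the
  \<open>r\<close> points in row \<open>r\<close>.\<close>

definition mlq_index :: "nat \<Rightarrow> (nat \<times> nat) set" where
  "mlq_index n = (SIGMA r:{1..n}. {1..r})"

definition mlq_meas :: "nat \<Rightarrow> (nat \<times> nat \<Rightarrow> real) measure" where
  "mlq_meas n = PiM (mlq_index n) (\<lambda>_. unit_meas)"

definition mlq_rows :: "nat \<Rightarrow> (nat \<times> nat \<Rightarrow> 'a) \<Rightarrow> nat \<Rightarrow> 'a set" where
  "mlq_rows n g = (\<lambda>r\<in>{1..n}. g ` ({r} \<times> {1..r}))"

definition cell :: "nat \<Rightarrow> real \<Rightarrow> nat" where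
  "cell L p = nat \<lfloor>real L * p\<rfloor>"

definition discretise :: "nat \<Rightarrow> nat \<Rightarrow> (nat \<times> nat \<Rightarrow> real) \<Rightarrow> nat \<times> nat \<Rightarrow> nat" where
  "discretise n L u = (\<lambda>p\<in>mlq_index n. cell L (u p))"

lemma space_unit [simp]: "space unit_meas = {0..<1}"
  by (simp add: unit_meas_def space_restrict_space)

lemma sets_unit: "sets unit_meas = sets (restrict_space borel {0..<1})"
  by (simp add: unit_meas_def sets_restrict_space)

lemma prob_space_unit: "prob_space unit_meas"
  by (rule prob_spaceI) (simp add: unit_meas_def space_restrict_space emeasure_restrict_space)

lemma prob_space_mlq_meas: "prob_space (mlq_meas n)"
  unfolding mlq_meas_def by (intro prob_space_PiM prob_space_unit)

lemma finite_mlq_index [simp]: "finite (mlq_index n)"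
  by (simp add: mlq_index_def)

lemma cell_less: "0 \<le> p \<Longrightarrow> p < 1 \<Longrightarrow> 0 < L \<Longrightarrow> cell L p < L"
  unfolding cell_def by (auto simp: nat_less_iff floor_less_iff)

lemma cell_eq_iff:
  assumes "0 < L" "0 \<le> p"
  shows "cell L p = a \<longleftrightarrow> real a / real L \<le> p \<and> p < (real a + 1) / real L"
proof -
  have "0 \<le> \<lfloor>real L * p\<rfloor>" using assms by simp
  then have "cell L p = a \<longleftrightarrow> \<lfloor>real L * p\<rfloor> = int a" unfolding cell_def by auto
  also have "\<dots> \<longleftrightarrow> real a \<le> real L * p \<and> real L * p < real a + 1" by (auto simp: floor_eq_iff)
  finally show ?thesis using assms by (simp add: field_simps)
qed

lemma cell_sets: "0 < L \<Longrightarrow> {p \<in> {0..<1}. cell L p = a} \<in> sets unit_meas"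
proof -
  assume L: "0 < L"
  have eq: "{p \<in> {0..<1}. cell L p = a} = {0..<1} \<inter> {real a / real L..<(real a + 1) / real L}"
  proof (rule set_eqI)
    fix p
    show "p \<in> {p \<in> {0..<1}. cell L p = a} \<longleftrightarrow> p \<in> {0..<1} \<inter> {real a / real L..<(real a + 1) / real L}"
      using cell_eq_iff[OF L, of p a] order_trans[of 0 "real a / real L" p] by (cases "0 \<le> p") auto
  qed
  show ?thesis unfolding eq sets_unit sets_restrict_space by (intro imageI) simp
qed

lemma emeasure_cell:
  assumes L: "0 < L" and a: "a < L"
  shows "emeasure unit_meas {p \<in> {0..<1}. cell L p = a} = ennreal (1 / real L)"
proof -
  have le: "(real a + 1) / real L \<le> 1" using a by (simp add: field_simps)
  have "{p \<in> {0..<1}. cell L p = a} = {real a / real L..<(real a + 1) / real L}"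
  proof (intro set_eqI iffI)
    fix p assume p: "p \<in> {real a / real L..<(real a + 1) / real L}"
    have "0 \<le> real a / real L" by simp
    then have "0 \<le> p" "p < 1" using p le unfolding atLeastLessThan_iff by (meson order_trans, meson less_le_trans)
    then show "p \<in> {p \<in> {0..<1}. cell L p = a}" using cell_eq_iff[OF L, of p a] p by auto
  next
    fix p assume "p \<in> {p \<in> {0..<1}. cell L p = a}"
    then show "p \<in> {real a / real L..<(real a + 1) / real L}" using cell_eq_iff[OF L, of p a] by simp
  qed
  moreover have "{real a / real L..<(real a + 1) / real L} \<subseteq> {0..<1}"
    using calculation by blast
  ultimately have "emeasure unit_meas {p \<in> {0..<1}. cell L p = a} =
      emeasure lborel {real a / real L..<(real a + 1) / real L}"
    unfolding unit_meas_def by (subst emeasure_restrict_space) auto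
  also have "\<dots> = ennreal ((real a + 1) / real L - real a / real L)"
    by (subst emeasure_lborel_Ico) (auto simp: divide_right_mono)
  finally show ?thesis by (simp add: add_divide_distrib)
qed

lemma discretise_event:
  assumes g: "g \<in> PiE (mlq_index n) (\<lambda>_. {..<L})"
  shows "{u \<in> space (mlq_meas n). discretise n L u = g} =
    PiE (mlq_index n) (\<lambda>p. {x \<in> {0..<1}. cell L x = g p})"
proof (intro set_eqI iffI)
  fix u assume u: "u \<in> {u \<in> space (mlq_meas n). discretise n L u = g}"
  then have "discretise n L u p = g p" for p by simp
  then have "cell L (u p) = g p" if "p \<in> mlq_index n" for p
    using that unfolding discretise_def by (metis restrict_apply')
  then show "u \<in> PiE (mlq_index n) (\<lambda>p. {x \<in> {0..<1}. cell L x = g p})"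
    using u by (auto simp: mlq_meas_def space_PiM PiE_iff)
next
  fix u assume u: "u \<in> PiE (mlq_index n) (\<lambda>p. {x \<in> {0..<1}. cell L x = g p})"
  then have "discretise n L u p = g p" for p
    using PiE_arb[OF g, of p] by (auto simp: discretise_def PiE_iff)
  then show "u \<in> {u \<in> space (mlq_meas n). discretise n L u = g}"
    using u by (auto simp: mlq_meas_def space_PiM PiE_iff)
qed

lemma discretise_event_sets:
  assumes L: "0 < L" and g: "g \<in> PiE (mlq_index n) (\<lambda>_. {..<L})"
  shows "{u \<in> space (mlq_meas n). discretise n L u = g} \<in> sets (mlq_meas n)"
  unfolding discretise_event[OF g] unfolding mlq_meas_def
  by (intro sets_PiM_I_finite cell_sets L) simp

lemma measure_discretise:
  assumes L: "0 < L" and g: "g \<in> PiE (mlq_index n) (\<lambda>_. {..<L})"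
  shows "measure (mlq_meas n) {u \<in> space (mlq_meas n). discretise n L u = g} =
    (1 / real L) ^ card (mlq_index n)"
proof -
  interpret prob_space unit_meas by (rule prob_space_unit)
  interpret product_sigma_finite "\<lambda>_ :: nat \<times> nat. unit_meas" ..
  have "emeasure (mlq_meas n) {u \<in> space (mlq_meas n). discretise n L u = g} =
    (\<Prod>p\<in>mlq_index n. emeasure unit_meas {x \<in> {0..<1}. cell L x = g p})"
    unfolding discretise_event[OF g] unfolding mlq_meas_def
    by (intro emeasure_PiM cell_sets L) simp
  also have "\<dots> = (\<Prod>p\<in>mlq_index n. ennreal (1 / real L))"
    using g L by (intro prod.cong refl emeasure_cell) (auto simp: PiE_iff)
  also have "\<dots> = ennreal ((1 / real L) ^ card (mlq_index n))"
    by (simp add: ennreal_power)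
  finally show ?thesis by (simp add: measure_def)
qed

lemma discretise_in_PiE:
  assumes "0 < L" "u \<in> space (mlq_meas n)"
  shows "discretise n L u \<in> PiE (mlq_index n) (\<lambda>_. {..<L})"
  using assms cell_less by (auto simp: discretise_def mlq_meas_def space_PiM PiE_iff)

lemma measurable_discretise:
  assumes L: "0 < L"
  shows "discretise n L \<in> measurable (mlq_meas n) (count_space (PiE (mlq_index n) (\<lambda>_. {..<L})))"
proof (subst measurable_count_space_eq2, goal_cases)
  case 1
  show ?case by (intro finite_PiE) auto
next
  case 2
  show ?case
  proof (intro conjI ballI)
  show "discretise n L \<in> space (mlq_meas n) \<rightarrow> PiE (mlq_index n) (\<lambda>_. {..<L})"
    using discretise_in_PiE[OF L] by auto
  fix g assume g: "g \<in> PiE (mlq_index n) (\<lambda>_. {..<L})"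
  show "discretise n L -` {g} \<inter> space (mlq_meas n) \<in> sets (mlq_meas n)"
    using discretise_event_sets[OF L g] by (simp add: vimage_def Int_def conj_commute)
  qed
qed

lemma borel_measurable_discretise:
  fixes \<phi> :: "(nat \<times> nat \<Rightarrow> nat) \<Rightarrow> real"
  assumes L: "0 < L"
  shows "(\<lambda>u. \<phi> (discretise n L u)) \<in> borel_measurable (mlq_meas n)"
  by (rule measurable_compose[OF measurable_discretise[OF L]]) simp

text \<open>The cells of the coordinates are independent and uniform, so integrals of functions of
  the cells are averages over the grid.\<close>

lemma integral_discretise:
  fixes \<phi> :: "(nat \<times> nat \<Rightarrow> nat) \<Rightarrow> real"
  assumes L: "0 < L"
  shows "integral\<^sup>L (mlq_meas n) (\<lambda>u. \<phi> (discretise n L u)) =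
    (\<Sum>g\<in>PiE (mlq_index n) (\<lambda>_. {..<L}). \<phi> g) * (1 / real L) ^ card (mlq_index n)"
proof -
  interpret prob_space "mlq_meas n" by (rule prob_space_mlq_meas)
  let ?G = "PiE (mlq_index n) (\<lambda>_. {..<L})"
  let ?E = "\<lambda>g. {u \<in> space (mlq_meas n). discretise n L u = g}"
  have fin: "finite ?G" by (intro finite_PiE) auto
  have "integral\<^sup>L (mlq_meas n) (\<lambda>u. \<phi> (discretise n L u)) =
    integral\<^sup>L (mlq_meas n) (\<lambda>u. \<Sum>g\<in>?G. \<phi> g * indicator (?E g) u)"
  proof (rule Bochner_Integration.integral_cong[OF refl])
    fix u assume u: "u \<in> space (mlq_meas n)"
    have "(\<Sum>g\<in>?G. \<phi> g * indicator (?E g) u) = (\<Sum>g\<in>?G. if g = discretise n L u then \<phi> g else 0)"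
      using u by (intro sum.cong) (auto simp: indicator_def)
    also have "\<dots> = \<phi> (discretise n L u)"
      using fin discretise_in_PiE[OF L u] by simp
    finally show "\<phi> (discretise n L u) = (\<Sum>g\<in>?G. \<phi> g * indicator (?E g) u)" by simp
  qed
  also have "\<dots> = (\<Sum>g\<in>?G. \<phi> g * measure (mlq_meas n) (?E g))"
    using discretise_event_sets[OF L]
    by (subst Bochner_Integration.integral_sum) (auto intro!: sum.cong integrable_real_mult_indicator simp: emeasure_eq_measure)
  also have "\<dots> = (\<Sum>g\<in>?G. \<phi> g * (1 / real L) ^ card (mlq_index n))"
    by (intro sum.cong refl) (simp add: measure_discretise[OF L])
  finally show ?thesis by (simp add: sum_distrib_right)
qed

text \<open>Bijections between corresponding rows transport the numbered points of \<open>R\<close>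
  to those of \<open>S\<close>. By symmetry the inequality is an equality: all row configurations
  arise equally often.\<close>

lemma card_rows_fibre:
  assumes R: "R \<in> row_space L (\<lambda>i. i) n" and S: "S \<in> row_space L (\<lambda>i. i) n"
  shows "card {g \<in> PiE (mlq_index n) (\<lambda>_. {..<L}). mlq_rows n g = R} \<le>
         card {g \<in> PiE (mlq_index n) (\<lambda>_. {..<L}). mlq_rows n g = S}"
proof -
  let ?G = "PiE (mlq_index n) (\<lambda>_. {..<L})"
  have sets: "Q r \<subseteq> {..<L}" "card (Q r) = r" if "Q \<in> row_space L (\<lambda>i. i) n" "r \<in> {1..n}" for Q r
    using that by (auto simp: row_space_def subsets_of_card_def PiE_iff)
  have "\<exists>h. bij_betw h (R r) (S r)" if "r \<in> {1..n}" for r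
    using sets[OF R that] sets[OF S that] finite_subset[OF _ finite_lessThan]
    by (intro finite_same_card_bij) auto
  then obtain h where h: "\<And>r. r \<in> {1..n} \<Longrightarrow> bij_betw (h r) (R r) (S r)" by metis
  define f where "f g = (\<lambda>p\<in>mlq_index n. h (fst p) (g p))" for g
  have mem: "g p \<in> R (fst p)" "fst p \<in> {1..n}" if "mlq_rows n g = R" "p \<in> mlq_index n" for g p
  proof -
    show r: "fst p \<in> {1..n}" using that by (auto simp: mlq_index_def)
    have "p \<in> {fst p} \<times> {1..fst p}" using that by (auto simp: mlq_index_def)
    then have "g p \<in> mlq_rows n g (fst p)" using r by (simp add: mlq_rows_def)
    then show "g p \<in> R (fst p)" using that by simp
  qed
  have rows_f: "mlq_rows n (f g) = S" if g: "mlq_rows n g = R" for g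
  proof
    fix r
    show "mlq_rows n (f g) r = S r"
    proof (cases "r \<in> {1..n}")
      case True
      have "f g p = h r (g p)" if "p \<in> {r} \<times> {1..r}" for p
        using that True by (auto simp: f_def mlq_index_def)
      then have "f g ` ({r} \<times> {1..r}) = (\<lambda>p. h r (g p)) ` ({r} \<times> {1..r})"
        by (intro image_cong refl)
      then have "mlq_rows n (f g) r = h r ` (g ` ({r} \<times> {1..r}))"
        using True by (simp add: mlq_rows_def image_image)
      also have "g ` ({r} \<times> {1..r}) = R r" using fun_cong[OF g, of r] True by (simp add: mlq_rows_def)
      finally show ?thesis using h[OF True] by (simp add: bij_betw_def)
    next
      case False
      then show ?thesis using S by (auto simp: mlq_rows_def row_space_def PiE_iff extensional_def)
    qed
  qed
  show ?thesis
  proof (rule card_inj_on_le[of f])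
    show "finite {g \<in> ?G. mlq_rows n g = S}" by (rule finite_subset[of _ ?G]) (auto intro!: finite_PiE)
    show "f ` {g \<in> ?G. mlq_rows n g = R} \<subseteq> {g \<in> ?G. mlq_rows n g = S}"
    proof
      fix k assume "k \<in> f ` {g \<in> ?G. mlq_rows n g = R}"
      then obtain g where g: "g \<in> ?G" "mlq_rows n g = R" "k = f g" by auto
      have "h (fst p) (g p) < L" if "p \<in> mlq_index n" for p
        using h[OF mem(2)[OF g(2) that]] mem(1)[OF g(2) that] sets(1)[OF S mem(2)[OF g(2) that]]
        by (auto simp: bij_betw_def)
      then have "f g \<in> ?G" by (auto simp: f_def)
      then show "k \<in> {g \<in> ?G. mlq_rows n g = S}" using g rows_f by simp
    qed
    show "inj_on f {g \<in> ?G. mlq_rows n g = R}"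
    proof (rule inj_onI)
      fix g g' assume g: "g \<in> {g \<in> ?G. mlq_rows n g = R}" and g': "g' \<in> {g \<in> ?G. mlq_rows n g = R}" and eq: "f g = f g'"
      show "g = g'"
      proof
        fix p
        show "g p = g' p"
        proof (cases "p \<in> mlq_index n")
          case True
          have "h (fst p) (g p) = h (fst p) (g' p)" using fun_cong[OF eq, of p] True by (simp add: f_def)
          then show ?thesis
            using h[OF mem(2)[OF _ True, of g]] mem(1)[OF _ True, of g] mem(1)[OF _ True, of g'] g g'
            by (auto simp: bij_betw_def dest: inj_onD)
        next
          case False
          then show ?thesis using g g' by (metis (no_types, lifting) PiE_arb mem_Collect_eq)
        qed
      qed
    qed
  qed
qed

text \<open>Given that no two points of a row share a cell, the discretised rows are uniform on
  \<open>row_space\<close>. The average is therefore a quotient of two integrals, whose denominator,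
  the probability of no collision, tends to 1; dominated convergence handles both.\<close>

lemma row_space_avg_limit:
  fixes \<Phi> :: "nat \<Rightarrow> (nat \<Rightarrow> nat set) \<Rightarrow> real" and \<Psi> :: "(nat \<times> nat \<Rightarrow> real) \<Rightarrow> real"
  assumes bound: "\<And>L R. R \<in> row_space L (\<lambda>i. i) n \<Longrightarrow> \<bar>\<Phi> L R\<bar> \<le> B"
    and meas: "\<Psi> \<in> borel_measurable (mlq_meas n)"
    and conv: "AE u in mlq_meas n. (\<lambda>L. \<Phi> L (mlq_rows n (discretise n L u))) \<longlonglongrightarrow> \<Psi> u"
    and ev: "AE u in mlq_meas n. eventually (\<lambda>L. mlq_rows n (discretise n L u) \<in> row_space L (\<lambda>i. i) n) sequentially"
  shows "(\<lambda>L. (\<Sum>R\<in>row_space L (\<lambda>i. i) n. \<Phi> L R) / real (card (row_space L (\<lambda>i. i) n)))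
    \<longlonglongrightarrow> integral\<^sup>L (mlq_meas n) \<Psi>"
proof -
  interpret prob_space "mlq_meas n" by (rule prob_space_mlq_meas)
  let ?W = "\<lambda>L. row_space L (\<lambda>i. i) n"
  let ?G = "\<lambda>L. PiE (mlq_index n) (\<lambda>_. {..<L})"
  \<comment> \<open>The probability of one particular row configuration. A representative can be
    chosen, since all fibres have the same size.\<close>
  define q where "q L = real (card {g \<in> ?G L. mlq_rows n g = (SOME R. R \<in> ?W L)}) * (1 / real L) ^ card (mlq_index n)" for L
  have fibre: "card {g \<in> ?G L. mlq_rows n g = R} = card {g \<in> ?G L. mlq_rows n g = (SOME R. R \<in> ?W L)}"
    if "R \<in> ?W L" for R L
    using card_rows_fibre[OF that someI[of "\<lambda>R. R \<in> ?W L", OF that]]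
      card_rows_fibre[OF someI[of "\<lambda>R. R \<in> ?W L", OF that] that] by (rule antisym)
  define h where "h \<phi> L R = (if R \<in> ?W L then \<phi> L R else 0 :: real)" for \<phi> L R
  have int: "integral\<^sup>L (mlq_meas n) (\<lambda>u. h \<phi> L (mlq_rows n (discretise n L u))) = q L * (\<Sum>R\<in>?W L. \<phi> L R)"
    if L: "0 < L" for \<phi> L
  proof -
    have fin: "finite (?G L)" by (intro finite_PiE) auto
    have "(\<Sum>g\<in>?G L. h \<phi> L (mlq_rows n g)) = (\<Sum>g\<in>{g\<in>?G L. mlq_rows n g \<in> ?W L}. \<phi> L (mlq_rows n g))"
      using fin by (simp add: h_def sum.If_cases Int_def)
    also have "\<dots> = (\<Sum>R\<in>?W L. \<Sum>g\<in>{g\<in>{g\<in>?G L. mlq_rows n g \<in> ?W L}. mlq_rows n g = R}. \<phi> L (mlq_rows n g))"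
      using fin by (intro sum.group[symmetric]) auto
    also have "\<dots> = (\<Sum>R\<in>?W L. real (card {g\<in>?G L. mlq_rows n g = R}) * \<phi> L R)"
    proof (intro sum.cong refl)
      fix R assume R: "R \<in> ?W L"
      have "{g\<in>{g\<in>?G L. mlq_rows n g \<in> ?W L}. mlq_rows n g = R} = {g\<in>?G L. mlq_rows n g = R}" using R by auto
      then show "(\<Sum>g\<in>{g\<in>{g\<in>?G L. mlq_rows n g \<in> ?W L}. mlq_rows n g = R}. \<phi> L (mlq_rows n g)) =
          real (card {g\<in>?G L. mlq_rows n g = R}) * \<phi> L R" by simp
    qed
    also have "\<dots> = real (card {g \<in> ?G L. mlq_rows n g = (SOME R. R \<in> ?W L)}) * (\<Sum>R\<in>?W L. \<phi> L R)"
      unfolding sum_distrib_left by (intro sum.cong refl) (simp add: fibre)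
    finally have s: "(\<Sum>g\<in>?G L. h \<phi> L (mlq_rows n g)) =
      real (card {g \<in> ?G L. mlq_rows n g = (SOME R. R \<in> ?W L)}) * (\<Sum>R\<in>?W L. \<phi> L R)" .
    show ?thesis
      unfolding integral_discretise[OF L, where \<phi> = "\<lambda>g. h \<phi> L (mlq_rows n g)"] s q_def by simp
  qed
  \<comment> \<open>The sequence starts at one site, because discretisation into zero cells is
    meaningless.\<close>
  have lim: "(\<lambda>L. integral\<^sup>L (mlq_meas n) (\<lambda>u. h \<phi> (Suc L) (mlq_rows n (discretise n (Suc L) u)))) \<longlonglongrightarrow> integral\<^sup>L (mlq_meas n) \<psi>"
    if b: "\<And>L R. R \<in> ?W L \<Longrightarrow> \<bar>\<phi> L R\<bar> \<le> C" "0 \<le> C" and m: "\<psi> \<in> borel_measurable (mlq_meas n)"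
      and c: "AE u in mlq_meas n. (\<lambda>L. \<phi> L (mlq_rows n (discretise n L u))) \<longlonglongrightarrow> \<psi> u" for \<phi> \<psi> C
  proof (rule integral_dominated_convergence[where w = "\<lambda>_. C"])
    show "AE u in mlq_meas n. (\<lambda>L. h \<phi> (Suc L) (mlq_rows n (discretise n (Suc L) u))) \<longlonglongrightarrow> \<psi> u"
      using c ev
    proof eventually_elim
      case (elim u)
      have "eventually (\<lambda>L. \<phi> L (mlq_rows n (discretise n L u)) = h \<phi> L (mlq_rows n (discretise n L u))) sequentially"
        using elim(2) by eventually_elim (simp add: h_def)
      then have "(\<lambda>L. h \<phi> L (mlq_rows n (discretise n L u))) \<longlonglongrightarrow> \<psi> u"
        using elim(1) by (rule Lim_transform_eventually[rotated])
      then show ?case by (rule LIMSEQ_Suc)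
    qed
    show "(\<lambda>u. h \<phi> (Suc L) (mlq_rows n (discretise n (Suc L) u))) \<in> borel_measurable (mlq_meas n)" for L
      using borel_measurable_discretise[of "Suc L", where \<phi> = "\<lambda>g. h \<phi> (Suc L) (mlq_rows n g)" and n = n] by simp
    show "AE u in mlq_meas n. norm (h \<phi> (Suc L) (mlq_rows n (discretise n (Suc L) u))) \<le> C" for L
      using b by (intro AE_I2) (auto simp: h_def)
  qed (use m in auto)
  have "(\<lambda>L. q (Suc L) * (\<Sum>R\<in>?W (Suc L). \<Phi> (Suc L) R)) \<longlonglongrightarrow> integral\<^sup>L (mlq_meas n) \<Psi>"
    using lim[of \<Phi> "max 0 B" \<Psi>] bound meas conv int[of "Suc _" \<Phi>] by (auto simp: le_max_iff_disj)
  moreover have "(\<lambda>L. q (Suc L) * (\<Sum>R\<in>?W (Suc L). 1)) \<longlonglongrightarrow> integral\<^sup>L (mlq_meas n) (\<lambda>_. 1)"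
    using lim[of "\<lambda>_ _. 1" 1 "\<lambda>_. 1"] int[of "Suc _" "\<lambda>_ _. 1"] by auto
  then have one: "(\<lambda>L. q (Suc L) * real (card (?W (Suc L)))) \<longlonglongrightarrow> 1"
    by (simp add: prob_space)
  ultimately have "(\<lambda>L. q (Suc L) * (\<Sum>R\<in>?W (Suc L). \<Phi> (Suc L) R) / (q (Suc L) * real (card (?W (Suc L)))))
      \<longlonglongrightarrow> integral\<^sup>L (mlq_meas n) \<Psi> / 1"
    by (intro tendsto_divide) auto
  moreover have "eventually (\<lambda>L. q (Suc L) * (\<Sum>R\<in>?W (Suc L). \<Phi> (Suc L) R) / (q (Suc L) * real (card (?W (Suc L)))) =
     (\<Sum>R\<in>?W (Suc L). \<Phi> (Suc L) R) / real (card (?W (Suc L)))) sequentially"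
    using order_tendstoD(1)[OF one, of 0] by (auto elim!: eventually_mono)
  ultimately show ?thesis
    by (subst filterlim_sequentially_Suc[symmetric]) (simp add: tendsto_cong)
qed

section \<open>Measures on the torus\<close>

text \<open>
  On \<open>[0,1)\<close> the function \<open>x \<mapsto> sin (\<pi> x) * sin (\<pi> (b - x))\<close>, which has period 1, is nonnegative
  exactly on \<open>[0,b]\<close>.
\<close>

definition arc_approx :: "nat \<Rightarrow> real \<Rightarrow> real \<Rightarrow> real" where
  "arc_approx m b x = (if b < 0 then 0 else if 1 \<le> b then 1 else
     max 0 (min 1 (real m * (sin (pi * x) * sin (pi * (b - x))) + 1)))"

lemma arc_approx_continuous: "continuous_on UNIV (arc_approx m b)"
  unfolding arc_approx_def by (cases "b < 0"; cases "1 \<le> b") (auto intro!: continuous_intros)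

lemma arc_approx_periodic: "arc_approx m b (x + 1) = arc_approx m b x"
proof -
  have "sin (pi * (x + 1)) = - sin (pi * x)" "sin (pi * (b - (x + 1))) = - sin (pi * (b - x))"
    using sin_periodic_pi[of "pi * x"] sin_periodic_pi[of "pi * (b - (x + 1))"]
    by (simp_all add: algebra_simps)
  then show ?thesis by (simp add: arc_approx_def)
qed

lemma arc_approx_bounds: "0 \<le> arc_approx m b x" "arc_approx m b x \<le> 1"
  by (auto simp: arc_approx_def)

text \<open>Where the product of sines is nonnegative, truncation at 1 gives the value 1; where it
  is negative, the factor \<open>m\<close> eventually pushes the expression below 0, and it is cut
  off there.\<close>

lemma arc_approx_limit:
  assumes x: "0 \<le> x" "x < 1"
  shows "(\<lambda>m. arc_approx m b x) \<longlonglongrightarrow> of_bool (x \<le> b)"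
proof (cases "0 \<le> b \<and> b < 1")
  case False
  then show ?thesis using x by (auto simp: arc_approx_def)
next
  case True
  let ?s = "sin (pi * x) * sin (pi * (b - x))"
  show ?thesis
  proof (cases "x \<le> b")
    case le: True
    have "0 \<le> sin (pi * x)" "0 \<le> sin (pi * (b - x))"
      using x le True mult_left_le[of x pi] mult_left_le[of "b - x" pi] by (auto intro!: sin_ge_zero)
    then have "arc_approx m b x = 1" for m using True by (auto simp: arc_approx_def)
    then show ?thesis using le by simp
  next
    case gt: False
    have "0 < sin (pi * x)" using x gt True by (intro sin_gt_zero) auto
    moreover have "0 < sin (pi * (x - b))" using x gt True by (intro sin_gt_zero) auto
    moreover have "sin (pi * (b - x)) = - sin (pi * (x - b))"
      by (metis minus_diff_eq mult_minus_right sin_minus)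
    ultimately have neg: "?s < 0" by (simp add: mult_pos_neg)
    have "eventually (\<lambda>m. 1 \<le> real m * (- ?s)) sequentially"
    proof -
      obtain N where "1 / (- ?s) < real N" using reals_Archimedean2 by blast
      then have "1 \<le> real m * (- ?s)" if "N \<le> m" for m
        using neg that by (simp add: field_simps) (smt (verit) mult_left_mono_neg of_nat_le_iff mult.commute)
      then show ?thesis by (auto simp: eventually_sequentially)
    qed
    then have "eventually (\<lambda>m. arc_approx m b x = 0) sequentially"
      by eventually_elim (use True in \<open>auto simp: arc_approx_def\<close>)
    then show ?thesis using gt by (simp add: tendsto_eventually)
  qed
qed

text \<open>Boxes anchored at the origin form an intersection-stable generator, and their indicators
  are limits of products of \<open>arc_approx\<close>.\<close>

definition ring_box :: "nat \<Rightarrow> (nat \<Rightarrow> real) \<Rightarrow> (nat \<Rightarrow> real) set" where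
  "ring_box n b = PiE {1..n} (\<lambda>k. {0..<1} \<inter> {..b k})"

lemma space_ring_space: "space (ring_space n) = PiE {1..n} (\<lambda>_. {0..<1})"
  by (simp add: ring_space_def space_PiM space_restrict_space)

lemma ring_box_sets: "ring_box n b \<in> sets (ring_space n)"
  unfolding ring_box_def ring_space_def
  by (intro sets_PiM_I_finite) (auto simp: sets_restrict_space)

lemma sets_ring_space: "sets (ring_space n) = sigma_sets (space (ring_space n)) (range (ring_box n))"
proof
  define N where "N = sigma (space (ring_space n)) (range (ring_box n))"
  have sub: "range (ring_box n) \<subseteq> Pow (space (ring_space n))"
    using sets.sets_into_space[OF ring_box_sets] by blast
  have sN: "space N = space (ring_space n)" and setsN: "sets N = sigma_sets (space (ring_space n)) (range (ring_box n))"
    using sub by (simp_all add: N_def space_measure_of sets_measure_of)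
  have id: "(\<lambda>x. x) \<in> measurable N (ring_space n)"
    unfolding ring_space_def
  proof (rule measurable_PiM_single'[where f = "\<lambda>k x. x k"])
    show "(\<lambda>x. x) \<in> space N \<rightarrow> (\<Pi>\<^sub>E i\<in>{1..n}. space (restrict_space borel {0..<1}))"
      unfolding sN by (simp add: space_ring_space space_restrict_space)
    fix k assume k: "k \<in> {1..n}"
    show "(\<lambda>x. x k) \<in> measurable N (restrict_space borel {0..<1})"
    proof (rule measurable_restrict_space2)
      show "(\<lambda>x. x k) \<in> space N \<rightarrow> {0..<1}" unfolding sN using k by (auto simp: space_ring_space)
      show "(\<lambda>x. x k) \<in> borel_measurable N"
      proof (rule borel_measurableI_le)
        fix y
        \<comment> \<open>A condition on a single coordinate is a box whose other sides are
          unrestricted, as 1 bounds the whole circle.\<close>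
        have "{x \<in> space N. x k \<le> y} = ring_box n ((\<lambda>_. 1)(k := y))"
        proof (rule set_eqI)
          fix x :: "nat \<Rightarrow> real"
          have "x i \<in> {0..<1} \<inter> {..((\<lambda>_. 1)(k := y)) i} \<longleftrightarrow> x i \<in> {0..<1} \<and> (i = k \<longrightarrow> x k \<le> y)" for i
            by auto
          then show "x \<in> {x \<in> space N. x k \<le> y} \<longleftrightarrow> x \<in> ring_box n ((\<lambda>_. 1)(k := y))"
            unfolding sN space_ring_space ring_box_def mem_Collect_eq PiE_iff using k by blast
        qed
        then show "{x \<in> space N. x k \<le> y} \<in> sets N" unfolding setsN by auto
      qed
    qed
  qed
  have "A \<in> sets N" if "A \<in> sets (ring_space n)" for A
    using measurable_sets[OF id that] sets.sets_into_space[OF that] by (simp add: sN Int_absorb2)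
  then show "sets (ring_space n) \<subseteq> sigma_sets (space (ring_space n)) (range (ring_box n))"
    unfolding setsN by blast
  show "sigma_sets (space (ring_space n)) (range (ring_box n)) \<subseteq> sets (ring_space n)"
    by (intro sets.sigma_sets_subset) (auto intro: ring_box_sets)
qed

lemma ring_continuous_borel_measurable:
  assumes f: "ring_continuous n f"
  shows "f \<in> borel_measurable (ring_space n)"
proof -
  have "(\<lambda>x. x) \<in> borel_measurable (ring_space n)"
  proof (rule measurable_coordinatewise_then_product)
    fix k
    show "(\<lambda>x. x k) \<in> borel_measurable (ring_space n)"
    proof (cases "k \<in> {1..n}")
      case True
      then have "(\<lambda>x. x k) \<in> measurable (ring_space n) (restrict_space borel {0..<1})"
        unfolding ring_space_def by (rule measurable_component_singleton)
      then show ?thesis using measurable_restrict_space2_iff by blast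
    next
      case False
      \<comment> \<open>Test functions take all coordinates as arguments; outside
        \<open>{1..n}\<close> these are constant on the space.\<close>
      then have "x k = undefined" if "x \<in> space (ring_space n)" for x
        using that by (auto simp: space_ring_space PiE_iff extensional_def)
      then show ?thesis by (subst measurable_cong[of _ _ "\<lambda>_. undefined"]) auto
    qed
  qed
  moreover have "f \<in> borel_measurable borel"
    using f by (intro borel_measurable_continuous_onI) (simp add: ring_continuous_def)
  ultimately show ?thesis using measurable_compose[of "\<lambda>x. x"] by simp
qed

text \<open>Indicators of boxes are not continuous on the torus, but they are bounded pointwise
  limits of admissible test functions. So the integrals determine the measure on boxes and hence
  everywhere.\<close>

lemma ring_measure_eqI:
  assumes P: "prob_space P" "sets P = sets (ring_space n)" and Q: "prob_space Q" "sets Q = sets (ring_space n)"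
    and eq: "\<And>f. ring_continuous n f \<Longrightarrow> integral\<^sup>L P f = integral\<^sup>L Q f"
  shows "P = Q"
proof -
  define f where "f b m x = (\<Prod>k\<in>{1..n}. arc_approx m (b k) (x k))" for b m and x :: "nat \<Rightarrow> real"
  have f: "ring_continuous n (f b m)" for b m
    unfolding ring_continuous_def
  proof (intro conjI allI ballI)
    show "continuous_on UNIV (f b m)"
      unfolding f_def[abs_def]
      by (intro continuous_on_prod continuous_on_compose2[OF arc_approx_continuous] continuous_on_product_coordinates) auto
    fix x k assume "k \<in> {1..n}"
    show "f b m (x(k := x k + 1)) = f b m x"
      unfolding f_def by (intro prod.cong refl) (auto simp: arc_approx_periodic)
  qed
  have lim: "(\<lambda>m. integral\<^sup>L M (f b m)) \<longlonglongrightarrow> measure M (ring_box n b)"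
    if M: "prob_space M" "sets M = sets (ring_space n)" for M b
  proof -
    interpret prob_space M by fact
    have sp: "space M = space (ring_space n)" using M(2) by (rule sets_eq_imp_space_eq)
    have "(\<lambda>m. integral\<^sup>L M (f b m)) \<longlonglongrightarrow> integral\<^sup>L M (indicator (ring_box n b))"
    proof (rule integral_dominated_convergence[where w = "\<lambda>_. 1"])
      show "indicator (ring_box n b) \<in> borel_measurable M"
        using ring_box_sets M(2) by (intro borel_measurable_indicator) simp
      show "f b m \<in> borel_measurable M" for m
        using ring_continuous_borel_measurable[OF f] M(2) by (simp cong: measurable_cong_sets)
      show "AE x in M. (\<lambda>m. f b m x) \<longlonglongrightarrow> indicator (ring_box n b) x"
      proof (rule AE_I2)
        fix x assume "x \<in> space M"
        then have x: "x \<in> PiE {1..n} (\<lambda>_. {0..<1})" unfolding sp space_ring_space .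
        have "(\<lambda>m. f b m x) \<longlonglongrightarrow> (\<Prod>k\<in>{1..n}. of_bool (x k \<le> b k))"
          unfolding f_def using x by (intro tendsto_prod arc_approx_limit) (auto simp: PiE_iff)
        also have "(\<Prod>k\<in>{1..n}. of_bool (x k \<le> b k)) = (indicator (ring_box n b) x :: real)"
          using x by (auto simp: indicator_def ring_box_def PiE_iff)
        finally show "(\<lambda>m. f b m x) \<longlonglongrightarrow> indicator (ring_box n b) x" .
      qed
      show "AE x in M. norm (f b m x) \<le> 1" for m
        unfolding f_def using arc_approx_bounds
        by (intro AE_I2) (auto intro!: prod_le_1 simp: abs_prod)
    qed auto
    then show ?thesis using ring_box_sets[of n b] M(2) by simp
  qed
  have box: "measure P (ring_box n b) = measure Q (ring_box n b)" for b
    using LIMSEQ_unique[OF lim[OF P, of b]] lim[OF Q, of b] eq[OF f] by simp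
  interpret P: prob_space P by fact
  interpret Q: prob_space Q by fact
  show ?thesis
  proof (rule measure_eqI_generator_eq[where E = "range (ring_box n)" and \<Omega> = "space (ring_space n)"
        and A = "\<lambda>_. ring_box n (\<lambda>_. 1)"])
    show "Int_stable (range (ring_box n))"
    proof (rule Int_stableI)
      fix A B assume "A \<in> range (ring_box n)" "B \<in> range (ring_box n)"
      then obtain a b where ab: "A = ring_box n a" "B = ring_box n b" by auto
      have "A \<inter> B = ring_box n (\<lambda>k. min (a k) (b k))"
        unfolding ab ring_box_def by (auto simp: PiE_iff)
      then show "A \<inter> B \<in> range (ring_box n)" by auto
    qed
    show "range (ring_box n) \<subseteq> Pow (space (ring_space n))"
      using sets.sets_into_space[OF ring_box_sets] by blast
    show "(\<Union>i::nat. ring_box n (\<lambda>_. 1)) = space (ring_space n)"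
    proof -
      have "ring_box n (\<lambda>_. 1) = space (ring_space n)"
        unfolding ring_box_def space_ring_space by (intro PiE_cong) auto
      then show ?thesis by simp
    qed
  qed (use P Q box in \<open>auto simp: sets_ring_space P.emeasure_eq_measure Q.emeasure_eq_measure\<close>)
qed

lemma is_continuous_tasep_unique:
  assumes "is_continuous_tasep n M" shows "continuous_tasep n = M"
  unfolding continuous_tasep_def
proof (rule the_equality)
  show "is_continuous_tasep n M" by (rule assms)
next
  fix N assume N: "is_continuous_tasep n N"
  show "N = M"
  proof (rule ring_measure_eqI)
    fix f assume f: "ring_continuous n f"
    show "integral\<^sup>L N f = integral\<^sup>L M f"
      using N assms f unfolding is_continuous_tasep_def by (meson LIMSEQ_unique)
  qed (use N assms in \<open>auto simp: is_continuous_tasep_def\<close>)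
qed

section \<open>Order embeddings and distinct coordinates\<close>

definition order_embedding_on :: "'a::linorder set \<Rightarrow> ('a \<Rightarrow> 'b::linorder) \<Rightarrow> bool" where
  "order_embedding_on U f \<longleftrightarrow> (\<forall>x\<in>U. \<forall>y\<in>U. f x \<le> f y \<longleftrightarrow> x \<le> y)"

lemma order_embedding_onD:
  "order_embedding_on U f \<Longrightarrow> x \<in> U \<Longrightarrow> y \<in> U \<Longrightarrow> f x \<le> f y \<longleftrightarrow> x \<le> y"
  by (simp add: order_embedding_on_def)

lemma order_embedding_on_inj: "order_embedding_on U f \<Longrightarrow> inj_on f U"
  by (rule inj_onI) (metis order_embedding_onD order_antisym order_refl)

lemma order_embedding_cyc_int:
  assumes "order_embedding_on U f" "t \<in> U" "s \<in> U" "u \<in> U"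
  shows "f u \<in> cyc_int (f t) (f s) \<longleftrightarrow> u \<in> cyc_int t s"
  using assms by (simp add: cyc_int_def order_embedding_onD)

text \<open>Queues see points only through cyclic intervals. The embedding has to respect the order
  of all rows jointly, since consecutive rows are compared with each other.\<close>

lemma mlq_image:
  assumes f: "order_embedding_on U f" and R: "\<And>r. r \<in> {1..n} \<Longrightarrow> R r \<subseteq> U"
  shows "mlq (\<lambda>r. f ` R r) n k = f ` mlq R n k"
  using R
proof (induction n)
  case (Suc n)
  have "mlq R n k \<subseteq> U"
  proof (cases "n = 0")
    case False
    then show ?thesis using mlq_subset_row[of n R k] Suc.prems[of n] by auto
  qed simp
  moreover have "R (Suc n) \<subseteq> U" using Suc.prems by simp
  ultimately have U: "mlq R n k \<union> R (Suc n) \<subseteq> U" by simp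
  have "departures (f ` mlq R n k) (f ` R (Suc n)) = f ` departures (mlq R n k) (R (Suc n))"
    using U by (intro departures_image inj_on_subset[OF order_embedding_on_inj[OF f]]
        order_embedding_cyc_int[OF f]) auto
  then show ?case using Suc by simp
qed simp

lemma adjacent_image:
  assumes f: "order_embedding_on U f" and P: "P \<subseteq> U" "a \<in> U" "b \<in> U"
  shows "adjacent (f ` P) (f a) (f b) \<longleftrightarrow> adjacent P a b"
proof -
  note inj = order_embedding_on_inj[OF f]
  have "f ` P \<inter> cyc_int (f a) (f b) = f ` (P \<inter> cyc_int a b)"
    using order_embedding_cyc_int[OF f P(2,3)] P(1) by blast
  moreover have "f ` (P \<inter> cyc_int a b) = {f a, f b} \<longleftrightarrow> P \<inter> cyc_int a b = {a, b}"
    using inj_on_image_eq_iff[OF inj, of "P \<inter> cyc_int a b" "{a, b}"] P by auto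
  moreover have "f b \<noteq> f a \<longleftrightarrow> b \<noteq> a" using inj P by (auto dest: inj_onD)
  ultimately show ?thesis by (simp add: adjacent_def)
qed

lemma label_site_image:
  assumes f: "order_embedding_on U f" and R: "\<And>r. r \<in> {1..n} \<Longrightarrow> R r \<subseteq> U"
    and fin: "\<And>i. i \<in> {1..n} \<Longrightarrow> finite (R i)" and card: "\<And>k. k \<le> n \<Longrightarrow> card (mlq R n k) = k"
    and k: "1 \<le> k" "k \<le> n"
  shows "label_site (\<lambda>r. f ` R r) n k = f (label_site R n k)"
proof -
  note ins = mlq_eq_insert_label_site[OF fin card k]
  have "mlq R n k \<subseteq> U" using mlq_subset_row[of n R k] R[of n] k by auto
  then have "f ` mlq R n k - f ` mlq R n (k - 1) = f ` (mlq R n k - mlq R n (k - 1))"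
    using ins by (subst inj_on_image_set_diff[OF order_embedding_on_inj[OF f]]) auto
  also have "mlq R n k - mlq R n (k - 1) = {label_site R n k}" using ins by auto
  finally have "mlq (\<lambda>r. f ` R r) n k - mlq (\<lambda>r. f ` R r) n (k - 1) = {f (label_site R n k)}"
    using mlq_image[OF f R] by simp
  then show ?thesis unfolding label_site_def[of "\<lambda>r. f ` R r"] by simp
qed

lemma mlq_eq_label_sites:
  assumes fin: "\<And>i. i \<in> {1..n} \<Longrightarrow> finite (R i)" and card: "\<And>k. k \<le> n \<Longrightarrow> card (mlq R n k) = k"
    and k: "k \<le> n"
  shows "mlq R n k = label_site R n ` {1..k}"
  using k
proof (induction k)
  case (Suc k)
  have "{1..Suc k} = insert (Suc k) {1..k}" by auto
  then show ?case using mlq_eq_insert_label_site(1)[OF fin card, of "Suc k"] Suc by simp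
qed simp

lemma label_site_inj:
  assumes fin: "\<And>i. i \<in> {1..n} \<Longrightarrow> finite (R i)" and card: "\<And>k. k \<le> n \<Longrightarrow> card (mlq R n k) = k"
  shows "inj_on (label_site R n) {1..n}"
  using mlq_eq_label_sites[OF fin card, of n] card[of n] by (intro eq_card_imp_inj_on) auto

lemma site_of_word:
  assumes L: "2 \<le> L" and R: "R \<in> row_space L (\<lambda>i. i) n" and k: "1 \<le> k" "k \<le> n"
  shows "site_of (word L n (mlq R n)) k = label_site R n k"
proof -
  have A: "mono (mlq R n)" using mlq_mono[OF row_space_finite_row[OF R]] by (intro monoI) simp
  have sub: "mlq R n k \<subseteq> {..<L}" using mlq_row_space[OF L _ R] by (auto simp: mono_def)
  have "word L n (mlq R n) ! s = k \<longleftrightarrow> s \<in> mlq R n k - mlq R n (k - 1)" if "s < L" for s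
  proof -
    have "word L n (mlq R n) ! s = k \<longleftrightarrow> word L n (mlq R n) ! s \<le> k \<and> \<not> word L n (mlq R n) ! s \<le> k - 1"
      using k by linarith
    then show ?thesis using word_le_iff[OF A that k(2)] word_le_iff[OF A that, of "k - 1" n] k by simp
  qed
  then have "s < length (word L n (mlq R n)) \<and> word L n (mlq R n) ! s = k \<longleftrightarrow>
      s \<in> mlq R n k - mlq R n (k - 1)" for s
    using sub by auto
  then show ?thesis unfolding site_of_def label_site_def by simp
qed

lemma label_site_less:
  assumes L: "2 \<le> L" and R: "R \<in> row_space L (\<lambda>i. i) n" and k: "1 \<le> k" "k \<le> n"
  shows "label_site R n k < L"
proof -
  have card: "card (mlq R n k) = k" if "k \<le> n" for k
    using mlq_row_space[OF L _ R, of k] that by (auto simp: mono_def)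
  have "label_site R n k \<in> mlq R n k"
    using mlq_eq_insert_label_site(1)[OF row_space_finite_row[OF R] card k] by auto
  then show ?thesis using mlq_row_space[OF L _ R, of k] by (auto simp: mono_def)
qed

lemma tasep_expectation:
  fixes f :: "(nat \<Rightarrow> real) \<Rightarrow> real"
  assumes L: "3 \<le> L" "n \<le> L"
  shows "measure_pmf.expectation (tasep_pmf n L) (\<lambda>w. f (rescaled_positions n w)) =
    (\<Sum>R\<in>row_space L (\<lambda>i. i) n. f (\<lambda>k\<in>{1..n}. real (label_site R n k) / real L))
      / real (card (row_space L (\<lambda>i. i) n))"
proof -
  have ne: "row_space L (\<lambda>i. i) n \<noteq> {}" using L by (intro row_space_nonempty) auto
  have pos: "rescaled_positions n (word L n (mlq R n)) = (\<lambda>k\<in>{1..n}. real (label_site R n k) / real L)"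
    if "R \<in> row_space L (\<lambda>i. i) n" for R
    using site_of_word[OF _ that] L by (auto simp: rescaled_positions_def)
  have "measure_pmf.expectation (tasep_pmf n L) (\<lambda>w. f (rescaled_positions n w)) =
    (\<Sum>R\<in>row_space L (\<lambda>i. i) n. f (rescaled_positions n (word L n (mlq R n)))) / real (card (row_space L (\<lambda>i. i) n))"
    unfolding tasep_pmf_eq[OF L] using ne by (simp add: integral_pmf_of_set)
  also have "(\<Sum>R\<in>row_space L (\<lambda>i. i) n. f (rescaled_positions n (word L n (mlq R n)))) =
    (\<Sum>R\<in>row_space L (\<lambda>i. i) n. f (\<lambda>k\<in>{1..n}. real (label_site R n k) / real L))"
    using pos by (intro sum.cong refl) simp
  finally show ?thesis .
qed

lemma cell_strict_mono_eventually:
  assumes "0 \<le> x" "x < y"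
  shows "eventually (\<lambda>L. cell L x < cell L y) sequentially"
proof -
  obtain N where N: "1 / (y - x) < real N" using reals_Archimedean2 by blast
  have "cell L x < cell L y" if "N \<le> L" for L
  proof -
    have "1 / (y - x) < real L" using N that by (meson less_le_trans of_nat_le_iff)
    then have "1 < real L * y - real L * x" using assms by (simp add: field_simps)
    then have "\<lfloor>real L * x\<rfloor> < \<lfloor>real L * y\<rfloor>" by linarith
    moreover have "0 \<le> \<lfloor>real L * x\<rfloor>" using assms by simp
    ultimately show ?thesis unfolding cell_def by linarith
  qed
  then show ?thesis by (auto simp: eventually_sequentially)
qed

text \<open>Finitely many points have a smallest gap, and cells of a finer grid separate
  them.\<close>

lemma cell_embedding_eventually:
  assumes fin: "finite P" and P: "P \<subseteq> {0..<1}"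
  shows "eventually (\<lambda>L. order_embedding_on P (cell L)) sequentially"
proof -
  have "eventually (\<lambda>L. \<forall>x\<in>P. \<forall>y\<in>P. x < y \<longrightarrow> cell L x < cell L y) sequentially"
  proof (intro eventually_ball_finite fin ballI)
    fix x y assume "x \<in> P" "y \<in> P"
    then show "eventually (\<lambda>L. x < y \<longrightarrow> cell L x < cell L y) sequentially"
      using cell_strict_mono_eventually[of x y] P by (cases "x < y") auto
  qed
  then show ?thesis
  proof eventually_elim
    case (elim L)
    show ?case unfolding order_embedding_on_def
    proof (intro ballI)
      fix x y assume "x \<in> P" "y \<in> P"
      then show "cell L x \<le> cell L y \<longleftrightarrow> x \<le> y"
        using bspec[OF bspec[OF elim], of x y] bspec[OF bspec[OF elim], of y x]
        by (cases "x < y"; cases "y < x") auto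
    qed
  qed
qed

lemma cell_limit:
  assumes "0 \<le> p"
  shows "(\<lambda>L. real (cell L p) / real L) \<longlonglongrightarrow> p"
proof (rule tendsto_sandwich[of "\<lambda>L. p - inverse (real L)" _ _ "\<lambda>_. p"])
  have r: "real (cell L p) = of_int \<lfloor>real L * p\<rfloor>" for L
    unfolding cell_def using assms by simp
  show "eventually (\<lambda>L. p - inverse (real L) \<le> real (cell L p) / real L) sequentially"
    using eventually_gt_at_top[of 0]
  proof eventually_elim
    case (elim L)
    have "real L * p - 1 \<le> real (cell L p)" unfolding r by linarith
    then have "(real L * p - 1) / real L \<le> real (cell L p) / real L" by (rule divide_right_mono) simp
    then show ?case using elim by (simp add: diff_divide_distrib inverse_eq_divide)
  qed
  show "eventually (\<lambda>L. real (cell L p) / real L \<le> p) sequentially"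
    using eventually_gt_at_top[of 0]
  proof eventually_elim
    case (elim L)
    have "real (cell L p) \<le> real L * p" unfolding r by linarith
    then show ?case using elim by (simp add: field_simps)
  qed
  show "(\<lambda>L. p - inverse (real L)) \<longlonglongrightarrow> p"
    using tendsto_diff[OF tendsto_const lim_inverse_n, of p] by simp
qed simp

lemma mlq_coordinate_measurable:
  "p \<in> mlq_index n \<Longrightarrow> (\<lambda>u. u p) \<in> borel_measurable (mlq_meas n)"
proof -
  assume p: "p \<in> mlq_index n"
  have "(\<lambda>u. u p) \<in> measurable (mlq_meas n) unit_meas"
    unfolding mlq_meas_def by (rule measurable_component_singleton[OF p])
  also have "measurable (mlq_meas n) unit_meas = measurable (mlq_meas n) (restrict_space borel {0..<1})"
    by (rule measurable_cong_sets[OF refl sets_unit])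
  finally show ?thesis using measurable_restrict_space2_iff by blast
qed

text \<open>Equal coordinates lie in the same cell of every grid, and for two given coordinates this
  has probability at most \<open>1 / L\<close>.\<close>

lemma AE_coordinates_distinct:
  assumes p: "p \<in> mlq_index n" and q: "q \<in> mlq_index n" and pq: "p \<noteq> q"
  shows "AE u in mlq_meas n. u p \<noteq> u q"
proof -
  interpret prob_space "mlq_meas n" by (rule prob_space_mlq_meas)
  let ?I = "mlq_index n"
  let ?E = "{u \<in> space (mlq_meas n). u p = u q}"
  have E: "?E \<in> sets (mlq_meas n)"
    using mlq_coordinate_measurable[OF p] mlq_coordinate_measurable[OF q] by measurable
  have le: "measure (mlq_meas n) ?E \<le> 1 / real L" if L: "0 < L" for L
  proof -
    let ?G = "PiE ?I (\<lambda>_. {..<L})"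
    let ?D = "{g \<in> ?G. g p = g q}"
    have finG: "finite ?G" by (intro finite_PiE) auto
    \<comment> \<open>The coordinate \<open>p\<close> can be forgotten, as it repeats the coordinate
      \<open>q\<close>.\<close>
    have "card ?D \<le> card (PiE (?I - {p}) (\<lambda>_. {..<L}))"
    proof (rule card_inj_on_le[of "\<lambda>g. restrict g (?I - {p})"])
      show "inj_on (\<lambda>g. restrict g (?I - {p})) ?D"
      proof (rule inj_onI)
        fix g h assume g: "g \<in> ?D" and h: "h \<in> ?D" and eq: "restrict g (?I - {p}) = restrict h (?I - {p})"
        have ne: "g r = h r" if "r \<in> ?I - {p}" for r using fun_cong[OF eq, of r] that by simp
        show "g = h"
        proof
          fix r
          consider "r = p" | "r \<in> ?I - {p}" | "r \<notin> ?I" by blast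
          then show "g r = h r"
          proof cases
            case 1
            then show ?thesis using g h ne[of q] q pq by simp
          next
            case 3
            then show ?thesis using g h PiE_arb[of g ?I "\<lambda>_. {..<L}" r] PiE_arb[of h ?I "\<lambda>_. {..<L}" r] by simp
          qed (rule ne)
        qed
      qed
      show "(\<lambda>g. restrict g (?I - {p})) ` ?D \<subseteq> PiE (?I - {p}) (\<lambda>_. {..<L})"
        unfolding image_subset_iff restrict_PiE_iff by (auto simp: PiE_iff)
      show "finite (PiE (?I - {p}) (\<lambda>_. {..<L}))" by (intro finite_PiE) auto
    qed
    also have "\<dots> = L ^ (card ?I - 1)" using p by (simp add: card_PiE)
    finally have "real (card ?D) \<le> real (L ^ (card ?I - 1))" by (rule of_nat_mono)
    then have D: "real (card ?D) \<le> real L ^ (card ?I - 1)" unfolding of_nat_power .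
    have "measure (mlq_meas n) ?E = integral\<^sup>L (mlq_meas n) (indicator ?E)" using E by simp
    also have "\<dots> \<le> integral\<^sup>L (mlq_meas n) (\<lambda>u. of_bool (discretise n L u p = discretise n L u q))"
    proof (rule integral_mono)
      show "integrable (mlq_meas n) (indicator ?E :: _ \<Rightarrow> real)" using E by (simp add: emeasure_eq_measure)
      show "integrable (mlq_meas n) (\<lambda>u. of_bool (discretise n L u p = discretise n L u q) :: real)"
        using borel_measurable_discretise[OF L, where \<phi> = "\<lambda>g. of_bool (g p = g q)"]
        by (intro integrable_const_bound[where B = 1]) auto
    qed (use p q in \<open>auto simp: indicator_def discretise_def\<close>)
    also have "\<dots> = real (card ?D) * (1 / real L) ^ card ?I"
      using integral_discretise[OF L, where \<phi> = "\<lambda>g. of_bool (g p = g q)" and n = n] finG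
      by (simp add: of_bool_def sum.If_cases Int_def)
    also have "\<dots> \<le> real L ^ (card ?I - 1) * (1 / real L) ^ card ?I"
      using D by (intro mult_right_mono) auto
    also have "\<dots> = 1 / real L"
    proof -
      have "card ?I \<noteq> 0" using p by auto
      then have "(1 / real L) ^ card ?I = 1 / real L * (1 / real L) ^ (card ?I - 1)"
        by (simp add: power_eq_if)
      then show ?thesis using L by (simp add: power_one_over)
    qed
    finally show ?thesis .
  qed
  have "measure (mlq_meas n) ?E \<le> 0"
  proof (rule LIMSEQ_le_const[OF lim_inverse_n'])
    show "\<exists>N. \<forall>L\<ge>N. measure (mlq_meas n) ?E \<le> 1 / real L" using le by (intro exI[of _ 1]) auto
  qed
  then have "measure (mlq_meas n) ?E = 0" by (simp add: antisym)
  then have "emeasure (mlq_meas n) ?E = 0" by (simp add: emeasure_eq_measure)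
  then show ?thesis using E by (intro AE_I[where N = ?E]) auto
qed

lemma AE_inj_coordinates: "AE u in mlq_meas n. inj_on u (mlq_index n)"
proof -
  have "AE u in mlq_meas n. \<forall>p\<in>mlq_index n. \<forall>q\<in>mlq_index n. p \<noteq> q \<longrightarrow> u p \<noteq> u q"
  proof (intro AE_finite_allI finite_mlq_index)
    fix p q assume "p \<in> mlq_index n" "q \<in> mlq_index n"
    then show "AE u in mlq_meas n. p \<noteq> q \<longrightarrow> u p \<noteq> u q"
      using AE_coordinates_distinct[of p n q] by (cases "p = q") auto
  qed
  then show ?thesis by (rule AE_mp) (auto simp: inj_on_def)
qed

section \<open>The continuous TASEP\<close>

lemma tendsto_fun_real:
  fixes X :: "nat \<Rightarrow> nat \<Rightarrow> real"
  assumes "\<And>k. (\<lambda>m. X m k) \<longlonglongrightarrow> l k" shows "X \<longlonglongrightarrow> l"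
proof -
  have "limitin (product_topology (\<lambda>_. euclidean) UNIV) X l sequentially"
    unfolding limitin_componentwise using assms by (simp add: limitin_canonical_iff)
  then show ?thesis by (simp add: euclidean_product_topology limitin_canonical_iff)
qed

text \<open>Closing the interval to \<open>[0,1]\<close> and pinning the remaining coordinates to
  \<open>undefined\<close> gives a compact product containing all configurations.\<close>

lemma ring_continuous_bounded:
  assumes f: "ring_continuous n f"
  shows "\<exists>B. \<forall>x\<in>PiE {1..n} (\<lambda>_. {0..<1}). \<bar>f x\<bar> \<le> B"
proof -
  let ?K = "PiE UNIV (\<lambda>k. if k \<in> {1..n} then {0..1} else {undefined}) :: (nat \<Rightarrow> real) set"
  have "compactin (product_topology (\<lambda>_. euclidean) UNIV) ?K"
    unfolding compactin_PiE by (simp add: compactin_euclidean_iff)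
  then have "compact ?K" by (simp add: euclidean_product_topology compactin_euclidean_iff)
  then have "compact (f ` ?K)"
    using f by (intro compact_continuous_image) (auto simp: ring_continuous_def intro: continuous_on_subset)
  then obtain B where B: "\<And>y. y \<in> f ` ?K \<Longrightarrow> \<bar>y\<bar> \<le> B"
    using compact_imp_bounded bounded_iff real_norm_def by metis
  have "x \<in> ?K" if "x \<in> PiE {1..n} (\<lambda>_. {0..<1})" for x
    using that by (auto simp: PiE_iff extensional_def less_imp_le)
  then have "\<bar>f x\<bar> \<le> B" if "x \<in> PiE {1..n} (\<lambda>_. {0..<1})" for x
    using that by (intro B imageI)
  then show ?thesis by blast
qed

lemma frac_diff_less_iff:
  fixes a b c :: real
  assumes "a \<in> {0..<1}" "b \<in> {0..<1}" "c \<in> {0..<1}" "c \<noteq> a" "c \<noteq> b"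
  shows "frac (b - a) < frac (c - a) \<longleftrightarrow> c \<notin> cyc_int a b"
proof -
  have fr: "frac (y - a) = (if a \<le> y then y - a else y - a + 1)" if "y \<in> {0..<1}" for y
    using that assms(1) by (auto simp: frac_unique_iff)
  show ?thesis using assms unfolding fr[OF assms(2)] fr[OF assms(3)] by (auto simp: cyc_int_def)
qed

lemma label_site_cong:
  assumes "\<And>i. i \<in> {1..n} \<Longrightarrow> R i = R' i"
  shows "label_site R n k = label_site R' n k"
proof -
  have "mlq R n l = mlq R' n l" for l using assms by (rule mlq_cong)
  then show ?thesis unfolding label_site_def by simp
qed

lemma mlq_rows_discretise:
  "r \<in> {1..n} \<Longrightarrow> mlq_rows n (discretise n L u) r = cell L ` mlq_rows n u r"
proof -
  assume r: "r \<in> {1..n}"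
  have "discretise n L u p = cell L (u p)" if "p \<in> {r} \<times> {1..r}" for p
    using that r by (auto simp: discretise_def mlq_index_def)
  then have "discretise n L u ` ({r} \<times> {1..r}) = (\<lambda>p. cell L (u p)) ` ({r} \<times> {1..r})"
    by (intro image_cong refl)
  then show ?thesis using r by (simp add: mlq_rows_def image_image)
qed

section \<open>Multiline queues of generic points\<close>

locale generic_points =
  fixes n :: nat and u :: "nat \<times> nat \<Rightarrow> real"
  assumes u: "u \<in> space (mlq_meas n)" and inj: "inj_on u (mlq_index n)"
begin

abbreviation "points \<equiv> u ` mlq_index n"
abbreviation "R \<equiv> mlq_rows n u"

lemma points: "finite points" "points \<subseteq> {0..<1}"
  using u by (auto simp: mlq_meas_def space_PiM PiE_iff)

lemma row_points: "r \<in> {1..n} \<Longrightarrow> R r \<subseteq> points"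
  by (auto simp: mlq_rows_def mlq_index_def)

lemma finite_row: "r \<in> {1..n} \<Longrightarrow> finite (R r)"
  by (simp add: mlq_rows_def)

lemma card_row: "r \<in> {1..n} \<Longrightarrow> card (R r) = r"
proof -
  assume r: "r \<in> {1..n}"
  have "inj_on u ({r} \<times> {1..r})" by (rule inj_on_subset[OF inj]) (use r in \<open>auto simp: mlq_index_def\<close>)
  then show ?thesis using r by (simp add: mlq_rows_def card_image card_cartesian_product)
qed

lemma embedding_eventually: "eventually (\<lambda>L. order_embedding_on points (cell L)) sequentially"
  by (rule cell_embedding_eventually[OF points])

lemma discrete_rows:
  assumes L: "0 < L" and e: "order_embedding_on points (cell L)"
  shows "mlq_rows n (discretise n L u) \<in> row_space L (\<lambda>i. i) n"
proof -
  have "mlq_rows n (discretise n L u) r \<in> subsets_of_card L r" if r: "r \<in> {1..n}" for r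
  proof -
    have "card (cell L ` R r) = r"
      using card_row[OF r] inj_on_subset[OF order_embedding_on_inj[OF e] row_points[OF r]] by (simp add: card_image)
    moreover have "cell L ` R r \<subseteq> {..<L}"
      using row_points[OF r] points(2) cell_less[OF _ _ L] by fastforce
    ultimately show ?thesis by (simp add: mlq_rows_discretise[OF r] subsets_of_card_def)
  qed
  then show ?thesis by (auto simp: row_space_def mlq_rows_def)
qed

lemma discrete_mlq:
  assumes e: "order_embedding_on points (cell L)"
  shows "mlq (mlq_rows n (discretise n L u)) n k = cell L ` mlq R n k"
proof -
  have "mlq (mlq_rows n (discretise n L u)) n k = mlq (\<lambda>r. cell L ` R r) n k"
    by (rule mlq_cong) (rule mlq_rows_discretise)
  also have "\<dots> = cell L ` mlq R n k" by (rule mlq_image[OF e row_points])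
  finally show ?thesis .
qed

lemma mlq_points: "1 \<le> n \<Longrightarrow> mlq R n k \<subseteq> points"
  using mlq_subset_row[of n R k] row_points[of n] by auto

text \<open>The sizes were computed for rows on finitely many sites; a sufficiently fine grid
  transports them to real points.\<close>

lemma card_mlq: "k \<le> n \<Longrightarrow> card (mlq R n k) = k"
proof (cases "n = 0")
  case False
  assume k: "k \<le> n"
  have "eventually (\<lambda>L. order_embedding_on points (cell L) \<and> 2 \<le> L) sequentially"
    using embedding_eventually eventually_ge_at_top by (rule eventually_conj)
  then obtain L where L: "order_embedding_on points (cell L)" "2 \<le> L"
    using eventually_happens'[OF sequentially_bot] by blast
  have "card (cell L ` mlq R n k) = k"
    using mlq_row_space[OF L(2) _ discrete_rows[OF _ L(1)], of k] L(2) k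
    unfolding discrete_mlq[OF L(1)] by (auto simp: mono_def)
  moreover have "inj_on (cell L) (mlq R n k)"
    by (rule inj_on_subset[OF order_embedding_on_inj[OF L(1)] mlq_points]) (use False in simp)
  ultimately show ?thesis by (simp add: card_image)
qed simp

lemma label_site_point: "k \<in> {1..n} \<Longrightarrow> label_site R n k \<in> points"
  using mlq_eq_insert_label_site(1)[OF finite_row card_mlq, of k] mlq_points[of k] by auto

lemma label_site_unit: "k \<in> {1..n} \<Longrightarrow> label_site R n k \<in> {0..<1}"
  using label_site_point points by blast

lemma discrete_label_site:
  assumes e: "order_embedding_on points (cell L)" and k: "k \<in> {1..n}"
  shows "label_site (mlq_rows n (discretise n L u)) n k = cell L (label_site R n k)"
proof -
  have "label_site (mlq_rows n (discretise n L u)) n k = label_site (\<lambda>r. cell L ` R r) n k"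
    by (rule label_site_cong) (rule mlq_rows_discretise)
  also have "\<dots> = cell L (label_site R n k)"
    by (rule label_site_image[OF e row_points finite_row card_mlq]) (use k in auto)
  finally show ?thesis .
qed

lemma discrete_label_site_limit:
  assumes k: "k \<in> {1..n}"
  shows "(\<lambda>L. real (label_site (mlq_rows n (discretise n L u)) n k) / real L) \<longlonglongrightarrow> label_site R n k"
proof -
  have "(\<lambda>L. real (cell L (label_site R n k)) / real L) \<longlonglongrightarrow> label_site R n k"
    using label_site_unit[OF k] by (intro cell_limit) simp
  moreover have "eventually (\<lambda>L. real (cell L (label_site R n k)) / real L =
      real (label_site (mlq_rows n (discretise n L u)) n k) / real L) sequentially"
    using embedding_eventually by eventually_elim (simp only: discrete_label_site[OF _ k])
  ultimately show ?thesis by (rule Lim_transform_eventually)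
qed

lemma immediately_left_iff_adjacent:
  assumes i: "i \<in> {1..n}" and j: "j \<in> {1..n}" and ij: "i \<noteq> j"
  shows "immediately_left n i j (\<lambda>k\<in>{1..n}. label_site R n k) \<longleftrightarrow>
    adjacent (R n) (label_site R n i) (label_site R n j)"
proof -
  let ?s = "label_site R n"
  have n: "1 \<le> n" using i by simp
  have Rn: "R n = ?s ` {1..n}"
    using mlq_eq_label_sites[OF finite_row card_mlq, of n] mlq_top[of n n R] n by simp
  have inj_s: "inj_on ?s {1..n}" by (rule label_site_inj[OF finite_row card_mlq])
  have ne: "?s k \<noteq> ?s l" if "k \<in> {1..n}" "l \<in> {1..n}" "k \<noteq> l" for k l
    using inj_s that by (auto dest: inj_onD)
  have "immediately_left n i j (\<lambda>k\<in>{1..n}. ?s k) \<longleftrightarrow> (\<forall>k\<in>{1..n} - {i, j}. ?s k \<notin> cyc_int (?s i) (?s j))"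
    unfolding immediately_left_def
    using i j ne label_site_unit by (intro ball_cong refl) (auto simp: frac_diff_less_iff)
  also have "\<dots> \<longleftrightarrow> R n \<inter> cyc_int (?s i) (?s j) = {?s i, ?s j}"
  proof -
    have "?s i \<in> cyc_int (?s i) (?s j)" "?s j \<in> cyc_int (?s i) (?s j)" by (auto simp: cyc_int_def)
    then show ?thesis unfolding Rn using i j ne by blast
  qed
  finally show ?thesis using ne[OF j i] ij by (simp add: adjacent_def)
qed

text \<open>Adjacency is a matter of order, hence preserved exactly once the cells separate the
  points. This takes the place of continuity of the event.\<close>

lemma adjacent_eventually:
  assumes i: "i \<in> {1..n}" and j: "j \<in> {1..n}"
  shows "eventually (\<lambda>L. adjacent (mlq_rows n (discretise n L u) n)
      (label_site (mlq_rows n (discretise n L u)) n i) (label_site (mlq_rows n (discretise n L u)) n j) \<longleftrightarrow>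
      adjacent (R n) (label_site R n i) (label_site R n j)) sequentially"
  using embedding_eventually
proof eventually_elim
  case (elim L)
  have n: "n \<in> {1..n}" using i by simp
  show ?case
    unfolding discrete_label_site[OF elim i] discrete_label_site[OF elim j] mlq_rows_discretise[OF n]
    by (rule adjacent_image[OF elim row_points[OF n] label_site_point[OF i] label_site_point[OF j]])
qed

end

lemma AE_generic_points: "AE u in mlq_meas n. generic_points n u"
  using AE_inj_coordinates AE_space by eventually_elim (simp add: generic_points_def)

lemma AE_discrete_rows:
  "AE u in mlq_meas n. eventually (\<lambda>L. mlq_rows n (discretise n L u) \<in> row_space L (\<lambda>i. i) n) sequentially"
  using AE_generic_points
proof eventually_elim
  case (elim u)
  interpret generic_points n u by fact
  show ?case using embedding_eventually eventually_gt_at_top[of 0]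
    by eventually_elim (rule discrete_rows)
qed

text \<open>
  Defined as a limit of the discretisations, which makes measurability immediate; for generic
  points the limit exists and lies in \<open>[0,1)\<close>.
\<close>

definition ring_config :: "nat \<Rightarrow> (nat \<times> nat \<Rightarrow> real) \<Rightarrow> nat \<Rightarrow> real" where
  "ring_config n u = (\<lambda>k\<in>{1..n}.
     let x = lim (\<lambda>L. real (label_site (mlq_rows n (discretise n (Suc L) u)) n k) / real (Suc L))
     in if 0 \<le> x \<and> x < 1 then x else 0)"

lemma ring_config_eq:
  assumes "generic_points n u"
  shows "ring_config n u = (\<lambda>k\<in>{1..n}. label_site (mlq_rows n u) n k)"
proof -
  interpret generic_points n u by fact
  have "lim (\<lambda>L. real (label_site (mlq_rows n (discretise n (Suc L) u)) n k) / real (Suc L)) = label_site R n k"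
    if "k \<in> {1..n}" for k
    using LIMSEQ_Suc[OF discrete_label_site_limit[OF that]] by (rule limI)
  then show ?thesis using label_site_unit by (auto simp: ring_config_def Let_def)
qed

lemma ring_config_measurable: "ring_config n \<in> measurable (mlq_meas n) (ring_space n)"
  unfolding ring_space_def ring_config_def[abs_def]
proof (rule measurable_restrict)
  fix k assume "k \<in> {1..n}"
  let ?l = "\<lambda>u. lim (\<lambda>L. real (label_site (mlq_rows n (discretise n (Suc L) u)) n k) / real (Suc L))"
  have l[measurable]: "?l \<in> borel_measurable (mlq_meas n)"
    using borel_measurable_discretise[of "Suc _", where \<phi> = "\<lambda>g. real (label_site (mlq_rows n g) n k) / real (Suc _)"]
    by (intro borel_measurable_lim_metric) simp
  have "(\<lambda>u. if 0 \<le> ?l u \<and> ?l u < 1 then ?l u else 0) \<in> borel_measurable (mlq_meas n)"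
    by measurable
  then show "(\<lambda>u. let x = ?l u in if 0 \<le> x \<and> x < 1 then x else 0) \<in> measurable (mlq_meas n) (restrict_space borel {0..<1})"
    unfolding Let_def by (intro measurable_restrict_space2) auto
qed

definition ring_law :: "nat \<Rightarrow> (nat \<Rightarrow> real) measure" where
  "ring_law n = distr (mlq_meas n) (ring_space n) (ring_config n)"

lemma row_space_le:
  assumes "R \<in> row_space L (\<lambda>i. i) n" shows "n \<le> L"
proof (cases "n = 0")
  case False
  then have "R n \<subseteq> {..<L}" "card (R n) = n"
    using assms by (auto simp: row_space_def PiE_iff subsets_of_card_def)
  then show ?thesis using card_mono[of "{..<L}" "R n"] by simp
qed simp

text \<open>For generic points the rescaled sites converge to the labelled points, so a bounded
  continuous \<open>f\<close> satisfies the hypotheses of \<open>row_space_avg_limit\<close>; the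
  averages there are the TASEP expectations by \<open>tasep_expectation\<close>.\<close>

lemma is_continuous_tasep_ring_law:
  assumes n: "2 \<le> n" shows "is_continuous_tasep n (ring_law n)"
  unfolding is_continuous_tasep_def
proof (intro conjI allI impI)
  interpret prob_space "mlq_meas n" by (rule prob_space_mlq_meas)
  show "prob_space (ring_law n)"
    unfolding ring_law_def by (rule prob_space_distr[OF ring_config_measurable])
  show "sets (ring_law n) = sets (ring_space n)" by (simp add: ring_law_def)
  fix f assume f: "ring_continuous n f"
  let ?X = "\<lambda>L R. \<lambda>k\<in>{1..n}. real (label_site R n k) / real L"
  obtain B where B: "\<And>x. x \<in> PiE {1..n} (\<lambda>_. {0..<1}) \<Longrightarrow> \<bar>f x\<bar> \<le> B"
    using ring_continuous_bounded[OF f] by blast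
  have fm: "f \<in> borel_measurable (ring_space n)" by (rule ring_continuous_borel_measurable[OF f])
  have "(\<lambda>L. (\<Sum>R\<in>row_space L (\<lambda>i. i) n. f (?X L R)) / real (card (row_space L (\<lambda>i. i) n)))
    \<longlonglongrightarrow> integral\<^sup>L (mlq_meas n) (\<lambda>u. f (ring_config n u))"
  proof (rule row_space_avg_limit[where B = B and \<Phi> = "\<lambda>L R. f (?X L R)"])
    fix L R assume R: "R \<in> row_space L (\<lambda>i. i) n"
    have L: "2 \<le> L" using row_space_le[OF R] n by simp
    show "\<bar>f (?X L R)\<bar> \<le> B" using label_site_less[OF L R] L by (intro B) auto
  next
    show "(\<lambda>u. f (ring_config n u)) \<in> borel_measurable (mlq_meas n)"
      using ring_config_measurable fm by (rule measurable_compose)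
    show "AE u in mlq_meas n. (\<lambda>L. f (?X L (mlq_rows n (discretise n L u)))) \<longlonglongrightarrow> f (ring_config n u)"
      using AE_generic_points
    proof eventually_elim
      case (elim u)
      interpret generic_points n u by fact
      have "(\<lambda>L. ?X L (mlq_rows n (discretise n L u))) \<longlonglongrightarrow> ring_config n u"
      proof (rule tendsto_fun_real)
        fix k
        show "(\<lambda>L. ?X L (mlq_rows n (discretise n L u)) k) \<longlonglongrightarrow> ring_config n u k"
          using discrete_label_site_limit[of k] unfolding ring_config_eq[OF elim] by (cases "k \<in> {1..n}") auto
      qed
      moreover have "isCont f (ring_config n u)"
        using f by (simp add: ring_continuous_def continuous_on_eq_continuous_at)
      ultimately show ?case by (rule isCont_tendsto_compose[rotated])
    qed
  qed (rule AE_discrete_rows)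
  also have "integral\<^sup>L (mlq_meas n) (\<lambda>u. f (ring_config n u)) = integral\<^sup>L (ring_law n) f"
    unfolding ring_law_def by (rule integral_distr[OF ring_config_measurable fm, symmetric])
  finally have lim: "(\<lambda>L. (\<Sum>R\<in>row_space L (\<lambda>i. i) n. f (?X L R)) / real (card (row_space L (\<lambda>i. i) n)))
    \<longlonglongrightarrow> integral\<^sup>L (ring_law n) f" .
  have "eventually (\<lambda>L. (\<Sum>R\<in>row_space L (\<lambda>i. i) n. f (?X L R)) / real (card (row_space L (\<lambda>i. i) n)) =
    measure_pmf.expectation (tasep_pmf n L) (\<lambda>w. f (rescaled_positions n w))) sequentially"
    using eventually_ge_at_top[of "max 3 n"] by eventually_elim (simp add: tasep_expectation)
  with lim show "(\<lambda>L. measure_pmf.expectation (tasep_pmf n L) (\<lambda>w. f (rescaled_positions n w)))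
      \<longlonglongrightarrow> integral\<^sup>L (ring_law n) f"
    by (rule Lim_transform_eventually)
qed

lemma immediately_left_sets:
  assumes "i \<in> {1..n}" "j \<in> {1..n}"
  shows "{x \<in> space (ring_space n). immediately_left n i j x} \<in> sets (ring_space n)"
proof -
  have c: "(\<lambda>x. x k) \<in> borel_measurable (ring_space n)" if "k \<in> {1..n}" for k
    using measurable_component_singleton[OF that, of "\<lambda>_. restrict_space borel {0..<1::real}"]
      measurable_restrict_space2_iff unfolding ring_space_def by blast
  have fr: "(\<lambda>x. frac (x k - x i)) \<in> borel_measurable (ring_space n)" if "k \<in> {1..n}" for k
  proof -
    have "(frac :: real \<Rightarrow> real) \<in> borel_measurable borel" unfolding frac_def[abs_def] by measurable
    with borel_measurable_diff[OF c[OF that] c[OF assms(1)]] show ?thesis by (rule measurable_compose)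
  qed
  show ?thesis unfolding immediately_left_def
  proof (rule sets.sets_Collect_finite_All)
    fix k assume "k \<in> {1..n} - {i, j}"
    then show "{x \<in> space (ring_space n). frac (x j - x i) < frac (x k - x i)} \<in> sets (ring_space n)"
      by (intro borel_measurable_less fr assms(2)) simp
  qed auto
qed

theorem theorem1p1:
  fixes n i j :: nat
  assumes "n \<ge> 2" and "1 \<le> j" and "j < i" and "i \<le> n"
  shows "two_point_correlation i j n =
    (if i < n then
       real n / real ((n + j) choose 2) - real n / real ((n + i) choose 2)
     else
       real n * (real j + 1) / real ((n + j) choose 2)
       - real n * (real j - 1) / real ((n + j - 1) choose 2)
       - real n / real ((2 * n) choose 2))"
proof (rule LIMSEQ_unique[OF _ adjacent_avg_limit[OF assms(2-4)]])
  interpret prob_space "mlq_meas n" by (rule prob_space_mlq_meas)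
  have i: "i \<in> {1..n}" and j: "j \<in> {1..n}" and ij: "i \<noteq> j" using assms by auto
  let ?E = "{x \<in> space (ring_space n). immediately_left n i j x}"
  have E: "?E \<in> sets (ring_space n)" by (rule immediately_left_sets[OF i j])
  \<comment> \<open>The averages whose limit was computed combinatorially are now shown to converge
    to the probability under the limit law; uniqueness of limits gives the formula.\<close>
  have "(\<lambda>L. (\<Sum>R\<in>row_space L (\<lambda>i. i) n. of_bool (adjacent (R n) (label_site R n i) (label_site R n j)))
      / real (card (row_space L (\<lambda>i. i) n)))
    \<longlonglongrightarrow> integral\<^sup>L (mlq_meas n) (\<lambda>u. indicator ?E (ring_config n u))"
  proof (rule row_space_avg_limit[where B = 1])
    show "(\<lambda>u. indicator ?E (ring_config n u) :: real) \<in> borel_measurable (mlq_meas n)"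
      using ring_config_measurable borel_measurable_indicator[OF E] by (rule measurable_compose)
    show "AE u in mlq_meas n. (\<lambda>L. of_bool (adjacent (mlq_rows n (discretise n L u) n)
      (label_site (mlq_rows n (discretise n L u)) n i) (label_site (mlq_rows n (discretise n L u)) n j)))
      \<longlonglongrightarrow> (indicator ?E (ring_config n u) :: real)"
      using AE_generic_points
    proof eventually_elim
      case (elim u)
      interpret generic_points n u by fact
      have "ring_config n u \<in> space (ring_space n)"
        using measurable_space[OF ring_config_measurable u] .
      then have "indicator ?E (ring_config n u) =
          (of_bool (adjacent (R n) (label_site R n i) (label_site R n j)) :: real)"
        unfolding ring_config_eq[OF elim] using immediately_left_iff_adjacent[OF i j ij]
        by (simp add: indicator_def)
      then show ?case
        using adjacent_eventually[OF i j] by (intro tendsto_eventually) (auto elim!: eventually_mono)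
    qed
  qed (auto intro: AE_discrete_rows)
  also have "integral\<^sup>L (mlq_meas n) (\<lambda>u. indicator ?E (ring_config n u)) =
      integral\<^sup>L (ring_law n) (indicator ?E :: _ \<Rightarrow> real)"
    unfolding ring_law_def
    by (rule integral_distr[OF ring_config_measurable borel_measurable_indicator[OF E], symmetric])
  also have "\<dots> = two_point_correlation i j n"
  proof -
    have "continuous_tasep n = ring_law n"
      by (rule is_continuous_tasep_unique[OF is_continuous_tasep_ring_law[OF assms(1)]])
    moreover have "sets (ring_law n) = sets (ring_space n)" "space (ring_law n) = space (ring_space n)"
      by (simp_all add: ring_law_def)
    ultimately show ?thesis using E by (simp add: two_point_correlation_def)
  qed
  finally show "(\<lambda>L. (\<Sum>R\<in>row_space L (\<lambda>i. i) n. of_bool (adjacent (R n) (label_site R n i) (label_site R n j)))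
      / real (card (row_space L (\<lambda>i. i) n))) \<longlonglongrightarrow> two_point_correlation i j n" .
qed

end
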